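(* Let $k\geq 1$ and let $G$ be a profinite group. Then $\gamma_k(G)$ is finite if and only if the cardinality of the set of uniform $k$-step commutators in $G$ is less than $2^{\aleph_0}$.
   Context: Subgroups of profinite groups are closed unless otherwise specified; in particular $\gamma_k(G)$, the $k$-th term of the lower central series of a profinite group $G$, is the closed subgroup generated by all values $[g_1,\dots,g_k]$, $g_i\in G$. Commutators: $[x,y]=x^{-1}y^{-1}xy$, $[x_1,\dots,x_k]=[[x_1,\dots,x_{k-1}],x_k]$ (left-normed), and $[x_1]=x_1$. For $g$ in a profinite group, $|g|$ is the order (a Steinitz number) of the procyclic subgroup topologically generated by $g$, and $\pi(g)$ is the set of prime divisors of $|g|$. A uniform $k$-step commutator of $G$ is an element of the form $[x_1,\dots,x_k]$ with $x_1,\dots,x_k\in G$ and $\pi(x_1)=\dots=\pi(x_k)$. *)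

theory Defs
  imports
    "HOL-Analysis.Analysis"
    "HOL-Algebra.Coset"
    "HOL-Algebra.Generated_Groups"
    "HOL-Library.Equipollence"
begin

locale topological_group = group G for G :: "('a, 'b) monoid_scheme" (structure) +
  fixes T :: "'a topology"
  assumes topspace_eq_carrier: "topspace T = carrier G"
    and continuous_mult: "continuous_map (prod_topology T T) T (\<lambda>(x, y). x \<otimes> y)"
    and continuous_inv: "continuous_map T T (\<lambda>x. inv x)"

locale profinite_group = topological_group +
  assumes compact: "compact_space T"
    and Hausdorff: "Hausdorff_space T"
    and totally_disconnected:
      "\<And>x. x \<in> carrier G \<Longrightarrow> connected_component_of_set T x = {x}"

(* In a topological group the closure of a subgroup is a subgroup, so this is the least
   closed subgroup containing S. *)
definition closed_generate :: "('a, 'b) monoid_scheme \<Rightarrow> 'a topology \<Rightarrow> 'a set \<Rightarrow> 'a set" where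
  "closed_generate G T S = T closure_of (generate G S)"

(* A Steinitz number, i.e. a formal product of prime powers with exponents in {0, 1, ..., \<infinity>},
   is given by its exponent function (0 off the primes); lcm is the pointwise supremum. *)
type_synonym steinitz = "nat \<Rightarrow> enat"

(* The order of a profinite group: the lcm of the indices of its open normal subgroups. These
   indices are finite by compactness, so card does not take its junk value. *)
definition steinitz_order :: "('a, 'b) monoid_scheme \<Rightarrow> 'a topology \<Rightarrow> steinitz" where
  "steinitz_order G T p =
     (if prime p
      then (SUP U \<in> {U. U \<lhd> G \<and> openin T U}. enat (multiplicity p (card (rcosets\<^bsub>G\<^esub> U))))
      else 0)"

definition element_order :: "('a, 'b) monoid_scheme \<Rightarrow> 'a topology \<Rightarrow> 'a \<Rightarrow> steinitz" where
  "element_order G T g =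
     (let H = closed_generate G T {g}
      in steinitz_order (G\<lparr>carrier := H\<rparr>) (subtopology T H))"

definition element_primes :: "('a, 'b) monoid_scheme \<Rightarrow> 'a topology \<Rightarrow> 'a \<Rightarrow> nat set" where
  "element_primes G T g = {p. prime p \<and> element_order G T g p \<noteq> 0}"

definition commutator :: "('a, 'b) monoid_scheme \<Rightarrow> 'a \<Rightarrow> 'a \<Rightarrow> 'a" where
  "commutator G x y = inv\<^bsub>G\<^esub> x \<otimes>\<^bsub>G\<^esub> inv\<^bsub>G\<^esub> y \<otimes>\<^bsub>G\<^esub> x \<otimes>\<^bsub>G\<^esub> y"

(* Left-normed; meaningful for nonempty lists only. *)
definition long_commutator :: "('a, 'b) monoid_scheme \<Rightarrow> 'a list \<Rightarrow> 'a" where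
  "long_commutator G xs = foldl (commutator G) (hd xs) (tl xs)"

definition lower_central :: "('a, 'b) monoid_scheme \<Rightarrow> 'a topology \<Rightarrow> nat \<Rightarrow> 'a set" where
  "lower_central G T k =
     closed_generate G T {long_commutator G xs | xs. length xs = k \<and> set xs \<subseteq> carrier G}"

definition uniform_commutators :: "('a, 'b) monoid_scheme \<Rightarrow> 'a topology \<Rightarrow> nat \<Rightarrow> 'a set" where
  "uniform_commutators G T k =
     {long_commutator G xs | xs. length xs = k \<and> set xs \<subseteq> carrier G \<and>
        (\<forall>x \<in> set xs. \<forall>y \<in> set xs. element_primes G T x = element_primes G T y)}"

end

theory Submission
  imports Defs "HOL-Algebra.Multiplicative_Group"
begin

text \<open>A nonempty compact Hausdorff space with fewer than continuum many points has an isolated point.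
  Hence a continuous word whose values are uniform commutators is constant on a box of cosets of
  some open normal subgroup, and the centre of the box can be taken in prescribed dense sets.
  Applied to conjugation, this gives every uniform commutator an open centraliser. Conjugates of one
  element have the same primes, so commutators of conjugates, and Engel words, are available; with
  box centres of open centraliser they yield an open normal pronilpotent subgroup \<open>N\<close>. Commutators of
  \<open>q\<close>-elements are uniform too, and for each prime \<open>q\<close> they show that some open subgroup of \<open>N\<close> has
  trivial commutators \<open>[y, s\<^sub>1, \<dots>, s\<^sub>m]\<close> for \<open>m = k - 1\<close>, \<open>y\<close> and \<open>s\<^sub>i\<close> \<open>q\<close>-elements, and commuting \<open>y\<close> and
  \<open>s\<close> of orders prime to and powers of \<open>q\<close>. Only finitely many primes need shrinking \<open>N\<close>, since
  nontrivial commutators in \<open>N\<close> for infinitely many primes can be multiplied together into continuum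
  many uniform ones. So the \<open>m\<close>-th term of the upper central series is open, and Baer's theorem
  applies.\<close>

subsection \<open>Conjugation and commutators\<close>

text \<open>A commutator with arbitrary entries is usually not uniform, so local constancy is
  available only for words whose entries are forced to share their primes, over closed sets of
  tuples. Constancy on a box says nothing yet about the value at its centre. If the centre commutes
  with the displacements, the word is the product of its values at the centre and at the
  displacement, and constancy makes the latter trivial. Such centres are dense only in the closure
  \<open>Fbar\<close> of \<open>FC\<close>. This explains the detour: modulo \<open>Fbar\<close>
  uniform commutators vanish, inside \<open>Fbar\<close> good centres are available, and an Engel
  condition of an open subgroup on \<open>Fbar\<close> glues the two layers. The
  \<open>q\<close>-elements offer no commuting centres and form no subgroup. But near each of them
  they fill a single coset of the normal \<open>q\<close>-part of \<open>N\<close>, so there the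
  centre of the first entry is divided out and the other entries are moved to prescribed values one
  at a time. Compactness of the set of \<open>q\<close>-elements then makes the open subgroup
  uniform.\<close>

definition conjg :: "('a, 'b) monoid_scheme \<Rightarrow> 'a \<Rightarrow> 'a \<Rightarrow> 'a" where
  "conjg G g x = inv\<^bsub>G\<^esub> g \<otimes>\<^bsub>G\<^esub> x \<otimes>\<^bsub>G\<^esub> g"

abbreviation lcomm :: "('a, 'b) monoid_scheme \<Rightarrow> 'a \<Rightarrow> 'a list \<Rightarrow> 'a" where
  "lcomm G \<equiv> foldl (commutator G)"

context group
begin

lemma inv_cancel [simp]:
  "x \<in> carrier G \<Longrightarrow> y \<in> carrier G \<Longrightarrow> inv x \<otimes> (x \<otimes> y) = y"
  "x \<in> carrier G \<Longrightarrow> y \<in> carrier G \<Longrightarrow> x \<otimes> (inv x \<otimes> y) = y"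
  by (simp_all flip: m_assoc)

text \<open>Identities between group words are proved by expanding both sides with
  \<open>word\<close> and cancelling neighbours with \<open>inv_cancel\<close>.\<close>

lemmas word = m_assoc inv_mult_group conjg_def commutator_def

lemma conjg_closed [simp, intro]:
  "g \<in> carrier G \<Longrightarrow> x \<in> carrier G \<Longrightarrow> conjg G g x \<in> carrier G"
  by (simp add: conjg_def)

lemma commutator_closed [simp, intro]:
  "x \<in> carrier G \<Longrightarrow> y \<in> carrier G \<Longrightarrow> commutator G x y \<in> carrier G"
  by (simp add: commutator_def)

lemma lcomm_closed [simp, intro]:
  "x \<in> carrier G \<Longrightarrow> set xs \<subseteq> carrier G \<Longrightarrow> lcomm G x xs \<in> carrier G"
  by (induction xs arbitrary: x) auto

lemma conjg_mult:
  "g \<in> carrier G \<Longrightarrow> x \<in> carrier G \<Longrightarrow> y \<in> carrier G \<Longrightarrow>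
   conjg G g (x \<otimes> y) = conjg G g x \<otimes> conjg G g y"
  by (simp add: word)

lemma conjg_conjg:
  "g \<in> carrier G \<Longrightarrow> h \<in> carrier G \<Longrightarrow> x \<in> carrier G \<Longrightarrow>
   conjg G g (conjg G h x) = conjg G (h \<otimes> g) x"
  by (simp add: word)

lemma conjg_one [simp]: "x \<in> carrier G \<Longrightarrow> conjg G \<one> x = x"
  by (simp add: word)

lemma conjg_of_one [simp]: "g \<in> carrier G \<Longrightarrow> conjg G g \<one> = \<one>"
  by (simp add: word)

lemma conjg_inv:
  "g \<in> carrier G \<Longrightarrow> x \<in> carrier G \<Longrightarrow> conjg G g (inv x) = inv (conjg G g x)"
  by (simp add: word)

lemma conjg_inv_cancel [simp]:
  "g \<in> carrier G \<Longrightarrow> x \<in> carrier G \<Longrightarrow> conjg G g (conjg G (inv g) x) = x"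
  "g \<in> carrier G \<Longrightarrow> x \<in> carrier G \<Longrightarrow> conjg G (inv g) (conjg G g x) = x"
  by (simp_all add: word)

lemma conjg_pow:
  "g \<in> carrier G \<Longrightarrow> x \<in> carrier G \<Longrightarrow> conjg G g (x [^] (n::nat)) = conjg G g x [^] n"
  by (induction n) (simp_all add: conjg_mult)

lemma conjg_eq_iff:
  assumes "g \<in> carrier G" "x \<in> carrier G"
  shows "conjg G g x = x \<longleftrightarrow> x \<otimes> g = g \<otimes> x"
proof -
  have "conjg G g x = x \<longleftrightarrow> g \<otimes> conjg G g x = g \<otimes> x"
    using assms by simp
  then show ?thesis
    using assms by (simp add: word)
qed

lemma commutator_eq_one_iff:
  assumes "x \<in> carrier G" "y \<in> carrier G"
  shows "commutator G x y = \<one> \<longleftrightarrow> x \<otimes> y = y \<otimes> x"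
proof -
  have "commutator G x y = \<one> \<longleftrightarrow> (y \<otimes> x) \<otimes> commutator G x y = (y \<otimes> x) \<otimes> \<one>"
    using assms by simp
  also have "(y \<otimes> x) \<otimes> commutator G x y = x \<otimes> y"
    using assms by (simp add: word)
  finally show ?thesis
    using assms by simp
qed

lemma commutator_conjg:
  "x \<in> carrier G \<Longrightarrow> y \<in> carrier G \<Longrightarrow> commutator G x y = inv x \<otimes> conjg G y x"
  by (simp add: word)

lemma conjg_commutator:
  "g \<in> carrier G \<Longrightarrow> x \<in> carrier G \<Longrightarrow> y \<in> carrier G \<Longrightarrow>
   conjg G g (commutator G x y) = commutator G (conjg G g x) (conjg G g y)"
  by (simp add: word)

lemma conjg_lcomm:
  "g \<in> carrier G \<Longrightarrow> x \<in> carrier G \<Longrightarrow> set xs \<subseteq> carrier G \<Longrightarrow>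
   conjg G g (lcomm G x xs) = lcomm G (conjg G g x) (map (conjg G g) xs)"
  by (induction xs arbitrary: x) (auto simp: conjg_commutator)

lemma commutator_mult_left:
  "x \<in> carrier G \<Longrightarrow> y \<in> carrier G \<Longrightarrow> z \<in> carrier G \<Longrightarrow>
   commutator G (x \<otimes> y) z = conjg G y (commutator G x z) \<otimes> commutator G y z"
  by (simp add: word)

lemma commutator_mult_right:
  "x \<in> carrier G \<Longrightarrow> y \<in> carrier G \<Longrightarrow> z \<in> carrier G \<Longrightarrow>
   commutator G x (y \<otimes> z) = commutator G x z \<otimes> conjg G z (commutator G x y)"
  by (simp add: word)

lemma commutator_inverse:
  "x \<in> carrier G \<Longrightarrow> y \<in> carrier G \<Longrightarrow> inv (commutator G x y) = commutator G y x"
  by (simp add: word)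

lemma commutator_one [simp]:
  "x \<in> carrier G \<Longrightarrow> commutator G \<one> x = \<one>"
  "x \<in> carrier G \<Longrightarrow> commutator G x \<one> = \<one>"
  by (simp_all add: word)

lemma lcomm_one [simp]: "set xs \<subseteq> carrier G \<Longrightarrow> lcomm G \<one> xs = \<one>"
  by (induction xs) auto

lemma lcomm_one_mem:
  "x \<in> carrier G \<Longrightarrow> set xs \<subseteq> carrier G \<Longrightarrow> \<one> \<in> set xs \<Longrightarrow> lcomm G x xs = \<one>"
  by (induction xs arbitrary: x) auto

lemma normal_conjg: "N \<lhd> G \<Longrightarrow> g \<in> carrier G \<Longrightarrow> x \<in> N \<Longrightarrow> conjg G g x \<in> N"
  by (simp add: conjg_def normal.inv_op_closed1)

lemma normal_in_carrier: "N \<lhd> G \<Longrightarrow> x \<in> N \<Longrightarrow> x \<in> carrier G"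
  by (meson normal_imp_subgroup subgroup.mem_carrier)

lemma normal_mult: "N \<lhd> G \<Longrightarrow> x \<in> N \<Longrightarrow> y \<in> N \<Longrightarrow> x \<otimes> y \<in> N"
  by (meson normal_imp_subgroup subgroup.m_closed)

lemma normal_inverse: "N \<lhd> G \<Longrightarrow> x \<in> N \<Longrightarrow> inv x \<in> N"
  by (meson normal_imp_subgroup subgroup.m_inv_closed)

lemma normal_one: "N \<lhd> G \<Longrightarrow> \<one> \<in> N"
  by (meson normal_imp_subgroup subgroup.one_closed)

lemma subgroup_pow: "subgroup N G \<Longrightarrow> x \<in> N \<Longrightarrow> x [^] (n::nat) \<in> N"
  by (induction n) (auto simp: subgroup.one_closed subgroup.m_closed)

lemma normal_pow: "N \<lhd> G \<Longrightarrow> x \<in> N \<Longrightarrow> x [^] (n::nat) \<in> N"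
  by (meson normal_imp_subgroup subgroup_pow)

lemma normal_commutator_left:
  "N \<lhd> G \<Longrightarrow> x \<in> N \<Longrightarrow> g \<in> carrier G \<Longrightarrow> commutator G x g \<in> N"
  by (simp add: commutator_conjg normal_in_carrier normal_conjg normal_inverse normal_mult)

lemma normal_commutator_right:
  "N \<lhd> G \<Longrightarrow> x \<in> N \<Longrightarrow> g \<in> carrier G \<Longrightarrow> commutator G g x \<in> N"
  by (metis commutator_inverse normal_commutator_left normal_in_carrier normal_inverse)

lemma normal_lcomm:
  "N \<lhd> G \<Longrightarrow> x \<in> N \<Longrightarrow> set xs \<subseteq> carrier G \<Longrightarrow> lcomm G x xs \<in> N"
  by (induction xs arbitrary: x) (auto simp: normal_commutator_left)

lemma subgroup_conjg:
  "subgroup N G \<Longrightarrow> g \<in> N \<Longrightarrow> x \<in> N \<Longrightarrow> conjg G g x \<in> N"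
  by (simp add: conjg_def subgroup.m_closed subgroup.m_inv_closed)

lemma subgroup_commutator:
  "subgroup N G \<Longrightarrow> x \<in> N \<Longrightarrow> y \<in> N \<Longrightarrow> commutator G x y \<in> N"
  by (simp add: commutator_def subgroup.m_closed subgroup.m_inv_closed)

lemma subgroup_lcomm:
  "subgroup N G \<Longrightarrow> x \<in> N \<Longrightarrow> set xs \<subseteq> N \<Longrightarrow> lcomm G x xs \<in> N"
  by (induction xs arbitrary: x) (auto simp: subgroup_commutator)

lemma normal_mem_mult_iff:
  assumes "N \<lhd> G" "x \<in> N" "y \<in> carrier G"
  shows "x \<otimes> y \<in> N \<longleftrightarrow> y \<in> N" "y \<otimes> x \<in> N \<longleftrightarrow> y \<in> N"
proof -
  note c = normal_in_carrier[OF assms(1)]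
  have "y = inv x \<otimes> (x \<otimes> y)" "y = (y \<otimes> x) \<otimes> inv x"
    using assms c by (auto simp: m_assoc)
  then show "x \<otimes> y \<in> N \<longleftrightarrow> y \<in> N" "y \<otimes> x \<in> N \<longleftrightarrow> y \<in> N"
    using assms by (metis normal_inverse normal_mult)+
qed

text \<open>The two normal factors need not intersect trivially, so this is an identity of elements,
  not a computation in a direct product.\<close>

lemma lcomm_mult_commuting:
  assumes D: "D \<lhd> G" and V: "V \<lhd> G" and comm: "\<And>d v. d \<in> D \<Longrightarrow> v \<in> V \<Longrightarrow> d \<otimes> v = v \<otimes> d"
    and "d \<in> D" "v \<in> V" "set zs \<subseteq> carrier G"
  shows "lcomm G (d \<otimes> v) zs = lcomm G d zs \<otimes> lcomm G v zs"
  using assms(4-6)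
proof (induction zs arbitrary: d v)
  case (Cons z zs)
  note [simp] = normal_in_carrier[OF D] normal_in_carrier[OF V]
  have z: "z \<in> carrier G" using Cons by simp
  have "conjg G v (commutator G d z) = commutator G d z"
    using Cons z by (subst conjg_eq_iff) (auto intro!: comm normal_commutator_left[OF D])
  then have "commutator G (d \<otimes> v) z = commutator G d z \<otimes> commutator G v z"
    using Cons z by (simp add: commutator_mult_left)
  then show ?case
    using Cons.IH[of "commutator G d z" "commutator G v z"] Cons.prems z
    by (simp add: normal_commutator_left[OF D] normal_commutator_left[OF V])
qed auto

text \<open>Companion of \<open>lcomm_mult_commuting\<close>. There the entries are arbitrary and
  normality keeps the two factors apart; here each entry is itself split between \<open>D\<close>
  and \<open>V\<close>, and closure of the two subgroups does that. It separates the centre of a box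
  from the displacement.\<close>

lemma lcomm_map2_mult_commuting:
  assumes D: "subgroup D G" and V: "subgroup V G"
    and comm: "\<And>d v. d \<in> D \<Longrightarrow> v \<in> V \<Longrightarrow> d \<otimes> v = v \<otimes> d"
    and "d \<in> D" "v \<in> V" "set ds \<subseteq> D" "set vs \<subseteq> V" "length ds = length vs"
  shows "lcomm G (d \<otimes> v) (map2 (\<otimes>) ds vs) = lcomm G d ds \<otimes> lcomm G v vs"
  using assms(8,4-7)
proof (induction ds vs arbitrary: d v rule: list_induct2)
  case (Cons e ds w vs)
  note [simp] = subgroup.mem_carrier[OF D] subgroup.mem_carrier[OF V]
  note cl = subgroup.m_closed[OF D] subgroup.m_inv_closed[OF D]
  have e: "e \<in> D" "w \<in> V" "d \<in> D" "v \<in> V" using Cons by auto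
  have c1: "conjg G v (commutator G d x) = commutator G d x" if "x \<in> D" for x
    using e that by (subst conjg_eq_iff) (auto intro!: comm subgroup_commutator[OF D])
  have c2: "commutator G d w = \<one>" "commutator G v e = \<one>"
    using e comm[of d w] comm[of e v] by (simp_all add: commutator_eq_one_iff)
  have "commutator G (d \<otimes> v) (e \<otimes> w) = commutator G d (e \<otimes> w) \<otimes> commutator G v (e \<otimes> w)"
  proof -
    have "commutator G d (e \<otimes> w) = commutator G d e"
    proof -
      have "conjg G w (commutator G d e) = commutator G d e"
        using e by (subst conjg_eq_iff) (auto intro!: comm subgroup_commutator[OF D])
      then show ?thesis using e c2 by (simp add: commutator_mult_right)
    qed
    then show ?thesis using e c1[of e] by (simp add: commutator_mult_left)
  qed
  also have "commutator G d (e \<otimes> w) = commutator G d e"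
  proof -
    have "conjg G w (commutator G d e) = commutator G d e"
      using e by (subst conjg_eq_iff) (auto intro!: comm subgroup_commutator[OF D])
    then show ?thesis using e c2 by (simp add: commutator_mult_right)
  qed
  also have "commutator G v (e \<otimes> w) = commutator G v w"
    using e c2 by (simp add: commutator_mult_right)
  finally have "commutator G (d \<otimes> v) (e \<otimes> w) = commutator G d e \<otimes> commutator G v w" .
  then show ?case
    using Cons.IH[of "commutator G d e" "commutator G v w"] Cons.prems e
    by (simp add: subgroup_commutator[OF D] subgroup_commutator[OF V])
qed auto

end

subsection \<open>Exponents modulo normal subgroups\<close>

lemma (in group_hom) hom_commutator:
  "x \<in> carrier G \<Longrightarrow> y \<in> carrier G \<Longrightarrow> h (commutator G x y) = commutator H (h x) (h y)"
  by (simp add: commutator_def)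

lemma (in group_hom) hom_lcomm:
  "x \<in> carrier G \<Longrightarrow> set xs \<subseteq> carrier G \<Longrightarrow> h (lcomm G x xs) = lcomm H (h x) (map h xs)"
  by (induction xs arbitrary: x) (auto simp: hom_commutator)

lemma (in group) mod_hom: "M \<lhd> G \<Longrightarrow> group_hom G (G Mod M) (\<lambda>x. M #> x)"
  by (simp add: group_hom.intro group_hom_axioms.intro normal.factorgroup_is_group
      normal.r_coset_hom_Mod is_group)

lemma (in group) mod_eq_one_iff:
  assumes "M \<lhd> G" "x \<in> carrier G"
  shows "M #> x = \<one>\<^bsub>G Mod M\<^esub> \<longleftrightarrow> x \<in> M"
  using assms by (metis coset_join1 coset_join2 normal_imp_subgroup one_FactGroup subgroup.subset)

context group
begin

lemma commutator_pow_right: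
  assumes "u \<in> carrier G" "y \<in> carrier G"
    and "commutator G u y \<otimes> y = y \<otimes> commutator G u y"
  shows "commutator G u (y [^] (j::nat)) = commutator G u y [^] j"
proof (induction j)
  case (Suc j)
  have "conjg G y (commutator G u y [^] j) = commutator G u y [^] j"
    using assms by (metis commutator_closed conjg_eq_iff conjg_pow)
  then show ?case
    using assms Suc by (simp add: commutator_mult_right) (metis commutator_closed nat_pow_Suc nat_pow_Suc2)
qed (use assms in simp)

text \<open>The order of an element of a profinite group is visible only modulo open normal
  subgroups, so exponents are counted modulo some \<open>M\<close> throughout; the claims are
  transported from \<open>G Mod M\<close>.\<close>

lemma mod_commutator_pow_right:
  assumes M: "M \<lhd> G" and "u \<in> carrier G" "y \<in> carrier G"
    and "commutator G (commutator G u y) y \<in> M"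
  shows "commutator G u (y [^] (j::nat)) \<in> M \<longleftrightarrow> commutator G u y [^] j \<in> M"
proof -
  interpret q: group_hom G "G Mod M" "\<lambda>x. M #> x" using M by (rule mod_hom)
  have "commutator (G Mod M) (M #> u) ((M #> y) [^]\<^bsub>G Mod M\<^esub> j) = commutator (G Mod M) (M #> u) (M #> y) [^]\<^bsub>G Mod M\<^esub> j"
  proof (rule q.H.commutator_pow_right)
    have "M #> commutator G (commutator G u y) y = \<one>\<^bsub>G Mod M\<^esub>"
      using assms by (subst mod_eq_one_iff) auto
    then have "commutator (G Mod M) (commutator (G Mod M) (M #> u) (M #> y)) (M #> y) = \<one>\<^bsub>G Mod M\<^esub>"
      using assms by (simp add: q.hom_commutator del: one_FactGroup)
    then show "commutator (G Mod M) (M #> u) (M #> y) \<otimes>\<^bsub>G Mod M\<^esub> (M #> y) = (M #> y) \<otimes>\<^bsub>G Mod M\<^esub> commutator (G Mod M) (M #> u) (M #> y)"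
      using assms by (subst (asm) q.H.commutator_eq_one_iff) auto
  qed (use assms in auto)
  then have "M #> commutator G u (y [^] j) = M #> (commutator G u y [^] j)"
    using assms by (simp add: q.hom_commutator q.hom_nat_pow)
  then show ?thesis
    using assms mod_eq_one_iff[OF M] by (metis commutator_closed nat_pow_closed)
qed

lemma mod_pow_mult:
  assumes M: "M \<lhd> G" and "x \<in> carrier G" "y \<in> carrier G" "commutator G x y \<in> M"
    and "x [^] (n::nat) \<in> M" "y [^] n \<in> M"
  shows "(x \<otimes> y) [^] n \<in> M"
proof -
  interpret q: group_hom G "G Mod M" "\<lambda>x. M #> x" using M by (rule mod_hom)
  have "M #> commutator G x y = \<one>\<^bsub>G Mod M\<^esub>"
    using assms by (subst mod_eq_one_iff) auto
  then have "commutator (G Mod M) (M #> x) (M #> y) = \<one>\<^bsub>G Mod M\<^esub>"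
    using assms by (simp add: q.hom_commutator del: one_FactGroup)
  then have "(M #> x) \<otimes>\<^bsub>G Mod M\<^esub> (M #> y) = (M #> y) \<otimes>\<^bsub>G Mod M\<^esub> (M #> x)"
    using assms by (subst (asm) q.H.commutator_eq_one_iff) auto
  then have "((M #> x) \<otimes>\<^bsub>G Mod M\<^esub> (M #> y)) [^]\<^bsub>G Mod M\<^esub> n = (M #> x) [^]\<^bsub>G Mod M\<^esub> n \<otimes>\<^bsub>G Mod M\<^esub> (M #> y) [^]\<^bsub>G Mod M\<^esub> n"
    using assms by (intro q.H.pow_mult_distrib) (auto simp del: mult_FactGroup)
  then have "M #> ((x \<otimes> y) [^] n) = (M #> (x [^] n)) \<otimes>\<^bsub>G Mod M\<^esub> (M #> (y [^] n))"
    using assms by (simp only: q.hom_nat_pow q.hom_mult m_closed q.hom_closed nat_pow_closed)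
  also have "\<dots> = \<one>\<^bsub>G Mod M\<^esub>"
    using assms mod_eq_one_iff[OF M] by (metis nat_pow_closed q.H.l_one q.H.one_closed)
  finally show ?thesis
    using assms by (subst (asm) mod_eq_one_iff) auto
qed

lemma mod_pow_mult_normal:
  assumes M: "M \<lhd> G" and "x \<in> carrier G" "y \<in> M" "x [^] (n::nat) \<in> M"
  shows "(x \<otimes> y) [^] n \<in> M" "(y \<otimes> x) [^] n \<in> M"
proof -
  have y: "y \<in> carrier G" using assms by (simp add: normal_in_carrier)
  show "(x \<otimes> y) [^] n \<in> M"
    using assms y by (intro mod_pow_mult normal_pow[OF M, of y] normal_commutator_right)
  show "(y \<otimes> x) [^] n \<in> M"
    using assms y by (intro mod_pow_mult normal_pow[OF M, of y] normal_commutator_left)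
qed

text \<open>This set is the preimage of the centraliser of the image of \<open>D\<close> in
  \<open>G Mod M\<close>. Both versions serve to extend commutator conditions from generators or
  from coprime powers.\<close>

lemma subgroup_commutator_left_mem:
  assumes M: "M \<lhd> G" and "D \<subseteq> carrier G"
  shows "subgroup {c \<in> carrier G. \<forall>d \<in> D. commutator G c d \<in> M} G"
proof (rule subgroupI)
  show "{c \<in> carrier G. \<forall>d \<in> D. commutator G c d \<in> M} \<noteq> {}"
    using assms normal_one[OF M] by (auto intro!: exI[of _ \<one>] simp: subset_iff)
next
  fix a assume a: "a \<in> {c \<in> carrier G. \<forall>d \<in> D. commutator G c d \<in> M}"
  have "commutator G (inv a) d \<in> M" if "d \<in> D" for d
  proof -
    have "commutator G (inv a) d = conjg G (inv a) (inv (commutator G a d))"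
      using a that assms by (auto simp: word subset_iff)
    then show ?thesis using a that M by (simp add: normal_conjg normal_inverse)
  qed
  then show "inv a \<in> {c \<in> carrier G. \<forall>d \<in> D. commutator G c d \<in> M}" using a by auto
next
  fix a b assume "a \<in> {c \<in> carrier G. \<forall>d \<in> D. commutator G c d \<in> M}"
    "b \<in> {c \<in> carrier G. \<forall>d \<in> D. commutator G c d \<in> M}"
  then show "a \<otimes> b \<in> {c \<in> carrier G. \<forall>d \<in> D. commutator G c d \<in> M}"
    using assms by (auto simp: commutator_mult_left subset_iff normal_conjg normal_mult)
qed auto

lemma subgroup_commutator_right_mem:
  assumes M: "M \<lhd> G" and "D \<subseteq> carrier G"
  shows "subgroup {c \<in> carrier G. \<forall>d \<in> D. commutator G d c \<in> M} G"
proof -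
  have "commutator G d c \<in> M \<longleftrightarrow> commutator G c d \<in> M" if "c \<in> carrier G" "d \<in> carrier G" for c d
    using that M by (metis commutator_closed commutator_inverse inv_inv normal_inverse)
  then have "{c \<in> carrier G. \<forall>d \<in> D. commutator G d c \<in> M} = {c \<in> carrier G. \<forall>d \<in> D. commutator G c d \<in> M}"
    using assms(2) by blast
  then show ?thesis using subgroup_commutator_left_mem[OF assms] by simp
qed

lemma generate_normal_if_conjg:
  assumes "Y \<subseteq> carrier G" "\<And>g y. g \<in> carrier G \<Longrightarrow> y \<in> Y \<Longrightarrow> conjg G g y \<in> Y"
  shows "generate G Y \<lhd> G"
proof (rule normal_generateI[OF assms(1)])
  fix h g assume "h \<in> Y" "g \<in> carrier G"
  then show "g \<otimes> h \<otimes> inv g \<in> Y"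
    using assms(2)[of "inv g" h] by (simp add: conjg_def)
qed

text \<open>By induction on the class: the subgroup generated by the longest commutators is central,
  and bilinearity gives it the exponent of the generators.\<close>

lemma nilpotent_exponent:
  assumes Y: "Y \<subseteq> carrier G" "\<And>g y. g \<in> carrier G \<Longrightarrow> y \<in> Y \<Longrightarrow> conjg G g y \<in> Y"
    and "M \<lhd> G" "\<And>y. y \<in> Y \<Longrightarrow> y [^] (n::nat) \<in> M"
    and "\<And>y ys. y \<in> Y \<Longrightarrow> set ys \<subseteq> Y \<Longrightarrow> length ys = k \<Longrightarrow> lcomm G y ys \<in> M"
    and "a \<in> generate G Y"
  shows "a [^] (n ^ Suc k) \<in> M"
  using assms(3-6)
proof (induction k arbitrary: M a)
  case 0
  then have "generate G Y \<subseteq> M"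
    by (intro generate_subgroup_incl) (auto simp: normal_imp_subgroup dest: "0.prems"(3)[of _ "[]"])
  then show ?case using 0 normal_pow by blast
next
  case (Suc k)
  note M = Suc.prems(1)
  define L where "L = {lcomm G y ys |y ys. y \<in> Y \<and> set ys \<subseteq> Y \<and> length ys = k}"
  \<comment> \<open>Modulo \<open>M'\<close> the commutators with \<open>k\<close> further entries
    vanish, so the induction hypothesis applies with \<open>M'\<close> in place of \<open>M\<close>.
    That \<open>M'\<close> has exponent \<open>n\<close> modulo \<open>M\<close> supplies the
    remaining factor.\<close>
  define M' where "M' = generate G (M \<union> L)"
  have Lc: "L \<subseteq> carrier G"
    using Y(1) by (force simp: L_def)
  have MuL: "M \<union> L \<subseteq> carrier G" using Lc M normal_in_carrier by blast
  have "conjg G g c \<in> L" if "g \<in> carrier G" "c \<in> L" for g c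
  proof -
    obtain y ys where c: "c = lcomm G y ys" "y \<in> Y" "set ys \<subseteq> Y" "length ys = k"
      using \<open>c \<in> L\<close> by (auto simp: L_def)
    then have "conjg G g c = lcomm G (conjg G g y) (map (conjg G g) ys)"
      using that Y(1) by (simp add: conjg_lcomm subset_iff)
    moreover have "set (map (conjg G g) ys) \<subseteq> Y" using c Y(2) that by auto
    ultimately show ?thesis
      unfolding L_def using c Y(2) that by (metis (mono_tags, lifting) CollectI length_map)
  qed
  then have M': "M' \<lhd> G"
    unfolding M'_def using MuL normal_conjg[OF M] by (intro generate_normal_if_conjg) auto
  have MuLsub: "M \<union> L \<subseteq> M'" unfolding M'_def by (simp add: generate.incl subsetI)
  have "a [^] (n ^ Suc k) \<in> M'"
  proof (rule Suc.IH[OF M'])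
    show "y [^] n \<in> M'" if "y \<in> Y" for y using that Suc.prems(2) MuLsub by auto
    show "lcomm G y ys \<in> M'" if "y \<in> Y" "set ys \<subseteq> Y" "length ys = k" for y ys
    proof -
      have "lcomm G y ys \<in> L" unfolding L_def using that by blast
      then show ?thesis using MuLsub by blast
    qed
  qed (use Suc.prems in auto)
  moreover have "c [^] n \<in> M" if "c \<in> M'" for c
  proof -
    have LY: "commutator G c y \<in> M" if "c \<in> L" "y \<in> Y" for c y
    proof -
      obtain x xs where c: "c = lcomm G x xs" "x \<in> Y" "set xs \<subseteq> Y" "length xs = k"
        using \<open>c \<in> L\<close> by (auto simp: L_def)
      show ?thesis using Suc.prems(3)[of x "xs @ [y]"] c that by simp
    qed
    have Ln: "c [^] n \<in> M" if "c \<in> L" for c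
    proof -
      obtain x xs where c: "c = lcomm G x xs" "x \<in> Y" "set xs \<subseteq> Y" "length xs = k"
        using \<open>c \<in> L\<close> by (auto simp: L_def)
      show ?thesis
      proof (cases xs rule: rev_cases)
        case Nil
        then show ?thesis using c Suc.prems(2) by simp
      next
        case (snoc zs z)
        define u where "u = lcomm G x zs"
        have u: "u \<in> carrier G" "z \<in> Y" "c = commutator G u z"
          using c snoc Y(1) by (auto simp: u_def)
        \<comment> \<open>As \<open>c = [u, z]\<close> commutes with \<open>z\<close> modulo
          \<open>M\<close>, its \<open>n\<close>-th power lies in \<open>M\<close> exactly if
          \<open>[u, z [^] n]\<close> does, and \<open>z [^] n\<close> is already in
          \<open>M\<close>.\<close>
        have "commutator G u (z [^] n) \<in> M"
          using u Suc.prems(2) M by (simp add: normal_commutator_right)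
        then show ?thesis
          using mod_commutator_pow_right[OF M, of u z n] u LY[OF that u(2)] Y(1) by auto
      qed
    qed
    have "generate G Y \<subseteq> carrier G" using Y(1) by (simp add: generate_incl)
    have gMY: "M \<union> Y \<subseteq> carrier G" using Y(1) M normal_in_carrier by blast
    \<comment> \<open>\<open>M'\<close> lies in \<open>D\<close> and is central there modulo
      \<open>M\<close>; so it is commutative modulo \<open>M\<close>, and its exponent can be
      checked on generators.\<close>
    define D where "D = generate G (M \<union> Y)"
    have D: "subgroup D G" unfolding D_def using gMY by (rule generate_is_subgroup)
    have MYD: "M \<union> Y \<subseteq> D" unfolding D_def by (simp add: generate.incl subsetI)
    have LD: "L \<subseteq> D"
      unfolding L_def using MYD by (auto intro!: subgroup_lcomm[OF D])
    have cD: "commutator G c d \<in> M" if "c \<in> M \<union> L" "d \<in> D" for c d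
    proof -
      let ?S = "{d \<in> carrier G. \<forall>c \<in> {c}. commutator G c d \<in> M}"
      have "subgroup ?S G"
        using that MuL by (intro subgroup_commutator_right_mem[OF M]) auto
      moreover have "M \<union> Y \<subseteq> ?S"
        using that gMY LY MuL normal_commutator_left[OF M] normal_commutator_right[OF M] by auto
      ultimately have "D \<subseteq> ?S" unfolding D_def by (rule generate_subgroup_incl[rotated])
      then show ?thesis using that by auto
    qed
    let ?Z = "{c \<in> carrier G. \<forall>d \<in> D. commutator G c d \<in> M}"
    have "D \<subseteq> carrier G" using D by (rule subgroup.subset)
    then have "subgroup ?Z G" by (rule subgroup_commutator_left_mem[OF M])
    then have M'Z: "M' \<subseteq> ?Z" unfolding M'_def using cD MuL by (intro generate_subgroup_incl) auto
    have M'D: "M' \<subseteq> D" unfolding M'_def using MYD LD by (intro generate_subgroup_incl D) auto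
    have "c \<in> generate G (M \<union> L)" using that by (simp add: M'_def)
    then show ?thesis
    proof (induction rule: generate.induct)
      case one
      then show ?case by (simp add: normal_one[OF M])
    next
      case (incl h)
      then show ?case using Ln normal_pow[OF M] by auto
    next
      case (inv h)
      then have "h [^] n \<in> M" using Ln normal_pow[OF M] by auto
      moreover have "h \<in> carrier G" using inv MuL by blast
      ultimately show ?case by (simp add: nat_pow_inv normal_inverse[OF M])
    next
      case (eng h1 h2)
      then have "h1 \<in> M'" "h2 \<in> M'" by (auto simp: M'_def)
      then have "h1 \<in> carrier G" "h2 \<in> carrier G" "commutator G h1 h2 \<in> M"
        using M'Z M'D by auto
      then show ?case using eng by (intro mod_pow_mult[OF M])
    qed
  qed
  ultimately have "(a [^] (n ^ Suc k)) [^] n \<in> M" by blast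
  moreover have "a \<in> carrier G" using Suc.prems Y(1) generate_in_carrier by blast
  ultimately show ?case by (simp add: nat_pow_pow mult.commute mult.left_commute)
qed

text \<open>The conjugates of \<open>x\<close> generate a normal subgroup of exponent
  \<open>n ^ Suc k\<close> modulo \<open>M\<close> by \<open>nilpotent_exponent\<close>. Modulo that
  subgroup the product is \<open>y\<close>, which contributes the factor \<open>m\<close>.\<close>

lemma mod_pow_mult_conjg_commutators:
  assumes M: "M \<lhd> G" and xy: "x \<in> carrier G" "y \<in> carrier G"
    and n: "x [^] (n::nat) \<in> M" "y [^] (m::nat) \<in> M"
    and c: "\<And>g gs. g \<in> carrier G \<Longrightarrow> set gs \<subseteq> carrier G \<Longrightarrow> length gs = k \<Longrightarrow>
        lcomm G (conjg G g x) (map (\<lambda>h. conjg G h x) gs) \<in> M"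
  shows "(x \<otimes> y) [^] (m * n ^ Suc k) \<in> M"
proof -
  define Y where "Y = (\<lambda>g. conjg G g x) ` carrier G"
  have Yc: "Y \<subseteq> carrier G" using xy by (auto simp: Y_def)
  have Yg: "conjg G g y \<in> Y" if "g \<in> carrier G" "y \<in> Y" for g y
    using that xy by (auto simp: Y_def conjg_conjg)
  have "a [^] (n ^ Suc k) \<in> M" if "a \<in> generate G Y" for a
  proof (rule nilpotent_exponent[OF Yc Yg M])
    show "y [^] n \<in> M" if "y \<in> Y" for y
      using that xy n by (auto simp: Y_def simp flip: conjg_pow intro: normal_conjg[OF M])
    show "lcomm G y ys \<in> M" if "y \<in> Y" "set ys \<subseteq> Y" "length ys = k" for y ys
    proof -
      obtain g where g: "g \<in> carrier G" "y = conjg G g x" using \<open>y \<in> Y\<close> by (auto simp: Y_def)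
      have "\<exists>gs. set gs \<subseteq> carrier G \<and> ys = map (\<lambda>h. conjg G h x) gs"
        using \<open>set ys \<subseteq> Y\<close>
      proof (induction ys)
        case (Cons y ys)
        then obtain gs h where "set gs \<subseteq> carrier G" "ys = map (\<lambda>h. conjg G h x) gs"
          "h \<in> carrier G" "y = conjg G h x" by (auto simp: Y_def)
        then show ?case by (intro exI[of _ "h # gs"]) auto
      qed simp
      then show ?thesis using c[of g] g that by auto
    qed
  qed (use that in auto)
  note a = this
  have P: "generate G Y \<lhd> G" using Yc Yg by (rule generate_normal_if_conjg)
  interpret q: group_hom G "G Mod generate G Y" "\<lambda>x. generate G Y #> x" using P by (rule mod_hom)
  have x: "x \<in> generate G Y"
    using xy by (intro generate.incl) (auto simp: Y_def intro!: image_eqI[of _ _ \<one>])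
  then have "generate G Y #> x = \<one>\<^bsub>G Mod generate G Y\<^esub>"
    using xy P by (simp add: mod_eq_one_iff del: one_FactGroup)
  then have "generate G Y #> (x \<otimes> y) [^] m = generate G Y #> (y [^] m)"
    using xy by (simp only: q.hom_nat_pow m_closed q.hom_mult q.H.l_one q.hom_closed)
  then have "(x \<otimes> y) [^] m \<in> generate G Y #> (y [^] m)"
    using xy P by (metis m_closed nat_pow_closed normal_imp_subgroup rcos_self)
  then obtain p where p: "p \<in> generate G Y" "(x \<otimes> y) [^] m = p \<otimes> y [^] m"
    by (auto simp: r_coset_def)
  have "(p \<otimes> y [^] m) [^] (n ^ Suc k) \<in> M"
    using a[OF p(1)] p(1) n Yc generate_in_carrier by (intro mod_pow_mult_normal[OF M]) auto
  then have "((x \<otimes> y) [^] m) [^] (n ^ Suc k) \<in> M"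
    by (simp only: p(2))
  then show ?thesis
    using xy by (simp add: nat_pow_pow)
qed

text \<open>The same inside \<open>B\<close>, with \<open>M \<inter> B\<close> as the normal
  subgroup: the vanishing commutators will be known only for conjugators from an open
  subgroup.\<close>

lemma mod_pow_mult_conjg_commutators_subgroup:
  assumes B: "subgroup B G" and M: "M \<lhd> G" and xy: "x \<in> B" "y \<in> B"
    and n: "x [^] (n::nat) \<in> M" "y [^] (m::nat) \<in> M"
    and c: "\<And>g gs. g \<in> B \<Longrightarrow> set gs \<subseteq> B \<Longrightarrow> length gs = k \<Longrightarrow>
        lcomm G (conjg G g x) (map (\<lambda>h. conjg G h x) gs) \<in> M"
  shows "(x \<otimes> y) [^] (m * n ^ Suc k) \<in> M"
proof -
  let ?B = "G\<lparr>carrier := B\<rparr>"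
  interpret b: group ?B using B by (rule subgroup.subgroup_is_group) (rule is_group)
  have cj: "conjg ?B g z = conjg G g z" if "g \<in> B" "z \<in> B" for g z
    using that B by (simp add: conjg_def m_inv_consistent)
  have lc: "lcomm ?B z zs = lcomm G z zs" if "z \<in> B" "set zs \<subseteq> B" for z zs
    using that
  proof (induction zs arbitrary: z)
    case (Cons w zs)
    then have "commutator ?B z w = commutator G z w"
      using B by (simp add: commutator_def m_inv_consistent)
    then show ?case using Cons B by (simp add: subgroup_commutator)
  qed simp
  have "M \<inter> B \<lhd> ?B"
    using normal_restrict_supergroup[OF B M] normal_Int_subgroup[OF B M] by blast
  then have "(x \<otimes>\<^bsub>?B\<^esub> y) [^]\<^bsub>?B\<^esub> (m * n ^ Suc k) \<in> M \<inter> B"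
  proof (rule b.mod_pow_mult_conjg_commutators)
    show "x [^]\<^bsub>?B\<^esub> n \<in> M \<inter> B" "y [^]\<^bsub>?B\<^esub> m \<in> M \<inter> B"
      using xy n B by (simp_all add: subgroup_pow flip: nat_pow_consistent)
    fix g gs assume g: "g \<in> carrier ?B" "set gs \<subseteq> carrier ?B" "length gs = k"
    have "map (\<lambda>h. conjg ?B h x) gs = map (\<lambda>h. conjg G h x) gs"
      using g xy cj by auto
    moreover have "set (map (\<lambda>h. conjg G h x) gs) \<subseteq> B"
      using g xy subgroup_conjg[OF B] by auto
    moreover have "conjg ?B g x = conjg G g x" "conjg G g x \<in> B"
      using g xy cj subgroup_conjg[OF B] by auto
    ultimately have "lcomm ?B (conjg ?B g x) (map (\<lambda>h. conjg ?B h x) gs) =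
        lcomm G (conjg G g x) (map (\<lambda>h. conjg G h x) gs)"
      by (simp only: lc)
    moreover have "\<dots> \<in> B"
      using g xy subgroup_conjg[OF B] by (intro subgroup_lcomm[OF B]) auto
    ultimately show "lcomm ?B (conjg ?B g x) (map (\<lambda>h. conjg ?B h x) gs) \<in> M \<inter> B"
      using c[of g gs] g by auto
  qed (use xy in auto)
  then show ?thesis by (simp flip: nat_pow_consistent)
qed

end

subsection \<open>Commutators on cosets\<close>

definition pi_num :: "nat set \<Rightarrow> nat \<Rightarrow> bool" where
  "pi_num I n \<longleftrightarrow> n > 0 \<and> (\<forall>p. prime p \<longrightarrow> p dvd n \<longrightarrow> p \<in> I)"

lemma pi_num_one [simp]: "pi_num I 1" "pi_num I (Suc 0)"
  by (auto simp: pi_num_def dest: not_prime_unit)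

lemma pi_num_mult: "pi_num I m \<Longrightarrow> pi_num I n \<Longrightarrow> pi_num I (m * n)"
  by (auto simp: pi_num_def prime_dvd_mult_iff)

lemma pi_num_power: "pi_num I n \<Longrightarrow> pi_num I (n ^ k)"
  by (induction k) (auto simp: pi_num_mult)

lemma pi_num_mono: "pi_num I n \<Longrightarrow> I \<inter> {p. prime p} \<subseteq> J \<Longrightarrow> pi_num J n"
  by (auto simp: pi_num_def)

text \<open>Sets such as \<open>- {q}\<close> contain numbers that are not prime, hence disjointness
  is always asked of the primes alone.\<close>

lemma pi_num_coprime:
  assumes "pi_num I m" "pi_num J n" "I \<inter> J \<inter> {p. prime p} = {}"
  shows "coprime m n"
proof (rule ccontr)
  assume "\<not> coprime m n"
  then have "gcd m n \<noteq> 1" by (simp add: coprime_iff_gcd_eq_1)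
  then obtain p where "prime p" "p dvd gcd m n" using prime_factor_nat by blast
  then have "prime p" "p dvd m" "p dvd n" by auto
  then show False using assms by (auto simp: pi_num_def)
qed

lemma pi_num_split:
  assumes "(n::nat) > 0"
  obtains a b where "n = a * b" "pi_num I a" "pi_num (- I) b"
proof -
  have "\<exists>a b. n = a * b \<and> pi_num I a \<and> pi_num (- I) b" using assms
  proof (induction n rule: less_induct)
    case (less n)
    show ?case
    proof (cases "n = 1")
      case True
      then show ?thesis by (intro exI[of _ 1]) auto
    next
      case False
      then obtain p m where p: "prime p" "n = p * m" by (metis dvd_def prime_factor_nat)
      then have "m < n" "m > 0" using less.prems prime_gt_1_nat by auto
      then obtain a b where ab: "m = a * b" "pi_num I a" "pi_num (- I) b"
        using less.IH by blast
      have pp: "pi_num J p" if "p \<in> J" for J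
        using p(1) that primes_dvd_imp_eq[of _ p] by (auto simp: pi_num_def prime_gt_0_nat)
      show ?thesis
      proof (cases "p \<in> I")
        case True
        then show ?thesis using ab p pp[of I] by (intro exI[of _ "p * a"] exI[of _ b]) (auto simp: pi_num_mult)
      next
        case False
        then show ?thesis using ab p pp[of "- I"] by (intro exI[of _ a] exI[of _ "p * b"]) (auto simp: pi_num_mult)
      qed
    qed
  qed
  then show thesis using that by blast
qed

context group
begin

lemma subgroup_coprime_pow_mem:
  assumes S: "subgroup S G" and x: "x \<in> carrier G"
    and mn: "x [^] (m::nat) \<in> S" "x [^] (n::nat) \<in> S" "coprime m n"
  shows "x \<in> S"
proof (cases "m = 0")
  case True
  then show ?thesis using assms by simp
next
  case False
  obtain a b where "m * a = n * b + gcd m n"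
    using bezout_nat[OF False, of n] by blast
  then have "m * a = n * b + 1" using mn(3) by simp
  then have "x [^] (m * a) = x [^] (n * b) \<otimes> x" by simp
  moreover have "x [^] (m * a) \<in> S" "x [^] (n * b) \<in> S"
    using mn subgroup_pow[OF S] x by (metis nat_pow_pow)+
  ultimately have "inv (x [^] (n * b)) \<otimes> (x [^] (n * b) \<otimes> x) \<in> S"
    using S by (metis subgroup.m_closed subgroup.m_inv_closed)
  then show ?thesis using x by simp
qed

text \<open>In coprime action an Engel condition forces trivial action: the elements centralised by
  \<open>z [^] m\<close> form a subgroup \<open>C\<close> containing \<open>[y, z]\<close>, hence \<open>[y, z [^] m]\<close>, and
  the powers of the latter measure the displacement of \<open>y\<close> under powers of \<open>z [^] m\<close>.\<close>

lemma engel_pow: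
  assumes W: "subgroup W G" and M: "M \<lhd> G" and z: "z \<in> carrier G"
    and inv: "\<And>w. w \<in> W \<Longrightarrow> conjg G z w \<in> W"
    and tor: "\<And>w. w \<in> W \<Longrightarrow> \<exists>l. pi_num J l \<and> w [^] l \<in> M"
    and "y \<in> W" "lcomm G y (replicate j z) \<in> M"
  shows "\<exists>m. pi_num J m \<and> commutator G y (z [^] m) \<in> M"
  using assms(6,7)
proof (induction j arbitrary: y)
  case 0
  then show ?case using M z by (intro exI[of _ 1]) (auto simp: normal_commutator_left)
next
  case (Suc j)
  note Wc = subgroup.mem_carrier[OF W]
  have d: "commutator G y z \<in> W"
    using Suc.prems z inv Wc W by (simp add: commutator_conjg subgroup.m_closed subgroup.m_inv_closed)
  then obtain m where m: "pi_num J m" "commutator G (commutator G y z) (z [^] m) \<in> M"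
    using Suc.IH[OF d] Suc.prems by auto
  define C where "C = W \<inter> {c \<in> carrier G. \<forall>d \<in> {z [^] m}. commutator G c d \<in> M}"
  have C: "subgroup C G"
    unfolding C_def using z by (intro subgroups_Inter_pair W subgroup_commutator_left_mem M) auto
  note Cc = subgroup.mem_carrier[OF C]
  have Cz: "conjg G z c \<in> C" if "c \<in> C" for c
  proof -
    have "conjg G z (z [^] m) = z [^] m"
      using z by (subst conjg_eq_iff) (auto, metis nat_pow_Suc nat_pow_Suc2)
    then have "commutator G (conjg G z c) (z [^] m) = conjg G z (commutator G c (z [^] m))"
      using z Cc[OF that] by (simp add: conjg_commutator)
    then show ?thesis using that z inv M by (auto simp: C_def normal_conjg)
  qed
  have dC: "commutator G y z \<in> C" using d m Wc by (simp add: C_def)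
  \<comment> \<open>The displacement of \<open>y\<close> under \<open>z [^] i\<close> is a product
    of conjugates of \<open>[y, z]\<close> by powers of \<open>z\<close>, and \<open>C\<close>
    contains all of these.\<close>
  have yC: "inv y \<otimes> conjg G (z [^] i) y \<in> C" for i :: nat
  proof (induction i)
    case 0
    then show ?case using Suc.prems Wc subgroup.one_closed[OF C] by simp
  next
    case (Suc i)
    have y: "y \<in> carrier G" using \<open>y \<in> W\<close> Wc by blast
    have "inv y \<otimes> conjg G (z [^] Suc i) y = commutator G y z \<otimes> conjg G z (inv y \<otimes> conjg G (z [^] i) y)"
      using y z by (simp add: word)
    then show ?case using Suc Cz dC subgroup.m_closed[OF C] by simp
  qed
  define e where "e = commutator G y (z [^] m)"
  have y: "y \<in> carrier G" using Suc.prems Wc by blast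
  have e: "e \<in> C" unfolding e_def using yC[of m] y z by (simp add: commutator_conjg)
  then obtain l where l: "pi_num J l" "e [^] l \<in> M" using tor by (auto simp: C_def)
  \<comment> \<open>\<open>e\<close> commutes with \<open>z [^] m\<close> modulo \<open>M\<close>,
    so passing from \<open>z [^] m\<close> to its \<open>l\<close>-th power replaces
    \<open>e\<close> by \<open>e [^] l\<close>.\<close>
  have "commutator G y ((z [^] m) [^] l) \<in> M"
    using e l y z by (subst mod_commutator_pow_right[OF M]) (auto simp: e_def C_def)
  then show ?case using m l z by (intro exI[of _ "m * l"]) (simp add: nat_pow_pow pi_num_mult)
qed

end

section \<open>Boxes of cosets and the commutator words that vanish on them\<close>

definition coset_list :: "('a, 'b) monoid_scheme \<Rightarrow> 'a set \<Rightarrow> 'a list \<Rightarrow> 'a list \<Rightarrow> bool" where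
  "coset_list G F = list_all2 (\<lambda>a b. \<exists>c \<in> F. b = a \<otimes>\<^bsub>G\<^esub> c)"

text \<open>The first entry ranges over \<open>F\<close> and not over a coset: the equation
  \<open>killed G F as = F\<close> is what local constancy leaves once the first centre has been
  divided out, and it is the condition that is moved from box to box.\<close>

definition killed :: "('a, 'b) monoid_scheme \<Rightarrow> 'a set \<Rightarrow> 'a list \<Rightarrow> 'a set" where
  "killed G F as = {x \<in> F. \<forall>bs. coset_list G F as bs \<longrightarrow> lcomm G x bs = \<one>\<^bsub>G\<^esub>}"

context group
begin

lemma coset_list_Nil [simp]: "coset_list G F [] bs \<longleftrightarrow> bs = []"
  by (simp add: coset_list_def)

lemma coset_list_Cons: "coset_list G F (a # as) bs \<longleftrightarrow>
    (\<exists>c cs. c \<in> F \<and> coset_list G F as cs \<and> bs = (a \<otimes> c) # cs)"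
  by (auto simp: coset_list_def list_all2_Cons1)

lemma coset_list_append: "coset_list G F (as @ as') bs \<longleftrightarrow>
    (\<exists>cs cs'. coset_list G F as cs \<and> coset_list G F as' cs' \<and> bs = cs @ cs')"
  unfolding coset_list_def list_all2_append1
  by (blast dest: list_all2_lengthD[symmetric])

lemma coset_list_length: "coset_list G F as bs \<Longrightarrow> length as = length bs"
  by (simp add: coset_list_def list_all2_lengthD)

lemma coset_list_carrier:
  "coset_list G F as bs \<Longrightarrow> F \<subseteq> carrier G \<Longrightarrow> set as \<subseteq> carrier G \<Longrightarrow> set bs \<subseteq> carrier G"
proof (induction as arbitrary: bs)
  case (Cons a as)
  then show ?case by (fastforce simp: coset_list_Cons)
qed simp

lemma coset_list_refl:
  assumes "subgroup F G" "set as \<subseteq> carrier G"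
  shows "coset_list G F as as"
  using assms(2)
proof (induction as)
  case (Cons a as)
  then have "a = a \<otimes> \<one>" by simp
  with Cons subgroup.one_closed[OF assms(1)] show ?case
    unfolding coset_list_Cons by (metis list.set_intros(2) set_subset_Cons subset_trans)
qed simp

lemma coset_list_trans:
  assumes F: "subgroup F G" and "F' \<subseteq> F" "set as \<subseteq> carrier G"
    and "coset_list G F as bs" "coset_list G F' bs cs"
  shows "coset_list G F as cs"
  using assms(3-5)
proof (induction as arbitrary: bs cs)
  case (Cons a as)
  then obtain c bs' c' cs' where *: "c \<in> F" "coset_list G F as bs'" "bs = (a \<otimes> c) # bs'"
    "c' \<in> F'" "coset_list G F' bs' cs'" "cs = (a \<otimes> c \<otimes> c') # cs'"
    by (auto simp: coset_list_Cons)
  then have "a \<otimes> c \<otimes> c' = a \<otimes> (c \<otimes> c')" "c \<otimes> c' \<in> F"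
    using Cons.prems assms(2) subgroup.mem_carrier[OF F] subgroup.m_closed[OF F]
    by (auto simp: m_assoc subset_iff)
  then show ?case using * Cons by (auto simp: coset_list_Cons)
qed simp

text \<open>For \<open>w\<close> in \<open>F\<close>, conjugation maps \<open>a \<otimes> c\<close>
  to \<open>a\<close> times \<open>[a, w]\<close> times a conjugate of \<open>c\<close>, and the
  last two factors lie in \<open>F\<close>.\<close>

lemma coset_list_conjg_mem:
  assumes F: "F \<lhd> G" and w: "w \<in> F" and "set as \<subseteq> carrier G" "coset_list G F as bs"
  shows "coset_list G F as (map (conjg G w) bs)"
  using assms(3,4)
proof (induction as arbitrary: bs)
  case (Cons a as)
  then obtain c bs' where *: "c \<in> F" "coset_list G F as bs'" "bs = (a \<otimes> c) # bs'"
    by (auto simp: coset_list_Cons)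
  note [simp] = normal_in_carrier[OF F]
  have "conjg G w (a \<otimes> c) = a \<otimes> (commutator G a w \<otimes> conjg G w c)"
    using Cons.prems * w by (simp add: word)
  moreover have "commutator G a w \<otimes> conjg G w c \<in> F"
    using Cons.prems * w
    by (intro normal_mult[OF F] normal_commutator_right[OF F] normal_conjg[OF F]) auto
  ultimately show ?case using * Cons by (auto simp: coset_list_Cons)
qed simp

lemma coset_list_conjg:
  assumes F: "F \<lhd> G" and w: "w \<in> carrier G" and "set as \<subseteq> carrier G" "coset_list G F as bs"
  shows "coset_list G F (map (conjg G w) as) (map (conjg G w) bs)"
  using assms(3,4)
proof (induction as arbitrary: bs)
  case (Cons a as)
  then obtain c bs' where *: "c \<in> F" "coset_list G F as bs'" "bs = (a \<otimes> c) # bs'"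
    by (auto simp: coset_list_Cons)
  then have "conjg G w (a \<otimes> c) = conjg G w a \<otimes> conjg G w c" "conjg G w c \<in> F"
    using w Cons.prems normal_in_carrier[OF F] normal_conjg[OF F w] by (auto simp: conjg_mult)
  then show ?case using * Cons by (auto simp: coset_list_Cons)
qed simp

text \<open>Each further entry conjugates the factor of \<open>x\<close> by the value
  \<open>w\<close> of the word at \<open>y\<close> reached so far. As \<open>w\<close> is in the
  normal subgroup \<open>F\<close>, this is absorbed by conjugating \<open>x\<close> and by moving
  the entries within the box.\<close>

lemma lcomm_mult_coset:
  assumes F: "F \<lhd> G" and "x \<in> carrier G" "y \<in> F" "set bs \<subseteq> carrier G"
  shows "\<exists>f \<in> F. \<exists>bs'. coset_list G F bs bs' \<and>
    lcomm G (x \<otimes> y) bs = lcomm G (conjg G f x) bs' \<otimes> lcomm G y bs"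
  using assms(4)
proof (induction bs rule: rev_induct)
  case Nil
  then show ?case using assms normal_one[OF F] by (intro bexI[of _ \<one>]) auto
next
  case (snoc b bs)
  note Fc = normal_in_carrier[OF F]
  obtain f bs' where f: "f \<in> F" "coset_list G F bs bs'"
    "lcomm G (x \<otimes> y) bs = lcomm G (conjg G f x) bs' \<otimes> lcomm G y bs"
    using snoc by auto
  define w where "w = lcomm G y bs"
  have w: "w \<in> F" unfolding w_def using snoc assms by (simp add: normal_lcomm)
  have bs': "set bs' \<subseteq> carrier G"
    using f snoc Fc by (intro coset_list_carrier[OF f(2)]) auto
  have c: "f \<in> carrier G" "w \<in> carrier G" "b \<in> carrier G" "lcomm G (conjg G f x) bs' \<in> carrier G"
    using f w snoc Fc bs' assms by auto
  have "lcomm G (x \<otimes> y) (bs @ [b]) = conjg G w (commutator G (lcomm G (conjg G f x) bs') b) \<otimes> commutator G w b"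
    using f c by (simp add: commutator_mult_left flip: w_def)
  also have "conjg G w (commutator G (lcomm G (conjg G f x) bs') b) =
      lcomm G (conjg G (f \<otimes> w) x) (map (conjg G w) bs' @ [conjg G w b])"
    using c bs' assms by (simp add: conjg_commutator conjg_lcomm conjg_conjg)
  finally have "lcomm G (x \<otimes> y) (bs @ [b]) =
      lcomm G (conjg G (f \<otimes> w) x) (map (conjg G w) (bs' @ [b])) \<otimes> lcomm G y (bs @ [b])"
    by (simp add: w_def)
  moreover have "coset_list G F (bs @ [b]) (bs' @ [b])"
    using f c coset_list_refl[of F "[b]"] F by (auto simp: coset_list_append normal_imp_subgroup)
  then have "coset_list G F (bs @ [b]) (map (conjg G w) (bs' @ [b]))"
    using snoc by (intro coset_list_conjg_mem[OF F w]) auto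
  ultimately show ?case using f(1) w normal_mult[OF F] by blast
qed

text \<open>In \<open>lcomm_mult_coset\<close> the left factor is again a value of the constant
  word, since the conjugate of \<open>x\<close> by \<open>f\<close> is
  \<open>x \<otimes> [x, f]\<close> and the new entries stay in the box. So \<open>c\<close> equals
  \<open>c\<close> times the value at \<open>y\<close>.\<close>

lemma killed_if_constant:
  assumes F: "F \<lhd> G" and x: "x \<in> carrier G" and as: "set as \<subseteq> carrier G"
    and const: "\<And>y bs. y \<in> F \<Longrightarrow> coset_list G F as bs \<Longrightarrow> lcomm G (x \<otimes> y) bs = c"
  shows "killed G F as = F"
proof -
  note Fc = normal_in_carrier[OF F]
  have "lcomm G y bs = \<one>" if y: "y \<in> F" and bs: "coset_list G F as bs" for y bs
  proof -
    have bsc: "set bs \<subseteq> carrier G" using as Fc by (intro coset_list_carrier[OF bs]) auto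
    obtain f bs' where f: "f \<in> F" "coset_list G F bs bs'"
      "lcomm G (x \<otimes> y) bs = lcomm G (conjg G f x) bs' \<otimes> lcomm G y bs"
      using lcomm_mult_coset[OF F x y bsc] by blast
    have "coset_list G F as bs'"
      using coset_list_trans[OF _ _ as bs f(2)] F by (simp add: normal_imp_subgroup)
    moreover have "conjg G f x = x \<otimes> commutator G x f" using f x Fc by (simp add: word)
    ultimately have "lcomm G (conjg G f x) bs' = c"
      using const[of "commutator G x f" bs'] f x by (simp add: normal_commutator_right[OF F])
    moreover have "lcomm G (x \<otimes> y) bs = c" using const y bs by blast
    moreover have "c \<in> carrier G"
      using const[OF y bs] x y Fc bsc by force
    moreover have "lcomm G y bs \<in> carrier G" using y Fc bsc by auto
    ultimately have "c \<otimes> lcomm G y bs = c \<otimes> \<one>" "c \<in> carrier G" "lcomm G y bs \<in> carrier G"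
      using f(3) by auto
    then show ?thesis by simp
  qed
  then show ?thesis by (auto simp: killed_def)
qed

text \<open>Conjugation by the inverse of \<open>w\<close> carries the box into itself, so the word
  at the conjugate of \<open>x\<close> is a conjugate of a vanishing one.\<close>

lemma killed_conjg:
  assumes F: "F \<lhd> G" and as: "set as \<subseteq> carrier G" and x: "x \<in> killed G F as" and w: "w \<in> F"
  shows "conjg G w x \<in> killed G F as"
proof -
  note Fc = normal_in_carrier[OF F]
  have xF: "x \<in> F" using x by (simp add: killed_def)
  have "lcomm G (conjg G w x) bs = \<one>" if bs: "coset_list G F as bs" for bs
  proof -
    have bsc: "set bs \<subseteq> carrier G" using as Fc by (intro coset_list_carrier[OF bs]) auto
    have "coset_list G F as (map (conjg G (inv w)) bs)"
      using bs as w F by (intro coset_list_conjg_mem) (auto simp: normal_inverse)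
    then have "lcomm G x (map (conjg G (inv w)) bs) = \<one>" using x by (simp add: killed_def)
    then have "conjg G w (lcomm G x (map (conjg G (inv w)) bs)) = \<one>" using w Fc by simp
    moreover have "set (map (conjg G (inv w)) bs) \<subseteq> carrier G" using bsc w Fc by auto
    moreover have "map (conjg G w) (map (conjg G (inv w)) bs) = bs"
      using bsc w Fc by (auto intro!: map_idI simp: subset_iff)
    ultimately show ?thesis using xF w Fc by (simp only: conjg_lcomm)
  qed
  then show ?thesis using xF w normal_conjg[OF F] Fc by (auto simp: killed_def)
qed

text \<open>By \<open>lcomm_mult_coset\<close> and \<open>killed_conjg\<close> a killed left factor
  may be dropped from the first entry without changing the value of the word.\<close>

lemma subgroup_killed:
  assumes F: "F \<lhd> G" and as: "set as \<subseteq> carrier G"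
  shows "subgroup (killed G F as) G"
proof (rule subgroupI)
  note Fc = normal_in_carrier[OF F]
  have mult: "lcomm G (x \<otimes> y) bs = lcomm G y bs"
    if xk: "x \<in> killed G F as" and yF: "y \<in> F" and bs: "coset_list G F as bs" for x y bs
  proof -
    have bsc: "set bs \<subseteq> carrier G" using as Fc by (intro coset_list_carrier[OF bs]) auto
    have x: "x \<in> F" using xk by (simp add: killed_def)
    obtain f bs' where f: "f \<in> F" "coset_list G F bs bs'"
      "lcomm G (x \<otimes> y) bs = lcomm G (conjg G f x) bs' \<otimes> lcomm G y bs"
      using lcomm_mult_coset[OF F _ yF bsc] x Fc by blast
    have "coset_list G F as bs'"
      using coset_list_trans[OF _ _ as bs f(2)] F by (simp add: normal_imp_subgroup)
    then have "lcomm G (conjg G f x) bs' = \<one>"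
      using killed_conjg[OF F as xk f(1)] by (simp add: killed_def)
    then show ?thesis using f(3) yF Fc bsc by simp
  qed
  show "killed G F as \<subseteq> carrier G" using Fc by (auto simp: killed_def)
  have "\<one> \<in> killed G F as"
    using normal_one[OF F] Fc as coset_list_carrier[of F as]
    by (auto simp: killed_def intro!: lcomm_one)
  then show "killed G F as \<noteq> {}" by blast
  fix a assume a: "a \<in> killed G F as"
  then have aF: "a \<in> F" by (simp add: killed_def)
  have "lcomm G (inv a) bs = \<one>" if "coset_list G F as bs" for bs
  proof -
    have "lcomm G (inv a) bs = lcomm G (a \<otimes> inv a) bs"
      using mult[OF a _ that] aF by (simp add: normal_inverse[OF F])
    then show ?thesis
      using aF Fc as coset_list_carrier[OF that] by (auto intro!: lcomm_one)
  qed
  then show "inv a \<in> killed G F as" using aF by (simp add: killed_def normal_inverse[OF F])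
  fix b assume b: "b \<in> killed G F as"
  then show "a \<otimes> b \<in> killed G F as"
    using aF mult[OF a] by (simp add: killed_def normal_mult[OF F])
qed

lemma killed_full_mono:
  assumes F: "F \<lhd> G" and F': "F' \<subseteq> F" and as: "set as \<subseteq> carrier G"
    and k: "killed G F as = F" and c: "coset_list G F as bs"
  shows "killed G F' bs = F'"
proof -
  have "lcomm G x cs = \<one>" if "x \<in> F'" "coset_list G F' bs cs" for x cs
  proof -
    have "coset_list G F as cs"
      using coset_list_trans[OF _ F' as c that(2)] F by (simp add: normal_imp_subgroup)
    then show ?thesis using k that F' unfolding killed_def by blast
  qed
  then show ?thesis by (auto simp: killed_def)
qed

text \<open>Since \<open>[x, g t] = [x, t] [x, g]\<^sup>t\<close>, the entry \<open>g t\<close> can be replaced by \<open>g\<close> if \<open>t\<close> is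
  admissible in the same place.\<close>

lemma killed_slot:
  assumes F: "F \<lhd> G" and c: "set pre \<subseteq> carrier G" "set post \<subseteq> carrier G" "g \<in> carrier G" "t \<in> carrier G"
    and k1: "killed G F (pre @ t # post) = F" and k2: "killed G F (pre @ (g \<otimes> t) # post) = F"
  shows "killed G F (pre @ g # map (conjg G (inv t)) post) = F"
proof -
  note Fc = normal_in_carrier[OF F]
  let ?K = "killed G F post"
  have K: "subgroup ?K G" using F c by (intro subgroup_killed)
  have "lcomm G y bs = \<one>" if y: "y \<in> F" and bs: "coset_list G F (pre @ g # map (conjg G (inv t)) post) bs" for y bs
  proof -
    from bs obtain b1 q b2 where b: "coset_list G F pre b1" "q \<in> F"
      "coset_list G F (map (conjg G (inv t)) post) b2" "bs = b1 @ (g \<otimes> q) # b2"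
      by (auto simp: coset_list_append coset_list_Cons)
    have b1c: "set b1 \<subseteq> carrier G" using c Fc by (intro coset_list_carrier[OF b(1)]) auto
    have b2c: "set b2 \<subseteq> carrier G" using c Fc by (intro coset_list_carrier[OF b(3)]) auto
    define x where "x = lcomm G y b1"
    have x: "x \<in> F" unfolding x_def using y b1c by (simp add: normal_lcomm[OF F])
    have in_K: "commutator G x (s \<otimes> e) \<in> ?K"
      if s: "s \<in> carrier G" "e \<in> F" "killed G F (pre @ s # post) = F" for s e
    proof -
      have "lcomm G (commutator G x (s \<otimes> e)) cs = \<one>" if cs: "coset_list G F post cs" for cs
      proof -
        have "coset_list G F (pre @ s # post) (b1 @ (s \<otimes> e) # cs)"
          using b s cs unfolding coset_list_append coset_list_Cons by blast
        then have "lcomm G y (b1 @ (s \<otimes> e) # cs) = \<one>"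
          using s(3) y unfolding killed_def by blast
        then show ?thesis by (simp add: x_def)
      qed
      then show ?thesis using x s Fc normal_commutator_left[OF F] by (simp add: killed_def)
    qed
    have "commutator G x (t \<otimes> \<one>) \<in> ?K"
      using c normal_one[OF F] k1 by (intro in_K) auto
    then have 1: "commutator G x t \<in> ?K" using c by simp
    \<comment> \<open>The displacement \<open>conjg G t q\<close> turns the entry into
      \<open>(g \<otimes> q) \<otimes> t\<close>. Dividing by \<open>[x, t]\<close> inside the
      subgroup \<open>?K\<close> then leaves the conjugate of \<open>[x, g \<otimes> q]\<close> by
      \<open>t\<close>; undoing this conjugation is what changes \<open>post\<close>.\<close>
    have "commutator G x ((g \<otimes> t) \<otimes> conjg G t q) \<in> ?K"
      using c k2 b normal_conjg[OF F] by (intro in_K) auto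
    moreover have "(g \<otimes> t) \<otimes> conjg G t q = (g \<otimes> q) \<otimes> t" using c b Fc by (simp add: word)
    ultimately have "inv (commutator G x t) \<otimes> commutator G x ((g \<otimes> q) \<otimes> t) \<in> ?K"
      using 1 K by (simp add: subgroup.m_closed subgroup.m_inv_closed)
    then have "conjg G t (commutator G x (g \<otimes> q)) \<in> ?K"
      using c b Fc x by (simp add: commutator_mult_right)
    moreover have "coset_list G F post (map (conjg G t) b2)"
    proof -
      have "map (conjg G t) (map (conjg G (inv t)) post) = post"
        using c by (auto intro!: map_idI simp: subset_iff)
      moreover have "set (map (conjg G (inv t)) post) \<subseteq> carrier G" using c by auto
      ultimately show ?thesis using coset_list_conjg[OF F c(4) _ b(3)] by simp
    qed
    ultimately have "lcomm G (conjg G t (commutator G x (g \<otimes> q))) (map (conjg G t) b2) = \<one>"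
      by (simp add: killed_def)
    then have "conjg G t (lcomm G (commutator G x (g \<otimes> q)) b2) = \<one>"
      using c b Fc x b2c by (simp add: conjg_lcomm)
    then have "conjg G (inv t) (conjg G t (lcomm G (commutator G x (g \<otimes> q)) b2)) = \<one>"
      using c by simp
    then show ?thesis using c b Fc x b2c by (simp flip: x_def)
  qed
  then show ?thesis by (auto simp: killed_def)
qed

end

subsection \<open>Central subgroups of finite index\<close>

lemma finite_image_factor:
  assumes "finite (f ` A)" "\<And>a b. a \<in> A \<Longrightarrow> b \<in> A \<Longrightarrow> f a = f b \<Longrightarrow> g a = g b"
  shows "finite (g ` A)"
proof -
  have "g ` A \<subseteq> (\<lambda>c. g (SOME a. a \<in> A \<and> f a = c)) ` f ` A"
  proof
    fix y assume "y \<in> g ` A"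
    then obtain a where a: "a \<in> A" "y = g a" by auto
    then have "(SOME b. b \<in> A \<and> f b = f a) \<in> A \<and> f (SOME b. b \<in> A \<and> f b = f a) = f a"
      by (intro someI[of "\<lambda>b. b \<in> A \<and> f b = f a" a]) auto
    then have "g (SOME b. b \<in> A \<and> f b = f a) = y" using assms(2) a by metis
    then show "y \<in> (\<lambda>c. g (SOME a. a \<in> A \<and> f a = c)) ` f ` A" 
      using a by (intro image_eqI[of _ _ "f a"]) auto
  qed
  then show ?thesis using assms(1) by (meson finite_imageI finite_subset)
qed

context group
begin

lemma finite_generate_central:
  assumes "finite S" "S \<subseteq> carrier G" "(n::nat) > 0"
    and "\<And>s x. s \<in> S \<Longrightarrow> x \<in> carrier G \<Longrightarrow> s \<otimes> x = x \<otimes> s"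
    and "\<And>s. s \<in> S \<Longrightarrow> s [^] n = \<one>"
  shows "finite (generate G S)"
  using assms(1,2,4,5)
proof (induction S rule: finite_induct)
  case empty
  then show ?case by (simp add: generate_empty)
next
  case (insert s S)
  have s: "s \<in> carrier G" "s [^] n = \<one>" "S \<subseteq> carrier G" using insert by auto
  have gc: "t \<in> carrier G" if "t \<in> generate G S" for t
    using that s generate_in_carrier by blast
  have sc: "s [^] (i::nat) \<otimes> x = x \<otimes> s [^] i" if "x \<in> carrier G" for i x
    using that insert.prems s(1) by (intro group_commutes_pow) auto
  let ?U = "{s [^] (i::nat) \<otimes> t |i t. t \<in> generate G S}"
  \<comment> \<open>Exponents are natural numbers here, so inverses have to be expressed by powers
    with the help of \<open>s [^] n = \<one>\<close>.\<close>
  have inv_pow: "inv (s [^] (i::nat)) = s [^] ((n - 1) * i)" for i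
  proof -
    have "s [^] ((n - 1) * i) \<otimes> s [^] i = s [^] (n * i)"
      using assms(3) s by (cases n) (simp_all add: nat_pow_mult add.commute)
    also have "\<dots> = (s [^] n) [^] i" using s(1) by (simp add: nat_pow_pow)
    also have "\<dots> = \<one>" by (simp only: s(2) nat_pow_one)
    finally show ?thesis using s by (intro inv_equality) auto
  qed
  have "subgroup ?U G"
  proof (rule subgroupI)
    show "?U \<subseteq> carrier G" using s gc by auto
    show "?U \<noteq> {}" using generate.one by blast
    fix a assume "a \<in> ?U"
    then obtain i t where a: "a = s [^] (i::nat) \<otimes> t" "t \<in> generate G S" by auto
    then have "inv a = s [^] ((n - 1) * i) \<otimes> inv t"
      using s gc sc[of "inv t" "(n - 1) * i"] by (simp add: inv_mult_group inv_pow)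
    then show "inv a \<in> ?U" using generate_m_inv_closed[OF s(3) a(2)] by blast
    fix b assume "b \<in> ?U"
    then obtain j u where b: "b = s [^] (j::nat) \<otimes> u" "u \<in> generate G S" by auto
    have "a \<otimes> b = s [^] i \<otimes> (t \<otimes> s [^] j) \<otimes> u" using a b s gc by (simp add: m_assoc)
    also have "t \<otimes> s [^] j = s [^] j \<otimes> t" using sc[of t j] a gc by simp
    also have "s [^] i \<otimes> (s [^] j \<otimes> t) \<otimes> u = (s [^] i \<otimes> s [^] j) \<otimes> (t \<otimes> u)"
      using a b s(1) gc by (simp only: m_assoc m_closed nat_pow_closed)
    finally have "a \<otimes> b = s [^] (i + j) \<otimes> (t \<otimes> u)"
      using s(1) by (simp only: nat_pow_mult)
    then show "a \<otimes> b \<in> ?U" using generate.eng[OF a(2) b(2)] by blast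
  qed
  moreover have "insert s S \<subseteq> ?U"
  proof -
    have "s = s [^] (1::nat) \<otimes> \<one>" using s by simp
    moreover have "t = s [^] (0::nat) \<otimes> t" if "t \<in> S" for t using that s by auto
    ultimately have "\<exists>i u. t = s [^] (i::nat) \<otimes> u \<and> u \<in> generate G S" if "t \<in> insert s S" for t
      using that generate.one[of G S] generate.incl[of _ S G] by (metis insertE)
    then show ?thesis by blast
  qed
  ultimately have "generate G (insert s S) \<subseteq> ?U" by (intro generate_subgroup_incl)
  moreover have "?U \<subseteq> (\<lambda>(i, t). s [^] i \<otimes> t) ` ({..<n} \<times> generate G S)"
  proof
    fix a assume "a \<in> ?U"
    then obtain i t where a: "a = s [^] (i::nat) \<otimes> t" "t \<in> generate G S" by auto
    have "s [^] i = s [^] (n * (i div n) + i mod n)" by simp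
    also have "\<dots> = (s [^] n) [^] (i div n) \<otimes> s [^] (i mod n)"
      using s(1) by (simp only: nat_pow_mult nat_pow_pow)
    also have "\<dots> = s [^] (i mod n)" using s(1) by (simp only: s(2) nat_pow_one l_one nat_pow_closed)
    finally show "a \<in> (\<lambda>(i, t). s [^] i \<otimes> t) ` ({..<n} \<times> generate G S)"
      using a assms(3) by (auto intro!: image_eqI[of _ _ "(i mod n, t)"])
  qed
  moreover have "finite (generate G S)" using insert by auto
  ultimately show ?case by (meson finite_SigmaI finite_imageI finite_lessThan finite_subset)
qed

text \<open>Schreier's argument, made easy by centrality of \<open>C\<close>.\<close>

lemma finite_generate_if_central_finite_index:
  assumes Y: "finite Y" "Y \<subseteq> carrier G" and C: "subgroup C G"
    and central: "\<And>c x. c \<in> C \<Longrightarrow> x \<in> carrier G \<Longrightarrow> c \<otimes> x = x \<otimes> c"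
    and fin: "finite ((\<lambda>x. C #> x) ` generate G Y)"
    and n: "(n::nat) > 0" "\<And>c. c \<in> C \<Longrightarrow> c \<in> generate G Y \<Longrightarrow> c [^] n = \<one>"
  shows "finite (generate G Y)"
proof -
  let ?B = "generate G Y"
  have B: "subgroup ?B G" using Y(2) by (rule generate_is_subgroup)
  note Bc = subgroup.mem_carrier[OF B] and Cc = subgroup.mem_carrier[OF C]
  define r where "r x = (SOME y. y \<in> ?B \<and> C #> y = C #> x)" for x
  have r: "r x \<in> ?B" "C #> r x = C #> x" if "x \<in> ?B" for x
    using someI[of "\<lambda>y. y \<in> ?B \<and> C #> y = C #> x" x] that by (auto simp: r_def)
  have r_eq: "r x = r y" if "C #> x = C #> y" for x y using that by (simp add: r_def)
  have finr: "finite (r ` ?B)" by (rule finite_image_factor[OF fin]) (auto intro: r_eq)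
  define d where "d x = x \<otimes> inv (r x)" for x
  have d: "d x \<in> C" "d x \<in> ?B" "x = d x \<otimes> r x" if "x \<in> ?B" for x
  proof -
    have "x \<in> C #> r x" using that r C Bc by (metis rcos_self)
    then obtain c where c: "c \<in> C" "x = c \<otimes> r x" by (auto simp: r_coset_def)
    have "d x = c"
      using arg_cong[OF c(2), of "\<lambda>y. y \<otimes> inv (r x)"] Cc[OF c(1)] Bc[OF r(1)[OF that]]
      by (simp add: d_def m_assoc)
    then show "d x \<in> C" "x = d x \<otimes> r x" using c by auto
    show "d x \<in> ?B" using that r B by (simp add: d_def subgroup.m_closed subgroup.m_inv_closed)
  qed
  define Y' where "Y' = Y \<union> (\<lambda>y. inv y) ` Y"
  define S where "S = (\<lambda>(x, y). r x \<otimes> y \<otimes> inv (r (x \<otimes> y))) ` (?B \<times> Y')"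
  have Y'B: "Y' \<subseteq> ?B" by (auto simp: Y'_def intro: generate.incl generate.inv)
  \<comment> \<open>By centrality a Schreier generator is the quotient of the \<open>C\<close>-parts
    of \<open>x \<otimes> y\<close> and \<open>x\<close>. In this form the generators telescope
    along a product, which gives \<open>main\<close> below.\<close>
  have S_eq: "r x \<otimes> y \<otimes> inv (r (x \<otimes> y)) = d (x \<otimes> y) \<otimes> inv (d x)" if "x \<in> ?B" "y \<in> ?B" for x y
  proof -
    have xy: "x \<otimes> y \<in> ?B" using subgroup.m_closed[OF B that] .
    note rc = r(1)[OF that(1), THEN Bc] r(1)[OF xy, THEN Bc] Bc[OF that(1)] Bc[OF that(2)] Cc[OF d(1)[OF that(1)]]
    have "d (x \<otimes> y) \<otimes> inv (d x) = inv (d x) \<otimes> d (x \<otimes> y)"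
      using rc C d(1)[OF that(1)] Cc[OF d(1)[OF xy]] by (intro central[symmetric] subgroup.m_inv_closed) auto
    also have "\<dots> = (inv (d x) \<otimes> x) \<otimes> y \<otimes> inv (r (x \<otimes> y))"
      using rc by (simp add: d_def[of "x \<otimes> y"] m_assoc)
    also have "inv (d x) \<otimes> x = r x"
      using arg_cong[OF d(3)[OF that(1)], of "\<lambda>y. inv (d x) \<otimes> y"] rc by simp
    finally show ?thesis by simp
  qed
  have S: "finite S"
  proof -
    have "S \<subseteq> (\<lambda>(u, v, y). u \<otimes> y \<otimes> inv v) ` (r ` ?B \<times> r ` ?B \<times> Y')"
      unfolding S_def using B Y'B by (auto intro!: image_eqI[where x = "(r x, r (x \<otimes> y), y)" for x y] simp: subset_iff subgroup.m_closed)
    moreover have "finite Y'" using Y by (simp add: Y'_def)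
    ultimately show ?thesis using finr by (meson finite_SigmaI finite_imageI finite_subset)
  qed
  have SC: "S \<subseteq> C \<inter> ?B"
  proof
    fix s assume "s \<in> S"
    then obtain x y where xy: "x \<in> ?B" "y \<in> ?B" "s = d (x \<otimes> y) \<otimes> inv (d x)"
      using S_eq Y'B by (auto simp: S_def)
    moreover have "x \<otimes> y \<in> ?B" using subgroup.m_closed[OF B xy(1,2)] .
    ultimately show "s \<in> C \<inter> ?B"
      using d B C by (auto intro: subgroup.m_closed subgroup.m_inv_closed)
  qed
  define L where "L = generate G S"
  have finL: "finite L"
    unfolding L_def using S SC n Cc by (intro finite_generate_central[OF _ _ n(1)]) (auto intro!: central)
  have Lsub: "subgroup L G" unfolding L_def using SC Cc by (intro generate_is_subgroup) auto
  have dS: "d (x \<otimes> y) \<otimes> inv (d x) \<in> S" if "x \<in> ?B" "y \<in> Y'" for x y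
    using S_eq[OF that(1), of y] that Y'B by (force simp: S_def)
  have main: "\<forall>x \<in> ?B. d (x \<otimes> b) \<otimes> inv (d x) \<in> L" if "b \<in> ?B" for b
    using that
  proof (induction rule: generate.induct)
    case one
    then show ?case using d Cc Bc subgroup.one_closed[OF Lsub] by simp
  next
    case (incl h)
    then show ?case using dS[of _ h] by (simp add: L_def Y'_def generate.incl)
  next
    case (inv h)
    then show ?case using dS[of _ "inv h"] by (simp add: L_def Y'_def generate.incl)
  next
    case (eng h1 h2)
    show ?case
    proof
      fix x assume x: "x \<in> ?B"
      have xh: "x \<otimes> h1 \<in> ?B" "x \<otimes> h1 \<otimes> h2 \<in> ?B" 
        using x eng by (simp_all add: subgroup.m_closed[OF B])
      have "d (x \<otimes> h1 \<otimes> h2) \<otimes> inv (d (x \<otimes> h1)) \<otimes> (d (x \<otimes> h1) \<otimes> inv (d x)) \<in> L"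
        by (rule subgroup.m_closed[OF Lsub eng.IH(2)[rule_format, OF xh(1)] eng.IH(1)[rule_format, OF x]])
      moreover have "d (x \<otimes> h1 \<otimes> h2) \<otimes> inv (d (x \<otimes> h1)) \<otimes> (d (x \<otimes> h1) \<otimes> inv (d x)) =
          d (x \<otimes> (h1 \<otimes> h2)) \<otimes> inv (d x)"
        using xh x eng Bc Cc d by (simp add: m_assoc)
      ultimately show "d (x \<otimes> (h1 \<otimes> h2)) \<otimes> inv (d x) \<in> L" by simp
    qed
  qed
  have oneB: "\<one> \<in> ?B" by (rule generate.one)
  \<comment> \<open>The representative of the trivial coset may differ from \<open>\<one>\<close>,
    hence the constant factor \<open>d \<one>\<close>.\<close>
  have "?B \<subseteq> (\<lambda>(l, t). l \<otimes> d \<one> \<otimes> t) ` (L \<times> r ` ?B)"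
  proof
    fix b assume b: "b \<in> ?B"
    have "d b \<otimes> inv (d \<one>) \<in> L" using main[OF b] oneB Bc[OF b] by auto
    moreover have "b = (d b \<otimes> inv (d \<one>)) \<otimes> d \<one> \<otimes> r b"
      using d[OF b] d[OF oneB] Cc r(1)[OF b] Bc by (simp add: m_assoc)
    ultimately show "b \<in> (\<lambda>(l, t). l \<otimes> d \<one> \<otimes> t) ` (L \<times> r ` ?B)"
      using b by (auto intro!: image_eqI[where x = "(d b \<otimes> inv (d \<one>), r b)"])
  qed
  then show ?thesis using finL finr by (meson finite_SigmaI finite_imageI finite_subset)
qed

text \<open>The transfer \<open>A \<rightarrow> C\<close> into a central subgroup of index \<open>n\<close> is invariant under conjugation by
  \<open>G\<close>, so it kills \<open>[A, G]\<close>; on \<open>C\<close> it is the \<open>n\<close>-th power map.\<close>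

lemma transfer_exponent:
  assumes A: "A \<lhd> G" and C: "subgroup C G" "C \<subseteq> A"
    and central: "\<And>c x. c \<in> C \<Longrightarrow> x \<in> carrier G \<Longrightarrow> c \<otimes> x = x \<otimes> c"
    and fin: "finite ((\<lambda>x. C #> x) ` A)"
    and z: "z \<in> generate G {commutator G a g |a g. a \<in> A \<and> g \<in> carrier G}" "z \<in> C"
  shows "z [^] card ((\<lambda>x. C #> x) ` A) = \<one>"
proof -
  note Ac = normal_in_carrier[OF A] and Cc = subgroup.mem_carrier[OF C(1)]
  note Cm = subgroup.m_closed[OF C(1)] and Ci = subgroup.m_inv_closed[OF C(1)]
  let ?R = "(\<lambda>x. C #> x) ` A"
  let ?C = "G\<lparr>carrier := C\<rparr>"
  interpret c: comm_group ?C
    using C(1) central Cc by (intro group.group_comm_groupI subgroup.subgroup_is_group is_group) auto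
  have cinv: "inv\<^bsub>?C\<^esub> x = inv x" if "x \<in> C" for x using that C(1) by (simp add: m_inv_consistent)
  define r where "r c = (SOME a. a \<in> A \<and> C #> a = c)" for c
  have r: "r c \<in> A" "C #> r c = c" if "c \<in> ?R" for c
    using that someI[of "\<lambda>a. a \<in> A \<and> C #> a = c"] by (auto simp: r_def)
  note rc = r(1)[THEN Ac]
  have coset_eq: "C #> x = C #> y \<longleftrightarrow> inv y \<otimes> x \<in> C" if "x \<in> carrier G" "y \<in> carrier G" for x y
  proof
    assume "C #> x = C #> y"
    then have "x \<in> C #> y" using that C(1) by (metis rcos_self)
    then obtain e where e: "e \<in> C" "x = e \<otimes> y" by (auto simp: r_coset_def)
    then have "inv y \<otimes> x = e" using that Cc central[OF e(1) that(2)] by (simp add: e(2))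
    then show "inv y \<otimes> x \<in> C" using e by simp
  next
    assume *: "inv y \<otimes> x \<in> C"
    then have "x = (inv y \<otimes> x) \<otimes> y" using that central[OF *, of y] by simp
    then have "x \<in> C #> y" using * by (auto simp: r_coset_def)
    then show "C #> x = C #> y" using that C(1) by (metis repr_independence)
  qed
  \<comment> \<open>Left multiplication on right cosets; it is well defined because \<open>C\<close>
    is central. \<open>t\<close> is the discrepancy between \<open>a \<otimes> r c\<close> and the
    representative of its coset, and the transfer \<open>V\<close> below multiplies these
    up.\<close>
  define act where "act a c = C #> (a \<otimes> r c)" for a c
  define t where "t a c = inv (r (act a c)) \<otimes> (a \<otimes> r c)" for a c
  have actR: "act a c \<in> ?R" if "a \<in> A" "c \<in> ?R" for a c
    using that r(1) normal_mult[OF A] by (auto simp: act_def)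
  have tC: "t a c \<in> C" if "a \<in> A" "c \<in> ?R" for a c
    using that r[OF actR[OF that]] rc Ac unfolding t_def
    by (subst coset_eq[symmetric]) (auto simp: act_def[symmetric])
  have rt: "a \<otimes> r c = r (act a c) \<otimes> t a c" if "a \<in> A" "c \<in> ?R" for a c
    using that rc[OF that(2)] rc[OF actR[OF that]] Ac by (simp add: t_def)
  have act_eq: "act a c = C #> (a \<otimes> x)" if "a \<in> carrier G" "x \<in> A" "c = C #> x" for a c x
  proof -
    have cR: "c \<in> ?R" using that by auto
    have "C #> r c = C #> x" using r(2)[OF cR] that by simp
    then have "inv x \<otimes> r c \<in> C" using coset_eq[of "r c" x] rc[OF cR] Ac[OF that(2)] by simp
    moreover have "inv (a \<otimes> x) \<otimes> (a \<otimes> r c) = inv x \<otimes> r c"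
      using that rc[OF cR] Ac by (simp add: word)
    ultimately show ?thesis unfolding act_def using that rc[OF cR] Ac by (subst coset_eq) auto
  qed
  have act_mult: "act (a \<otimes> b) c = act a (act b c)" if "a \<in> A" "b \<in> A" "c \<in> ?R" for a b c
    using that act_eq[of a "b \<otimes> r c" "act b c"] rc r normal_mult[OF A] Ac
    by (simp add: act_def m_assoc)
  have act_one: "act \<one> c = c" if "c \<in> ?R" for c
    using that r rc by (simp add: act_def)
  have act_inv: "act (inv a) (act a c) = c" "act a (act (inv a) c) = c" if "a \<in> A" "c \<in> ?R" for a c
    using that act_mult[of "inv a" a c] act_mult[of a "inv a" c] act_one Ac normal_inverse[OF A] by auto
  have bij: "bij_betw (act a) ?R ?R" if "a \<in> A" for a
    using that act_inv actR normal_inverse[OF A] by (intro bij_betwI[where g = "act (inv a)"]) auto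
  define V where "V a = finprod ?C (t a) ?R" for a
  have VC: "V a \<in> C" if "a \<in> A" for a
    unfolding V_def using that tC c.finprod_closed[of "t a" ?R] by auto
  have prod_act: "finprod ?C (\<lambda>c. f (act a c)) ?R = finprod ?C f ?R"
    if "a \<in> A" "f \<in> ?R \<rightarrow> C" for a f
  proof -
    have "finprod ?C f (act a ` ?R) = finprod ?C (\<lambda>c. f (act a c)) ?R"
      using that bij[OF that(1)] by (intro c.finprod_reindex) (auto simp: bij_betw_def)
    then show ?thesis using bij[OF that(1)] by (simp add: bij_betw_def)
  qed
  have Vmult: "V (a \<otimes> b) = V a \<otimes> V b" if "a \<in> A" "b \<in> A" for a b
  proof -
    have ab: "a \<otimes> b \<in> A" using that normal_mult[OF A] by blast
    have "t (a \<otimes> b) c = t a (act b c) \<otimes> t b c" if c: "c \<in> ?R" for c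
    proof -
      have *: "act b c \<in> ?R" "act a (act b c) \<in> ?R"
        using actR \<open>a \<in> A\<close> \<open>b \<in> A\<close> c by auto
      have "t a (act b c) \<otimes> t b c = inv (r (act a (act b c))) \<otimes> a \<otimes> r (act b c) \<otimes> (inv (r (act b c)) \<otimes> (b \<otimes> r c))"
        using rc[OF c] rc[OF *(1)] rc[OF *(2)] Ac \<open>a \<in> A\<close> \<open>b \<in> A\<close> by (simp add: t_def m_assoc)
      also have "\<dots> = t (a \<otimes> b) c"
        using rc[OF c] rc[OF *(1)] rc[OF *(2)] Ac \<open>a \<in> A\<close> \<open>b \<in> A\<close> act_mult c by (simp add: t_def m_assoc)
      finally show ?thesis by simp
    qed
    then have "V (a \<otimes> b) = finprod ?C (\<lambda>c. t a (act b c) \<otimes>\<^bsub>?C\<^esub> t b c) ?R"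
      unfolding V_def using tC that actR Cm by (intro c.finprod_cong') auto
    also have "\<dots> = finprod ?C (\<lambda>c. t a (act b c)) ?R \<otimes>\<^bsub>?C\<^esub> V b"
      unfolding V_def using tC that actR by (intro c.finprod_multf) auto
    also have "finprod ?C (\<lambda>c. t a (act b c)) ?R = V a"
      unfolding V_def using tC that by (intro prod_act) auto
    finally show ?thesis by simp
  qed
  have Vone: "V \<one> = \<one>"
    using Vmult[of \<one> \<one>] VC[of \<one>] normal_one[OF A] Cc by simp
  have Vconj: "V (conjg G g a) = V a" if a: "a \<in> A" and g: "g \<in> carrier G" for a g
  proof -
    \<comment> \<open>\<open>\<phi>\<close> permutes the cosets by conjugation with
      \<open>g\<close>, and \<open>\<zeta>\<close> compares a conjugated representative with the
      chosen one. In the product the \<open>\<zeta>\<close> cancel, as \<open>act a\<close> merely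
      permutes the cosets.\<close>
    define \<phi> where "\<phi> c = C #> conjg G g (r c)" for c
    define \<zeta> where "\<zeta> c = inv (r (\<phi> c)) \<otimes> conjg G g (r c)" for c
    have \<phi>R: "\<phi> c \<in> ?R" if "c \<in> ?R" for c
      using that r(1) g normal_conjg[OF A] by (auto simp: \<phi>_def)
    have \<zeta>C: "\<zeta> c \<in> C" if "c \<in> ?R" for c
      using that r(2)[OF \<phi>R[OF that]] rc \<phi>R[OF that] g unfolding \<zeta>_def
      by (subst coset_eq[symmetric]) (auto simp: \<phi>_def[symmetric])
    have conjC: "conjg G h e = e" if "e \<in> C" "h \<in> carrier G" for e h
      using that Cc central by (subst conjg_eq_iff) auto
    have \<phi>_eq: "\<phi> c = C #> conjg G g x" if "x \<in> A" "c = C #> x" for c x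
    proof -
      have cR: "c \<in> ?R" using that by auto
      have "C #> r c = C #> x" using r(2)[OF cR] that by simp
      then have "inv x \<otimes> r c \<in> C" using coset_eq[of "r c" x] rc[OF cR] Ac[OF that(1)] by simp
      then have "conjg G g (inv x \<otimes> r c) \<in> C" using g conjC by simp
      then have "inv (conjg G g x) \<otimes> conjg G g (r c) \<in> C"
        using g rc[OF cR] Ac[OF that(1)] by (simp add: conjg_mult conjg_inv)
      then show ?thesis unfolding \<phi>_def using that rc[OF cR] Ac g by (subst coset_eq) auto
    qed
    have inj\<phi>: "inj_on \<phi> ?R"
    proof (rule inj_onI)
      fix c d assume cd: "c \<in> ?R" "d \<in> ?R" "\<phi> c = \<phi> d"
      then have "inv (conjg G g (r d)) \<otimes> conjg G g (r c) \<in> C"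
        unfolding \<phi>_def using coset_eq rc g by simp
      then have "conjg G (inv g) (inv (conjg G g (r d)) \<otimes> conjg G g (r c)) \<in> C"
        using conjC g by simp
      moreover have "conjg G (inv g) (inv (conjg G g (r d)) \<otimes> conjg G g (r c)) = inv (r d) \<otimes> r c"
        using rc cd g by (simp add: conjg_mult conjg_inv)
      ultimately have "C #> r c = C #> r d" using coset_eq rc cd by simp
      then show "c = d" using r cd by simp
    qed
    then have \<phi>im: "\<phi> ` ?R = ?R"
      using fin \<phi>R by (intro card_subset_eq) (auto simp: card_image)
    have ag: "conjg G g a \<in> A" using a g normal_conjg[OF A] by blast
    have key: "t (conjg G g a) (\<phi> c) = \<zeta> (act a c) \<otimes> (inv (\<zeta> c) \<otimes> t a c)" if c: "c \<in> ?R" for c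
    proof -
      note aR = actR[OF a c]
      note cc = rc[OF c] rc[OF aR] rc[OF \<phi>R[OF c]] rc[OF \<phi>R[OF aR]] Ac[OF a] g Cc[OF \<zeta>C[OF c]] Cc[OF \<zeta>C[OF aR]] Cc[OF tC[OF a c]]
      have "act (conjg G g a) (\<phi> c) = C #> (conjg G g a \<otimes> conjg G g (r c))"
        using act_eq[of "conjg G g a" "conjg G g (r c)" "\<phi> c"] ag r(1)[OF c] g Ac normal_conjg[OF A]
        by (simp add: \<phi>_def)
      also have "conjg G g a \<otimes> conjg G g (r c) = conjg G g (a \<otimes> r c)"
        using cc by (simp add: conjg_mult)
      also have "C #> \<dots> = \<phi> (act a c)"
        using a r(1)[OF c] normal_mult[OF A] by (intro \<phi>_eq[symmetric]) (auto simp: act_def)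
      finally have act\<phi>: "act (conjg G g a) (\<phi> c) = \<phi> (act a c)" .
      have r\<phi>: "r (\<phi> e) = conjg G g (r e) \<otimes> inv (\<zeta> e)" if "e \<in> ?R" for e
        using that rc[OF that] rc[OF \<phi>R[OF that]] g by (simp add: \<zeta>_def inv_mult_group m_assoc[symmetric])
      have tc: "conjg G g (inv (r (act a c)) \<otimes> (a \<otimes> r c)) = t a c"
        using conjC[OF tC[OF a c] g] by (simp add: t_def)
      have "t (conjg G g a) (\<phi> c) = inv (conjg G g (r (act a c)) \<otimes> inv (\<zeta> (act a c))) \<otimes>
          (conjg G g a \<otimes> (conjg G g (r c) \<otimes> inv (\<zeta> c)))"
        unfolding t_def act\<phi> r\<phi>[OF c] r\<phi>[OF aR] ..
      also have "\<dots> = \<zeta> (act a c) \<otimes> (conjg G g (inv (r (act a c)) \<otimes> (a \<otimes> r c)) \<otimes> inv (\<zeta> c))"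
        using cc by (simp add: word)
      also have "\<dots> = \<zeta> (act a c) \<otimes> (inv (\<zeta> c) \<otimes> t a c)"
        unfolding tc using central[OF Ci[OF \<zeta>C[OF c]], of "t a c"] cc by simp
      finally show ?thesis .
    qed
    have "V (conjg G g a) = finprod ?C (t (conjg G g a)) (\<phi> ` ?R)" by (simp only: V_def \<phi>im)
    also have "\<dots> = finprod ?C (\<lambda>c. t (conjg G g a) (\<phi> c)) ?R"
      using tC[OF ag] \<phi>R by (intro c.finprod_reindex inj\<phi>) auto
    also have "\<dots> = finprod ?C (\<lambda>c. \<zeta> (act a c) \<otimes>\<^bsub>?C\<^esub> (inv\<^bsub>?C\<^esub> (\<zeta> c) \<otimes>\<^bsub>?C\<^esub> t a c)) ?R"
      using key tC \<zeta>C actR a cinv Cm Ci by (intro c.finprod_cong') auto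
    also have "\<dots> = finprod ?C (\<lambda>c. \<zeta> (act a c)) ?R \<otimes>\<^bsub>?C\<^esub> finprod ?C (\<lambda>c. inv\<^bsub>?C\<^esub> (\<zeta> c) \<otimes>\<^bsub>?C\<^esub> t a c) ?R"
      using tC \<zeta>C actR a cinv Cm Ci by (intro c.finprod_multf) auto
    also have "finprod ?C (\<lambda>c. inv\<^bsub>?C\<^esub> (\<zeta> c) \<otimes>\<^bsub>?C\<^esub> t a c) ?R = finprod ?C (\<lambda>c. inv\<^bsub>?C\<^esub> (\<zeta> c)) ?R \<otimes>\<^bsub>?C\<^esub> V a"
      unfolding V_def using tC \<zeta>C a cinv Ci by (intro c.finprod_multf) auto
    also have "finprod ?C (\<lambda>c. \<zeta> (act a c)) ?R = finprod ?C \<zeta> ?R"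
      using a \<zeta>C by (intro prod_act) auto
    also have "finprod ?C \<zeta> ?R \<otimes>\<^bsub>?C\<^esub> (finprod ?C (\<lambda>c. inv\<^bsub>?C\<^esub> (\<zeta> c)) ?R \<otimes>\<^bsub>?C\<^esub> V a) = 
       (finprod ?C \<zeta> ?R \<otimes>\<^bsub>?C\<^esub> finprod ?C (\<lambda>c. inv\<^bsub>?C\<^esub> (\<zeta> c)) ?R) \<otimes>\<^bsub>?C\<^esub> V a"
      using \<zeta>C VC[OF a] Ci cinv by (intro c.m_assoc[symmetric] c.finprod_closed) auto
    also have "finprod ?C \<zeta> ?R \<otimes>\<^bsub>?C\<^esub> finprod ?C (\<lambda>c. inv\<^bsub>?C\<^esub> (\<zeta> c)) ?R = finprod ?C (\<lambda>c. \<one>\<^bsub>?C\<^esub>) ?R"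
      using \<zeta>C Ci cinv Cc subgroup.one_closed[OF C(1)] by (subst c.finprod_multf[symmetric]) (auto intro!: c.finprod_cong')
    also have "\<dots> = \<one>\<^bsub>?C\<^esub>" by (rule c.finprod_one_eqI) auto
    finally show ?thesis using VC[OF a] Cc by simp
  qed
  have AV: "subgroup {a \<in> A. V a = \<one>} G"
  proof (rule subgroupI)
    fix a assume a: "a \<in> {a \<in> A. V a = \<one>}"
    then have "V (inv a \<otimes> a) = V (inv a) \<otimes> \<one>"
      using Vmult[of "inv a" a] normal_inverse[OF A] by auto
    then have "V (inv a) = \<one>"
      using a Vone VC[of "inv a"] normal_inverse[OF A] Ac Cc by auto
    then show "inv a \<in> {a \<in> A. V a = \<one>}" using a normal_inverse[OF A] by auto
  next
    show "{a \<in> A. V a = \<one>} \<noteq> {}" using Vone normal_one[OF A] by blast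
  qed (use Ac Vmult normal_mult[OF A] in auto)
  have "V (commutator G a g) = \<one>" if "a \<in> A" "g \<in> carrier G" for a g
  proof -
    have "V (commutator G a g) = V (inv a) \<otimes> V (conjg G g a)"
      using that Ac by (simp add: commutator_conjg Vmult normal_inverse[OF A] normal_conjg[OF A])
    also have "\<dots> = V (inv a \<otimes> a)" using that by (simp add: Vconj Vmult normal_inverse[OF A])
    finally show ?thesis using that Ac Vone by simp
  qed
  then have "generate G {commutator G a g |a g. a \<in> A \<and> g \<in> carrier G} \<subseteq> {a \<in> A. V a = \<one>}"
    by (intro generate_subgroup_incl[OF _ AV]) (auto intro: normal_commutator_left[OF A])
  then have "V z = \<one>" using z by auto
  moreover have "V z = z [^] card ?R"
  proof -
    have "t z c = z" if c: "c \<in> ?R" for c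
    proof -
      have "act z c = C #> (z \<otimes> r c)" by (simp add: act_def)
      also have "\<dots> = C #> r c"
        using z(2) rc[OF c] Cc central[of z "r c"] by (subst coset_eq) auto
      finally have "act z c = c" using r(2)[OF c] by simp
      then show ?thesis using z(2) rc[OF c] Cc central[of z "r c"] by (simp add: t_def)
    qed
    then have "V z = finprod ?C (\<lambda>c. z) ?R"
      unfolding V_def using z(2) by (intro c.finprod_cong') auto
    also have "\<dots> = z [^]\<^bsub>?C\<^esub> card ?R" using z(2) by (intro c.finprod_const) auto
    also have "\<dots> = z [^] card ?R" by (simp flip: nat_pow_consistent)
    finally show ?thesis .
  qed
  ultimately show ?thesis by simp
qed

end

subsection \<open>Baer's theorem\<close>

primrec upper_central :: "('a, 'b) monoid_scheme \<Rightarrow> nat \<Rightarrow> 'a set" where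
  "upper_central G 0 = {\<one>\<^bsub>G\<^esub>}"
| "upper_central G (Suc j) = {x \<in> carrier G. \<forall>g \<in> carrier G. commutator G x g \<in> upper_central G j}"

text \<open>Indices are shifted by one: \<open>abstract_lower_central G i\<close> is the term \<open>\<gamma>\<close> with index \<open>i + 1\<close>.\<close>

primrec abstract_lower_central :: "('a, 'b) monoid_scheme \<Rightarrow> nat \<Rightarrow> 'a set" where
  "abstract_lower_central G 0 = carrier G"
| "abstract_lower_central G (Suc i) =
     generate G {commutator G a g |a g. a \<in> abstract_lower_central G i \<and> g \<in> carrier G}"

context group
begin

text \<open>Schur's theorem relative to a normal subgroup. With \<open>C\<close> the central
  elements in \<open>A\<close>, the transfer bounds the exponent of the part of the commutator
  subgroup inside \<open>C\<close>, and Schreier's argument then gives finiteness from the finitely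
  many values.\<close>

lemma finite_generate_commutators:
  assumes A: "A \<lhd> G"
    and fin: "finite ((\<lambda>x. {z \<in> A. \<forall>g \<in> carrier G. z \<otimes> g = g \<otimes> z} #> x) ` A)"
    and vals: "finite {commutator G a g |a g. a \<in> A \<and> g \<in> carrier G}"
  shows "finite (generate G {commutator G a g |a g. a \<in> A \<and> g \<in> carrier G})"
proof -
  note Ac = normal_in_carrier[OF A]
  let ?Y = "{commutator G a g |a g. a \<in> A \<and> g \<in> carrier G}"
  define C where "C = {z \<in> A. \<forall>g \<in> carrier G. z \<otimes> g = g \<otimes> z}"
  have C: "subgroup C G"
  proof (rule subgroupI)
    show "C \<noteq> {}" using normal_one[OF A] by (auto simp: C_def)
    fix a assume a: "a \<in> C"
    have "inv a \<otimes> g = g \<otimes> inv a" if "g \<in> carrier G" for g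
    proof -
      have ac: "a \<in> carrier G" and ag: "g \<otimes> a = a \<otimes> g" using a that Ac by (auto simp: C_def)
      have "inv a \<otimes> g = inv a \<otimes> (g \<otimes> a) \<otimes> inv a" using ac that by (simp add: m_assoc)
      also have "\<dots> = g \<otimes> inv a" unfolding ag using ac that by (simp add: m_assoc)
      finally show ?thesis .
    qed
    then show "inv a \<in> C" using a normal_inverse[OF A] by (simp add: C_def)
    fix b assume b: "b \<in> C"
    have "a \<otimes> b \<otimes> g = g \<otimes> (a \<otimes> b)" if "g \<in> carrier G" for g
    proof -
      have ac: "a \<in> carrier G" "b \<in> carrier G" and ag: "a \<otimes> g = g \<otimes> a" "b \<otimes> g = g \<otimes> b"
        using a b that Ac by (auto simp: C_def)
      have "a \<otimes> b \<otimes> g = a \<otimes> (b \<otimes> g)" using ac that by (simp add: m_assoc)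
      also have "\<dots> = (a \<otimes> g) \<otimes> b" unfolding ag(2) using ac that by (simp add: m_assoc)
      also have "\<dots> = g \<otimes> (a \<otimes> b)" unfolding ag(1) using ac that by (simp add: m_assoc)
      finally show ?thesis .
    qed
    then show "a \<otimes> b \<in> C" using a b normal_mult[OF A] by (simp add: C_def)
  qed (use Ac in \<open>auto simp: C_def\<close>)
  have YA: "generate G ?Y \<subseteq> A"
    using A by (intro generate_subgroup_incl) (auto simp: normal_imp_subgroup normal_commutator_left)
  show ?thesis
  proof (rule finite_generate_if_central_finite_index[OF vals _ C])
    show "?Y \<subseteq> carrier G" using Ac by auto
    show "finite ((\<lambda>x. C #> x) ` generate G ?Y)"
      using fin YA unfolding C_def by (meson finite_subset image_mono)
    show "card ((\<lambda>x. C #> x) ` A) > 0"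
      using fin normal_one[OF A] unfolding C_def by (subst card_gt_0_iff) auto
    show "c [^] card ((\<lambda>x. C #> x) ` A) = \<one>" if "c \<in> C" "c \<in> generate G ?Y" for c
      using that fin by (intro transfer_exponent[OF A C]) (auto simp: C_def)
  qed (use Ac in \<open>auto simp: C_def\<close>)
qed

lemma upper_central_normal: "upper_central G j \<lhd> G"
proof (induction j)
  case 0
  then show ?case by (simp add: one_is_normal)
next
  case (Suc j)
  have "subgroup (upper_central G (Suc j)) G"
    using subgroup_commutator_left_mem[OF Suc, of "carrier G"] by simp
  moreover have "g \<otimes> x \<otimes> inv g \<in> upper_central G (Suc j)"
    if "g \<in> carrier G" "x \<in> upper_central G (Suc j)" for g x
  proof -
    have "commutator G (conjg G (inv g) x) h \<in> upper_central G j" if h: "h \<in> carrier G" for h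
    proof -
      have "commutator G (conjg G (inv g) x) h = conjg G (inv g) (commutator G x (conjg G g h))"
        using \<open>g \<in> carrier G\<close> \<open>x \<in> upper_central G (Suc j)\<close> h by (simp add: conjg_commutator)
      then show ?thesis
        using \<open>g \<in> carrier G\<close> \<open>x \<in> upper_central G (Suc j)\<close> h by (simp add: normal_conjg[OF Suc])
    qed
    then show ?thesis using that by (simp add: conjg_def)
  qed
  ultimately show ?case by (simp add: normal_inv_iff)
qed

lemma abstract_lower_central_normal: "abstract_lower_central G i \<lhd> G"
proof (induction i)
  case 0
  then show ?case by (simp add: normal_self)
next
  case (Suc i)
  show ?case unfolding abstract_lower_central.simps
  proof (rule generate_normal_if_conjg)
    fix g y assume g: "g \<in> carrier G"
      and "y \<in> {commutator G a g |a g. a \<in> abstract_lower_central G i \<and> g \<in> carrier G}"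
    then obtain a h where "y = commutator G a h" "a \<in> abstract_lower_central G i" "h \<in> carrier G" by auto
    then have "conjg G g y = commutator G (conjg G g a) (conjg G g h)"
      "conjg G g a \<in> abstract_lower_central G i" "conjg G g h \<in> carrier G"
      using g normal_in_carrier[OF Suc] normal_conjg[OF Suc] by (auto simp: conjg_commutator)
    then show "conjg G g y \<in> {commutator G a g |a g. a \<in> abstract_lower_central G i \<and> g \<in> carrier G}"
      by blast
  qed (use normal_in_carrier[OF Suc] in auto)
qed

lemma lcomm_in_abstract_lower_central:
  "x \<in> carrier G \<Longrightarrow> set xs \<subseteq> carrier G \<Longrightarrow> lcomm G x xs \<in> abstract_lower_central G (length xs)"
  by (induction xs rule: rev_induct) (auto intro!: generate.incl)

text \<open>A case of the three subgroups lemma at the level of elements: under the two conditions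
  \<open>a \<otimes> b\<close> and \<open>b \<otimes> a\<close> conjugate \<open>y\<close> to the
  same element, so \<open>y\<close> commutes with their quotient, which is the commutator of the
  inverses.\<close>

lemma commutator_commutator_eq_one:
  assumes c: "y \<in> carrier G" "a \<in> carrier G" "b \<in> carrier G"
    and central: "\<And>g. g \<in> carrier G \<Longrightarrow> commutator G (commutator G y a) g = \<one>"
    and ba: "commutator G (commutator G y b) a = \<one>"
  shows "commutator G y (commutator G (inv a) (inv b)) = \<one>"
proof -
  define \<alpha> \<beta> where "\<alpha> = commutator G y a" and "\<beta> = commutator G y b"
  have ab: "\<alpha> \<in> carrier G" "\<beta> \<in> carrier G" using c by (auto simp: \<alpha>_def \<beta>_def)
  have "conjg G b \<alpha> = \<alpha>" "\<alpha> \<otimes> \<beta> = \<beta> \<otimes> \<alpha>" "conjg G a \<beta> = \<beta>"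
    using central[of b] central[of \<beta>] ba c ab
    by (simp_all add: conjg_eq_iff commutator_eq_one_iff flip: \<alpha>_def \<beta>_def)
  moreover have "conjg G a y = y \<otimes> \<alpha>" "conjg G b y = y \<otimes> \<beta>"
    using c by (simp_all add: \<alpha>_def \<beta>_def word)
  ultimately have "conjg G b (conjg G a y) = conjg G a (conjg G b y)"
    using c ab by (simp add: conjg_mult m_assoc)
  then have "conjg G (inv (b \<otimes> a)) (conjg G (a \<otimes> b) y) = conjg G (inv (b \<otimes> a)) (conjg G (b \<otimes> a) y)"
    using c by (simp add: conjg_conjg)
  then have "conjg G (a \<otimes> b \<otimes> inv (b \<otimes> a)) y = y"
    using c by (simp add: conjg_conjg)
  moreover have "a \<otimes> b \<otimes> inv (b \<otimes> a) = commutator G (inv a) (inv b)" using c by (simp add: word)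
  ultimately show ?thesis using c by (simp add: conjg_eq_iff commutator_eq_one_iff)
qed

lemma mod_commutator_commutator:
  assumes M: "M \<lhd> G" and c: "y \<in> carrier G" "a \<in> carrier G" "b \<in> carrier G"
    and central: "\<And>g. g \<in> carrier G \<Longrightarrow> commutator G (commutator G y a) g \<in> M"
    and ba: "commutator G (commutator G y b) a \<in> M"
  shows "commutator G y (commutator G (inv a) (inv b)) \<in> M"
proof -
  interpret q: group_hom G "G Mod M" "\<lambda>x. M #> x" using M by (rule mod_hom)
  have *: "M #> x = \<one>\<^bsub>G Mod M\<^esub> \<longleftrightarrow> x \<in> M" if "x \<in> carrier G" for x
    using that M by (rule mod_eq_one_iff[rotated])
  have "commutator (G Mod M) (M #> y) (commutator (G Mod M) (inv\<^bsub>G Mod M\<^esub> (M #> a)) (inv\<^bsub>G Mod M\<^esub> (M #> b))) = \<one>\<^bsub>G Mod M\<^esub>"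
  proof (rule q.H.commutator_commutator_eq_one)
    fix g assume "g \<in> carrier (G Mod M)"
    then obtain h where h: "h \<in> carrier G" "g = M #> h" by (auto simp: carrier_FactGroup)
    then have "M #> commutator G (commutator G y a) h = \<one>\<^bsub>G Mod M\<^esub>"
      using central[OF h(1)] c by (subst *) auto
    then show "commutator (G Mod M) (commutator (G Mod M) (M #> y) (M #> a)) g = \<one>\<^bsub>G Mod M\<^esub>"
      using h c by (simp add: q.hom_commutator del: one_FactGroup)
  next
    have "M #> commutator G (commutator G y b) a = \<one>\<^bsub>G Mod M\<^esub>"
      using ba c by (subst *) auto
    then show "commutator (G Mod M) (commutator (G Mod M) (M #> y) (M #> b)) (M #> a) = \<one>\<^bsub>G Mod M\<^esub>"
      using c by (simp add: q.hom_commutator del: one_FactGroup)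
  qed (use c in auto)
  then have "M #> commutator G y (commutator G (inv a) (inv b)) = \<one>\<^bsub>G Mod M\<^esub>"
    using c by (simp add: q.hom_commutator del: one_FactGroup)
  then show ?thesis using c by (subst (asm) *) auto
qed

text \<open>Induction along the lower series by \<open>mod_commutator_commutator\<close>. Truncated
  subtraction gives the right answer: for \<open>Suc i \<ge> m\<close> the commutator is
  trivial.\<close>

lemma commutator_upper_lower_central:
  assumes "y \<in> upper_central G m" "u \<in> abstract_lower_central G i"
  shows "commutator G y u \<in> upper_central G (m - Suc i)"
  using assms
proof (induction i arbitrary: m y u)
  case 0
  then show ?case by (cases m) auto
next
  case (Suc i)
  let ?K = "upper_central G (m - Suc (Suc i))"
  note K = upper_central_normal[of "m - Suc (Suc i)"]
  note mc = normal_in_carrier[OF upper_central_normal]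
  note lc = normal_in_carrier[OF abstract_lower_central_normal]
  let ?S = "{c \<in> carrier G. \<forall>d \<in> upper_central G m. commutator G d c \<in> ?K}"
  have S: "subgroup ?S G" by (rule subgroup_commutator_right_mem[OF K]) (use mc in auto)
  have "commutator G a b \<in> ?S" if ab: "a \<in> abstract_lower_central G i" "b \<in> carrier G" for a b
  proof -
    have "commutator G y (commutator G a b) \<in> ?K" if y: "y \<in> upper_central G m" for y
    proof -
      have a': "inv a \<in> abstract_lower_central G i"
        using ab abstract_lower_central_normal by (simp add: normal_inverse)
      \<comment> \<open>The double inverses fit \<open>mod_commutator_commutator\<close>, whose
        conclusion is about inverses.\<close>
      have "commutator G y (commutator G (inv (inv a)) (inv (inv b))) \<in> ?K"
      proof (rule mod_commutator_commutator[OF K])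
        fix g assume g: "g \<in> carrier G"
        have "commutator G y (inv a) \<in> upper_central G (m - Suc i)" by (rule Suc.IH[OF y a'])
        then show "commutator G (commutator G y (inv a)) g \<in> ?K"
          using g Suc.prems by (cases "m - Suc i") (auto simp: Suc_diff_Suc diff_Suc split: nat.splits)
      next
        have "commutator G y (inv b) \<in> upper_central G (m - 1)"
          using y ab by (cases m) auto
        then have "commutator G (commutator G y (inv b)) (inv a) \<in> upper_central G (m - 1 - Suc i)"
          using a' by (rule Suc.IH)
        then show "commutator G (commutator G y (inv b)) (inv a) \<in> ?K" by simp
      qed (use y ab mc lc in auto)
      then show ?thesis using ab lc by simp
    qed
    then show ?thesis using ab lc by auto
  qed
  then have "abstract_lower_central G (Suc i) \<subseteq> ?S"
    unfolding abstract_lower_central.simps by (intro generate_subgroup_incl[OF _ S]) auto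
  then show ?case using Suc.prems by blast
qed

text \<open>Schur's argument is applied in turn to the terms of the lower central series modulo those of the
  upper one.\<close>

theorem finite_abstract_lower_central:
  assumes fin: "finite ((\<lambda>x. upper_central G n #> x) ` carrier G)"
  shows "finite (abstract_lower_central G n)"
proof -
  note mc = normal_in_carrier[OF upper_central_normal]
  note lc = normal_in_carrier[OF abstract_lower_central_normal]
  \<comment> \<open>Each step down the lower series allows one step down the upper one; at
    \<open>i = n\<close> the latter is trivial and the image is the lower central term
    itself.\<close>
  have "finite ((\<lambda>x. upper_central G (n - i) #> x) ` abstract_lower_central G i)" if "i \<le> n" for i
    using that
  proof (induction i)
    case 0
    then show ?case using fin by simp
  next
    case (Suc i)
    define j where "j = n - Suc i"
    have j: "n - i = Suc j" using Suc.prems by (simp add: j_def)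
    let ?A = "abstract_lower_central G i" and ?M = "upper_central G j"
    note M = upper_central_normal[of j]
    note M' = upper_central_normal[of "Suc j"]
    let ?Q = "G Mod ?M" and ?q = "\<lambda>x. ?M #> x"
    interpret q: group_hom G ?Q ?q using M by (rule mod_hom)
    have q1: "?q x = \<one>\<^bsub>?Q\<^esub> \<longleftrightarrow> x \<in> ?M" if "x \<in> carrier G" for x
      using that M by (rule mod_eq_one_iff[rotated])
    have surj: "\<exists>h \<in> carrier G. g = ?q h" if "g \<in> carrier ?Q" for g
      using that by (auto simp: carrier_FactGroup)
    have IH: "finite ((\<lambda>x. upper_central G (Suc j) #> x) ` ?A)"
      using Suc by (simp flip: j)
    have A': "?q ` ?A \<lhd> ?Q"
    proof (subst q.H.normal_inv_iff, intro conjI ballI)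
      show "subgroup (?q ` ?A) ?Q"
        by (intro q.subgroup_img_is_subgroup normal_imp_subgroup abstract_lower_central_normal)
      fix x h assume "x \<in> carrier ?Q" "h \<in> ?q ` ?A"
      then obtain x' a where xa: "x' \<in> carrier G" "x = ?q x'" "a \<in> ?A" "h = ?q a" using surj by blast
      then have "x \<otimes>\<^bsub>?Q\<^esub> h \<otimes>\<^bsub>?Q\<^esub> inv\<^bsub>?Q\<^esub> x = ?q (conjg G (inv x') a)"
        using lc by (simp only: q.hom_mult q.hom_inv conjg_def inv_closed m_closed inv_inv)
      then show "x \<otimes>\<^bsub>?Q\<^esub> h \<otimes>\<^bsub>?Q\<^esub> inv\<^bsub>?Q\<^esub> x \<in> ?q ` ?A"
        using xa normal_conjg[OF abstract_lower_central_normal] by auto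
    qed
    let ?C = "{z \<in> ?q ` ?A. \<forall>g \<in> carrier ?Q. z \<otimes>\<^bsub>?Q\<^esub> g = g \<otimes>\<^bsub>?Q\<^esub> z}"
    have diff: "\<exists>z \<in> upper_central G m. a = z \<otimes> b"
      if "upper_central G m #> a = upper_central G m #> b" "a \<in> carrier G" "b \<in> carrier G" for m a b
    proof -
      have "a \<in> upper_central G m #> b"
        using that by (metis rcos_self normal_imp_subgroup upper_central_normal)
      then show ?thesis by (auto simp: r_coset_def)
    qed
    \<comment> \<open>Elements of \<open>?A\<close> in the next upper central term become central
      modulo \<open>?M\<close>, so the index in the induction hypothesis bounds that of
      \<open>?C\<close>.\<close>
    have "finite ((\<lambda>x. ?C #>\<^bsub>?Q\<^esub> ?q x) ` ?A)"
    proof (rule finite_image_factor[OF IH])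
      fix a b assume ab: "a \<in> ?A" "b \<in> ?A" "upper_central G (Suc j) #> a = upper_central G (Suc j) #> b"
      then obtain z where z: "z \<in> upper_central G (Suc j)" "a = z \<otimes> b" using diff lc by blast
      have zc: "z \<in> carrier G" using z mc by blast
      have "z = a \<otimes> inv b" using z zc lc[OF ab(2)] by (simp add: m_assoc)
      then have "z \<in> ?A"
        using ab abstract_lower_central_normal by (simp add: normal_mult normal_inverse)
      have "?q z \<otimes>\<^bsub>?Q\<^esub> g = g \<otimes>\<^bsub>?Q\<^esub> ?q z" if g: "g \<in> carrier ?Q" for g
      proof -
        obtain h where h: "h \<in> carrier G" "g = ?q h" using surj[OF g] by blast
        have "?q (commutator G z h) = \<one>\<^bsub>?Q\<^esub>" using z h zc by (subst q1) auto
        then have "commutator ?Q (?q z) g = \<one>\<^bsub>?Q\<^esub>"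
          using h zc by (simp add: q.hom_commutator del: one_FactGroup)
        then show ?thesis using g zc by (subst (asm) q.H.commutator_eq_one_iff) auto
      qed
      then have zC: "?q z \<in> ?C" using \<open>z \<in> ?A\<close> by blast
      have Csub: "subgroup ?C ?Q"
      proof -
        have "?C = (?q ` ?A) \<inter> {c \<in> carrier ?Q. \<forall>d \<in> carrier ?Q. commutator ?Q c d \<in> {\<one>\<^bsub>?Q\<^esub>}}"
          using normal_imp_subgroup[OF A', THEN subgroup.subset] q.H.commutator_eq_one_iff by blast
        also have "subgroup \<dots> ?Q"
          by (intro q.H.subgroups_Inter_pair normal_imp_subgroup[OF A'] q.H.subgroup_commutator_left_mem q.H.one_is_normal) auto
        finally show ?thesis .
      qed
      have "?q a = ?q z \<otimes>\<^bsub>?Q\<^esub> ?q b" using z(2) zc lc[OF ab(2)] by (simp only: q.hom_mult)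
      then have "?q a \<in> ?C #>\<^bsub>?Q\<^esub> ?q b" 
        unfolding r_coset_def[of ?Q ?C "?q b"] using zC by (intro UN_I[of "?q z"]) (simp_all only: singleton_iff)
      then show "?C #>\<^bsub>?Q\<^esub> ?q a = ?C #>\<^bsub>?Q\<^esub> ?q b"
        using Csub lc[OF ab(2)] q.H.repr_independence[of "?q a" ?C "?q b"] by simp
    qed
    then have fin1: "finite ((\<lambda>x. ?C #>\<^bsub>?Q\<^esub> x) ` ?q ` ?A)" by (simp add: image_image)
    have vals: "{commutator ?Q a g |a g. a \<in> ?q ` ?A \<and> g \<in> carrier ?Q} =
        (\<lambda>(a, g). ?q (commutator G a g)) ` (?A \<times> carrier G)"
      using lc by (force simp: q.hom_commutator carrier_FactGroup image_iff)
    \<comment> \<open>Modulo \<open>?M\<close> the commutator depends only on \<open>a\<close>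
      modulo term \<open>Suc j\<close> and on \<open>g\<close> modulo term \<open>n\<close>: the
      first by definition, the second because commutators of term \<open>n\<close> with
      \<open>?A\<close> fall into term \<open>n - Suc i = j\<close>.\<close>
    have "finite ((\<lambda>(a, g). ?q (commutator G a g)) ` (?A \<times> carrier G))"
    proof (rule finite_image_factor[where f = "\<lambda>(a, g). (upper_central G (Suc j) #> a, upper_central G n #> g)"])
      have "(\<lambda>(a, g). (upper_central G (Suc j) #> a, upper_central G n #> g)) ` (?A \<times> carrier G) \<subseteq>
          (\<lambda>x. upper_central G (Suc j) #> x) ` ?A \<times> (\<lambda>x. upper_central G n #> x) ` carrier G" by auto
      then show "finite ((\<lambda>(a, g). (upper_central G (Suc j) #> a, upper_central G n #> g)) ` (?A \<times> carrier G))"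
        using IH fin by (meson finite_SigmaI finite_subset)
    next
      fix x y assume "x \<in> ?A \<times> carrier G" "y \<in> ?A \<times> carrier G"
        and eq: "(case x of (a, g) \<Rightarrow> (upper_central G (Suc j) #> a, upper_central G n #> g)) =
          (case y of (a, g) \<Rightarrow> (upper_central G (Suc j) #> a, upper_central G n #> g))"
      then obtain a g b h where xy: "x = (a, g)" "y = (b, h)" "a \<in> ?A" "b \<in> ?A" "g \<in> carrier G" "h \<in> carrier G"
        by (cases x; cases y) auto
      obtain z where z: "z \<in> upper_central G (Suc j)" "a = z \<otimes> b" using diff[of "Suc j" a b] eq xy lc by auto
      obtain w where w: "w \<in> upper_central G n" "g = w \<otimes> h" using diff[of n g h] eq xy by auto
      note cc = mc[OF z(1)] mc[OF w(1)] lc[OF xy(3)] lc[OF xy(4)] xy(5,6)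
      have "commutator G a g = conjg G b (commutator G z g) \<otimes> (commutator G b h \<otimes> conjg G h (commutator G b w))"
        unfolding z(2) using cc by (simp add: commutator_mult_left) (simp add: w(2) commutator_mult_right)
      moreover have "commutator G z g \<in> ?M" using z cc by simp
      then have "?q (conjg G b (commutator G z g)) = \<one>\<^bsub>?Q\<^esub>"
        using cc normal_conjg[OF M] by (subst q1) auto
      moreover have "commutator G w b \<in> ?M"
        using commutator_upper_lower_central[OF w(1) xy(4)] by (simp add: j_def)
      then have "commutator G b w \<in> ?M" using cc by (metis commutator_inverse normal_inverse[OF M])
      then have "?q (conjg G h (commutator G b w)) = \<one>\<^bsub>?Q\<^esub>"
        using cc normal_conjg[OF M] by (subst q1) auto
      ultimately have "?q (commutator G a g) = ?q (commutator G b h)"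
        using cc by (simp only: q.hom_mult q.H.l_one q.H.r_one q.hom_closed conjg_closed commutator_closed m_closed)
      then show "(case x of (a, g) \<Rightarrow> ?q (commutator G a g)) = (case y of (a, g) \<Rightarrow> ?q (commutator G a g))"
        by (simp add: xy)
    qed
    then have "finite (generate ?Q {commutator ?Q a g |a g. a \<in> ?q ` ?A \<and> g \<in> carrier ?Q})"
      using fin1 by (intro q.H.finite_generate_commutators[OF A']) (simp_all only: vals)
    moreover have "?q ` abstract_lower_central G (Suc i) =
        generate ?Q (?q ` {commutator G a g |a g. a \<in> ?A \<and> g \<in> carrier G})"
      unfolding abstract_lower_central.simps using lc by (intro q.generate_img[symmetric]) auto
    moreover have "?q ` {commutator G a g |a g. a \<in> ?A \<and> g \<in> carrier G} =
        {commutator ?Q a g |a g. a \<in> ?q ` ?A \<and> g \<in> carrier ?Q}"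
      unfolding vals by force
    ultimately show ?case by (simp add: j_def)
  qed
  from this[of n] have "finite ((\<lambda>x. {\<one>} #> x) ` abstract_lower_central G n)" by simp
  then show ?thesis
  proof (rule finite_image_factor[where g = id, simplified])
    fix a b assume "a \<in> abstract_lower_central G n" "b \<in> abstract_lower_central G n" "{\<one>} #> a = {\<one>} #> b"
    then show "a = b" using lc by (simp add: r_coset_def)
  qed
qed

end

subsection \<open>Open normal subgroups\<close>

lemma (in group) normal_set_mult:
  assumes N: "N \<lhd> G" and M: "M \<lhd> G"
  shows "{n \<otimes> m |n m. n \<in> N \<and> m \<in> M} \<lhd> G" (is "?P \<lhd> G")
proof -
  note c = normal_in_carrier[OF N] normal_in_carrier[OF M]
  have swap: "m \<otimes> n = conjg G (inv m) n \<otimes> m" if "n \<in> carrier G" "m \<in> carrier G" for n m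
    using that by (simp add: word)
  have "subgroup ?P G"
  proof (rule subgroupI)
    show "?P \<subseteq> carrier G" using c by auto
    have "\<one> \<otimes> \<one> \<in> ?P" using normal_one[OF N] normal_one[OF M] by blast
    then show "?P \<noteq> {}" by blast
    fix a assume "a \<in> ?P"
    then obtain n m where a: "a = n \<otimes> m" "n \<in> N" "m \<in> M" by auto
    then have "inv a = conjg G m (inv n) \<otimes> inv m" using c by (simp add: word)
    moreover have "conjg G m (inv n) \<in> N" "inv m \<in> M"
      using a c N M by (auto simp: normal_conjg normal_inverse)
    ultimately show "inv a \<in> ?P" by blast
    fix b assume "b \<in> ?P"
    then obtain k l where b: "b = k \<otimes> l" "k \<in> N" "l \<in> M" by auto
    have "a \<otimes> b = n \<otimes> (m \<otimes> k) \<otimes> l" using a b c by (simp add: m_assoc)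
    also have "m \<otimes> k = conjg G (inv m) k \<otimes> m" using a b c by (intro swap) auto
    finally have "a \<otimes> b = (n \<otimes> conjg G (inv m) k) \<otimes> (m \<otimes> l)" using a b c by (simp add: m_assoc)
    moreover have "n \<otimes> conjg G (inv m) k \<in> N" "m \<otimes> l \<in> M"
      using a b c N M by (auto intro!: normal_mult normal_conjg)
    ultimately show "a \<otimes> b \<in> ?P" by blast
  qed
  moreover have "g \<otimes> x \<otimes> inv g \<in> ?P" if g: "g \<in> carrier G" and "x \<in> ?P" for g x
  proof -
    from \<open>x \<in> ?P\<close> obtain n m where x: "x = n \<otimes> m" "n \<in> N" "m \<in> M" by auto
    then have "g \<otimes> x \<otimes> inv g = conjg G (inv g) n \<otimes> conjg G (inv g) m"
      using c g by (simp add: word)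
    moreover have "conjg G (inv g) n \<in> N" "conjg G (inv g) m \<in> M"
      using x g N M by (auto intro!: normal_conjg)
    ultimately show ?thesis by blast
  qed
  ultimately show ?thesis by (simp add: normal_inv_iff)
qed

context topological_group
begin

definition onorm :: "'a set \<Rightarrow> bool" where
  "onorm M \<longleftrightarrow> M \<lhd> G \<and> openin T M"

lemma onorm_normal [simp]: "onorm M \<Longrightarrow> M \<lhd> G"
  by (simp add: onorm_def)

lemma onorm_carrier: "onorm (carrier G)"
  using openin_topspace[of T] by (simp add: onorm_def normal_self topspace_eq_carrier)

lemma onorm_Int: "onorm M \<Longrightarrow> onorm N \<Longrightarrow> onorm (M \<inter> N)"
  by (simp add: onorm_def normal_subgroup_intersect openin_Int)

lemma continuous_mult_compose:
  assumes "continuous_map X T f" "continuous_map X T g"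
  shows "continuous_map X T (\<lambda>x. f x \<otimes> g x)"
  using continuous_map_compose[OF continuous_map_pairedI[OF assms] continuous_mult]
  by (simp add: o_def)

lemma continuous_inv_compose:
  "continuous_map X T f \<Longrightarrow> continuous_map X T (\<lambda>x. inv (f x))"
  using continuous_map_compose[OF _ continuous_inv] by (simp add: o_def)

lemma continuous_const_carrier: "c \<in> carrier G \<Longrightarrow> continuous_map X T (\<lambda>x. c)"
  by (simp add: topspace_eq_carrier)

lemmas continuous_group = continuous_mult_compose continuous_inv_compose continuous_const_carrier
  continuous_map_id[unfolded id_def]

lemma continuous_left_mult: "a \<in> carrier G \<Longrightarrow> continuous_map T T (\<lambda>x. a \<otimes> x)"
  by (intro continuous_group)

lemma continuous_commutator:
  assumes "continuous_map X T f" "continuous_map X T g"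
  shows "continuous_map X T (\<lambda>x. commutator G (f x) (g x))"
  unfolding commutator_def by (intro continuous_group assms)

lemma continuous_conjg:
  assumes "continuous_map X T f" "continuous_map X T g"
  shows "continuous_map X T (\<lambda>x. conjg G (f x) (g x))"
  unfolding conjg_def by (intro continuous_group assms)

lemma continuous_lcomm:
  assumes "continuous_map X T f" "\<And>g. g \<in> set gs \<Longrightarrow> continuous_map X T g"
  shows "continuous_map X T (\<lambda>x. lcomm G (f x) (map (\<lambda>g. g x) gs))"
  using assms
proof (induction gs arbitrary: f)
  case (Cons g gs)
  have "continuous_map X T (\<lambda>x. commutator G (f x) (g x))"
    using Cons.prems by (intro continuous_commutator) auto
  from Cons.IH[OF this] Cons.prems show ?case by simp
qed simp

lemma open_subgroup_if_nbhd:
  assumes S: "subgroup S G" and W: "openin T W" "\<one> \<in> W" "W \<subseteq> S"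
  shows "openin T S"
proof (subst openin_subopen, intro ballI)
  fix s assume s: "s \<in> S"
  note Sc = subgroup.mem_carrier[OF S]
  let ?U = "{x \<in> carrier G. inv s \<otimes> x \<in> W}"
  have "openin T ?U"
    using openin_continuous_map_preimage[of T T "\<lambda>x. inv s \<otimes> x", OF _ W(1)] s Sc
    by (auto simp: topspace_eq_carrier intro: continuous_left_mult)
  moreover have "s \<in> ?U" using s Sc W by simp
  moreover have "?U \<subseteq> S"
  proof
    fix x assume x: "x \<in> ?U"
    then have "x = s \<otimes> (inv s \<otimes> x)" using s Sc by simp
    then show "x \<in> S" using x W s subgroup.m_closed[OF S] by (metis (no_types, lifting) mem_Collect_eq subsetD)
  qed
  ultimately show "\<exists>U. openin T U \<and> s \<in> U \<and> U \<subseteq> S" by blast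
qed

text \<open>Such a set is a union of open cosets, and so is its complement.\<close>

lemma coset_invariant_open_closed:
  assumes M: "onorm M" and inv: "\<And>x m. x \<in> carrier G \<Longrightarrow> m \<in> M \<Longrightarrow> P (x \<otimes> m) \<longleftrightarrow> P x"
  shows "openin T {x \<in> carrier G. P x}" "closedin T {x \<in> carrier G. P x}"
proof -
  have "openin T {x \<in> carrier G. P x}"
    if inv: "\<And>x m. x \<in> carrier G \<Longrightarrow> m \<in> M \<Longrightarrow> P (x \<otimes> m) \<longleftrightarrow> P x" for P
  proof (subst openin_subopen, intro ballI)
    fix x assume x: "x \<in> {x \<in> carrier G. P x}"
    let ?U = "{y \<in> carrier G. inv x \<otimes> y \<in> M}"
    have "openin T ?U"
      using openin_continuous_map_preimage[of T T "\<lambda>y. inv x \<otimes> y" M] M x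
      by (auto simp: topspace_eq_carrier onorm_def intro: continuous_left_mult)
    moreover have "x \<in> ?U" using x M by (simp add: normal_one)
    moreover have "?U \<subseteq> {x \<in> carrier G. P x}"
    proof
      fix y assume y: "y \<in> ?U"
      then have "y = x \<otimes> (inv x \<otimes> y)" using x by simp
      then show "y \<in> {x \<in> carrier G. P x}"
        using inv[of x "inv x \<otimes> y"] x y by simp
    qed
    ultimately show "\<exists>U. openin T U \<and> x \<in> U \<and> U \<subseteq> {x \<in> carrier G. P x}" by blast
  qed
  from this[of P] this[of "\<lambda>x. \<not> P x"] inv
  have "openin T {x \<in> carrier G. P x}" "openin T {x \<in> carrier G. \<not> P x}" by auto
  moreover have "carrier G - {x \<in> carrier G. P x} = {x \<in> carrier G. \<not> P x}" by auto
  ultimately show "openin T {x \<in> carrier G. P x}" "closedin T {x \<in> carrier G. P x}"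
    by (auto simp: closedin_def topspace_eq_carrier)
qed

lemma onorm_closedin:
  assumes "onorm M" shows "closedin T M"
proof -
  have "{x \<in> carrier G. x \<in> M} = M" using assms normal_in_carrier[of M] by auto
  then show ?thesis
    using coset_invariant_open_closed(2)[OF assms, of "\<lambda>x. x \<in> M"] assms
    by (simp add: normal_mem_mult_iff(2))
qed

lemma onorm_set_mult:
  assumes "N \<lhd> G" and M: "onorm M"
  shows "onorm {n \<otimes> m |n m. n \<in> N \<and> m \<in> M}"
proof -
  have "M \<subseteq> {n \<otimes> m |n m. n \<in> N \<and> m \<in> M}"
  proof
    fix m assume "m \<in> M"
    moreover have "\<one> \<in> N" using assms by (simp add: normal_one)
    moreover have "m = \<one> \<otimes> m" using \<open>m \<in> M\<close> M normal_in_carrier[of M] by simp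
    ultimately show "m \<in> {n \<otimes> m |n m. n \<in> N \<and> m \<in> M}" by blast
  qed
  moreover have P: "{n \<otimes> m |n m. n \<in> N \<and> m \<in> M} \<lhd> G"
    using assms by (intro normal_set_mult) auto
  ultimately show ?thesis
    using M open_subgroup_if_nbhd[OF normal_imp_subgroup[OF P], of M]
    by (simp add: onorm_def normal_one)
qed

lemma subgroup_closure_of:
  assumes S: "subgroup S G"
  shows "subgroup (T closure_of S) G"
proof (rule subgroupI)
  note Sc = subgroup.subset[OF S]
  show "T closure_of S \<subseteq> carrier G"
    using closure_of_subset_topspace[of T S] by (simp add: topspace_eq_carrier)
  show "T closure_of S \<noteq> {}"
    using closure_of_subset[of S T] Sc subgroup.one_closed[OF S] by (auto simp: topspace_eq_carrier)
  show "inv a \<in> T closure_of S" if "a \<in> T closure_of S" for a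
  proof -
    have "(\<lambda>x. inv x) ` (T closure_of S) \<subseteq> T closure_of ((\<lambda>x. inv x) ` S)"
      using continuous_inv unfolding continuous_map_eq_image_closure_subset by blast
    moreover have "(\<lambda>x. inv x) ` S \<subseteq> S" using subgroup.m_inv_closed[OF S] by auto
    ultimately show ?thesis using that closure_of_mono by blast
  qed
  show "a \<otimes> b \<in> T closure_of S" if "a \<in> T closure_of S" "b \<in> T closure_of S" for a b
  proof -
    let ?m = "\<lambda>(x, y). x \<otimes> y"
    have "?m ` (prod_topology T T closure_of (S \<times> S)) \<subseteq> T closure_of (?m ` (S \<times> S))"
      using continuous_mult unfolding continuous_map_eq_image_closure_subset by blast
    moreover have "?m ` (S \<times> S) \<subseteq> S" using subgroup.m_closed[OF S] by auto
    moreover have "(a, b) \<in> prod_topology T T closure_of (S \<times> S)"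
      using that by (simp add: closure_of_Times)
    ultimately show ?thesis using closure_of_mono by blast
  qed
qed

lemma normal_closure_of:
  assumes N: "N \<lhd> G"
  shows "T closure_of N \<lhd> G"
proof -
  have "g \<otimes> x \<otimes> inv g \<in> T closure_of N" if g: "g \<in> carrier G" and x: "x \<in> T closure_of N" for g x
  proof -
    let ?f = "\<lambda>x. g \<otimes> x \<otimes> inv g"
    have "continuous_map T T ?f" using g by (intro continuous_group) auto
    then have "?f ` (T closure_of N) \<subseteq> T closure_of (?f ` N)"
      unfolding continuous_map_eq_image_closure_subset by blast
    moreover have "?f ` N \<subseteq> N" using N g normal_inv_iff by auto
    ultimately show ?thesis using x closure_of_mono by blast
  qed
  then show ?thesis
    using subgroup_closure_of N by (simp add: normal_inv_iff normal_imp_subgroup)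
qed

end

section \<open>Compactness arguments with open normal subgroups\<close>

context profinite_group
begin

text \<open>The component of \<open>\<one>\<close> is a point, and in a locally compact Hausdorff
  space a compact component has arbitrarily small clopen neighbourhoods.\<close>

lemma ex_clopen_nbhd:
  assumes "openin T U" "\<one> \<in> U"
  obtains V where "openin T V" "closedin T V" "\<one> \<in> V" "V \<subseteq> U"
proof -
  have "connected_component_of_set T \<one> \<in> connected_components_of T"
    by (simp add: connected_component_in_connected_components_of topspace_eq_carrier)
  then have "{\<one>} \<in> connected_components_of T" by (simp add: totally_disconnected)
  then obtain V W where "openin T V" "openin T W" "disjnt V W" "V \<union> W = topspace T" "{\<one>} \<subseteq> V" "V \<subseteq> U"
    using assms
    by (metis wilder_locally_compact_component_thm compact_imp_locally_compact_space compact Hausdorff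
        compactin_sing topspace_eq_carrier one_closed empty_subsetI insert_subset)
  moreover from this have "topspace T - V = W" by (auto simp: disjnt_def)
  ultimately have "closedin T V" using openin_subset[of T V] by (simp add: closedin_def)
  then show thesis using that \<open>openin T V\<close> \<open>{\<one>} \<subseteq> V\<close> \<open>V \<subseteq> U\<close> by blast
qed

text \<open>The translations preserving a clopen set \<open>V\<close> on both sides form a normal subgroup,
  which is open by the tube lemma.\<close>

lemma ex_onorm_subset:
  assumes U: "openin T U" "\<one> \<in> U"
  obtains M where "onorm M" "M \<subseteq> U"
proof -
  obtain V where V: "openin T V" "closedin T V" "\<one> \<in> V" "V \<subseteq> U"
    using ex_clopen_nbhd[OF U] .
  define M where "M = {x \<in> carrier G. \<forall>g \<in> carrier G. \<forall>h \<in> carrier G. g \<otimes> x \<otimes> h \<in> V \<longleftrightarrow> g \<otimes> h \<in> V}"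
  have "subgroup M G"
  proof (rule subgroupI)
    show "M \<noteq> {}" by (auto simp: M_def intro!: exI[of _ \<one>])
    fix a assume a: "a \<in> M"
    have "g \<otimes> inv a \<otimes> h \<in> V \<longleftrightarrow> g \<otimes> h \<in> V" if "g \<in> carrier G" "h \<in> carrier G" for g h
    proof -
      have "g \<otimes> inv a \<otimes> a \<otimes> h \<in> V \<longleftrightarrow> g \<otimes> inv a \<otimes> h \<in> V" using a that by (simp add: M_def)
      then show ?thesis using a that by (simp add: M_def m_assoc)
    qed
    then show "inv a \<in> M" using a by (simp add: M_def)
    fix b assume b: "b \<in> M"
    have "g \<otimes> (a \<otimes> b) \<otimes> h \<in> V \<longleftrightarrow> g \<otimes> h \<in> V" if "g \<in> carrier G" "h \<in> carrier G" for g h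
    proof -
      have "g \<otimes> a \<otimes> b \<otimes> h \<in> V \<longleftrightarrow> g \<otimes> a \<otimes> h \<in> V" using a b that by (simp add: M_def)
      moreover have "g \<otimes> a \<otimes> h \<in> V \<longleftrightarrow> g \<otimes> h \<in> V" using a that by (simp add: M_def)
      ultimately show ?thesis using a b that by (simp add: M_def m_assoc)
    qed
    then show "a \<otimes> b \<in> M" using a b by (simp add: M_def)
  qed (auto simp: M_def)
  moreover have "y \<otimes> x \<otimes> inv y \<in> M" if y: "y \<in> carrier G" and x: "x \<in> M" for y x
  proof -
    have "g \<otimes> (y \<otimes> x \<otimes> inv y) \<otimes> h \<in> V \<longleftrightarrow> g \<otimes> h \<in> V" if "g \<in> carrier G" "h \<in> carrier G" for g h
    proof -
      have "(g \<otimes> y) \<otimes> x \<otimes> (inv y \<otimes> h) \<in> V \<longleftrightarrow> (g \<otimes> y) \<otimes> (inv y \<otimes> h) \<in> V"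
        using x y that by (simp add: M_def)
      then show ?thesis using x y that by (simp add: M_def m_assoc)
    qed
    then show ?thesis using x y by (simp add: M_def)
  qed
  ultimately have N: "M \<lhd> G" by (simp add: normal_inv_iff)
  let ?X = "prod_topology T (prod_topology T T)"
  let ?f = "\<lambda>(x, g, h). g \<otimes> x \<otimes> h" and ?k = "\<lambda>(x, g, h). g \<otimes> h"
  have f: "continuous_map ?X T ?f"
    unfolding case_prod_beta'
    by (intro continuous_mult_compose continuous_map_fst continuous_map_snd
        continuous_map_compose[OF continuous_map_snd, unfolded o_def])
  have k: "continuous_map ?X T ?k"
    unfolding case_prod_beta'
    by (intro continuous_mult_compose continuous_map_fst continuous_map_snd
        continuous_map_compose[OF continuous_map_snd, unfolded o_def])
  \<comment> \<open>The triples on which the two memberships in \<open>V\<close> agree. This is an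
    open condition because both \<open>V\<close> and its complement are open, and it holds whenever
    the first coordinate is \<open>\<one>\<close>.\<close>
  let ?W = "({z \<in> topspace ?X. ?f z \<in> V} \<inter> {z \<in> topspace ?X. ?k z \<in> V}) \<union>
     ({z \<in> topspace ?X. ?f z \<in> topspace T - V} \<inter> {z \<in> topspace ?X. ?k z \<in> topspace T - V})"
  have "openin ?X ?W"
    using V by (intro openin_Un openin_Int openin_continuous_map_preimage[OF f] openin_continuous_map_preimage[OF k])
      (auto intro: openin_diff)
  moreover have "compactin (prod_topology T T) (carrier G \<times> carrier G)"
    using compact unfolding compact_space_def topspace_eq_carrier by (simp add: compactin_Times)
  moreover have "{\<one>} \<times> (carrier G \<times> carrier G) \<subseteq> ?W"
    by (auto simp: topspace_eq_carrier)
  ultimately obtain A B where AB: "openin T A" "\<one> \<in> A" "carrier G \<times> carrier G \<subseteq> B" "A \<times> B \<subseteq> ?W"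
    using tube_lemma_right[of T "prod_topology T T" ?W "carrier G \<times> carrier G" \<one>]
    by (auto simp: topspace_eq_carrier)
  have "A \<subseteq> M"
  proof
    fix x assume x: "x \<in> A"
    have "g \<otimes> x \<otimes> h \<in> V \<longleftrightarrow> g \<otimes> h \<in> V" if "g \<in> carrier G" "h \<in> carrier G" for g h
    proof -
      have "(x, g, h) \<in> A \<times> B" using x that AB(3) by blast
      then show ?thesis using AB(4) by auto
    qed
    then show "x \<in> M" using x openin_subset[OF AB(1)] by (auto simp: M_def topspace_eq_carrier)
  qed
  then have "openin T M" using open_subgroup_if_nbhd N AB by (simp add: normal_imp_subgroup)
  then have "onorm M" using N by (simp add: onorm_def)
  moreover have "M \<subseteq> V"
  proof
    fix x assume "x \<in> M"
    then have "x \<in> carrier G" and "\<one> \<otimes> x \<otimes> \<one> \<in> V \<longleftrightarrow> \<one> \<otimes> \<one> \<in> V"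
      unfolding M_def using one_closed by blast+
    then show "x \<in> V" using V by simp
  qed
  ultimately show thesis using that V by blast
qed

lemma ex_onorm_nbhd:
  assumes U: "openin T U" "x \<in> U"
  obtains M where "onorm M" "\<forall>m \<in> M. x \<otimes> m \<in> U"
proof -
  have x: "x \<in> carrier G" using openin_subset[OF U(1)] U(2) by (auto simp: topspace_eq_carrier)
  have "openin T {y \<in> topspace T. x \<otimes> y \<in> U}"
    using x U by (intro openin_continuous_map_preimage[OF continuous_left_mult]) auto
  then obtain M where "onorm M" "M \<subseteq> {y \<in> topspace T. x \<otimes> y \<in> U}"
    using ex_onorm_subset[of "{y \<in> topspace T. x \<otimes> y \<in> U}"] x U by (auto simp: topspace_eq_carrier)
  then show thesis using that by blast
qed

lemma ex_onorm_disjoint_closed: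
  assumes C: "closedin T C" and x: "x \<in> carrier G" "x \<notin> C"
  obtains M where "onorm M" "\<forall>m \<in> M. x \<otimes> m \<notin> C"
proof -
  have "openin T (topspace T - C)" using C unfolding closedin_def by blast
  moreover have "x \<in> topspace T - C" using x topspace_eq_carrier by blast
  ultimately obtain M where M: "onorm M" "\<forall>m \<in> M. x \<otimes> m \<in> topspace T - C"
    by (rule ex_onorm_nbhd)
  show thesis by (rule that[OF M(1)]) (use M(2) in blast)
qed

text \<open>If \<open>M\<close> separates \<open>x\<close> from \<open>R\<close>, then the product
  of \<open>R\<close> and \<open>M\<close> is an open normal subgroup above \<open>R\<close> that
  misses \<open>x\<close>.\<close>

lemma mem_closed_normal_iff:
  assumes R: "R \<lhd> G" "closedin T R" and x: "x \<in> carrier G"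
    and all: "\<And>M. onorm M \<Longrightarrow> R \<subseteq> M \<Longrightarrow> x \<in> M"
  shows "x \<in> R"
proof (rule ccontr)
  assume "x \<notin> R"
  then obtain M where M: "onorm M" "\<forall>m \<in> M. x \<otimes> m \<notin> R"
    using ex_onorm_disjoint_closed[OF R(2) x \<open>x \<notin> R\<close>] by auto
  let ?P = "{n \<otimes> m |n m. n \<in> R \<and> m \<in> M}"
  have "R \<subseteq> ?P"
  proof
    fix r assume "r \<in> R"
    moreover have "\<one> \<in> M" using M by (simp add: normal_one)
    moreover have "r = r \<otimes> \<one>" using \<open>r \<in> R\<close> R normal_in_carrier by simp
    ultimately show "r \<in> ?P" by blast
  qed
  then have "x \<in> ?P" using all onorm_set_mult[OF R(1) M(1)] by blast
  then obtain n m where nm: "x = n \<otimes> m" "n \<in> R" "m \<in> M" by auto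
  then have "x \<otimes> inv m = n"
    using R M normal_in_carrier[of R] normal_in_carrier[of M] by (simp add: m_assoc)
  then show False using M nm by (metis normal_inverse onorm_normal)
qed

lemma closedin_one: "closedin T {\<one>}"
  by (simp add: closedin_Hausdorff_singleton Hausdorff topspace_eq_carrier)

lemma eq_one_if_mem_all_onorm:
  "x \<in> carrier G \<Longrightarrow> (\<And>M. onorm M \<Longrightarrow> x \<in> M) \<Longrightarrow> x = \<one>"
  using mem_closed_normal_iff[OF one_is_normal closedin_one, of x] by blast

text \<open>The subgroup \<open>N x\<close> may vary with the point. Thus statements valid near each
  single element of \<open>A\<close> become uniform, on intersecting finitely many
  \<open>N x\<close>.\<close>

lemma finite_coset_cover:
  assumes A: "closedin T A" and N: "\<And>x. x \<in> A \<Longrightarrow> onorm (N x)"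
  obtains F where "finite F" "F \<subseteq> A" "\<forall>y \<in> A. \<exists>x \<in> F. inv x \<otimes> y \<in> N x"
proof -
  have Ac: "A \<subseteq> carrier G" using closedin_subset[OF A] by (simp add: topspace_eq_carrier)
  let ?U = "\<lambda>x. {y \<in> topspace T. inv x \<otimes> y \<in> N x}"
  have op: "openin T (?U x)" if "x \<in> A" for x
    using that Ac N[OF that] by (intro openin_continuous_map_preimage[OF continuous_left_mult]) (auto simp: onorm_def)
  have "x \<in> ?U x" if "x \<in> A" for x
    using that Ac N[OF that] by (auto simp: topspace_eq_carrier subset_iff normal_one)
  then have sub: "A \<subseteq> \<Union> (?U ` A)" by blast
  have "compactin T A" using A compact by (simp add: closedin_compact_space)
  moreover have "openin T U" if "U \<in> ?U ` A" for U using that op by blast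
  ultimately have "\<exists>\<F>. finite \<F> \<and> \<F> \<subseteq> ?U ` A \<and> A \<subseteq> \<Union>\<F>"
    using sub by (rule compactinD)
  then obtain \<F> where \<F>: "finite \<F>" "\<F> \<subseteq> ?U ` A" "A \<subseteq> \<Union>\<F>" by (elim exE conjE)
  obtain F where F: "F \<subseteq> A" "finite F" "\<F> = ?U ` F"
    using finite_subset_image[OF \<F>(1,2)] by (elim exE conjE)
  show thesis
  proof (rule that[OF F(2,1)], rule ballI)
    fix y assume "y \<in> A"
    then show "\<exists>x \<in> F. inv x \<otimes> y \<in> N x" using \<F>(3) F(3) by auto
  qed
qed

lemma finite_cosets:
  assumes M: "onorm M"
  shows "finite ((\<lambda>x. M #> x) ` carrier G)"
proof -
  have "closedin T (carrier G)" using closedin_topspace[of T] by (simp add: topspace_eq_carrier)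
  then obtain F where F: "finite F" "F \<subseteq> carrier G" "\<forall>y \<in> carrier G. \<exists>x \<in> F. inv x \<otimes> y \<in> M"
    by (rule finite_coset_cover[OF _ M])
  have "(\<lambda>x. M #> x) ` carrier G \<subseteq> (\<lambda>x. M #> x) ` F"
  proof
    fix z assume "z \<in> (\<lambda>x. M #> x) ` carrier G"
    then obtain y where y: "y \<in> carrier G" "z = M #> y" by auto
    obtain x where x: "x \<in> F" "inv x \<otimes> y \<in> M" using bspec[OF F(3) y(1)] by (elim bexE)
    then have "x \<in> carrier G" using F by blast
    have "conjg G (inv x) (inv x \<otimes> y) \<in> M" using M x \<open>x \<in> carrier G\<close> by (intro normal_conjg) auto
    then have "y \<otimes> inv x \<in> M" using \<open>x \<in> carrier G\<close> y by (simp add: word)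
    moreover have "y = (y \<otimes> inv x) \<otimes> x" using \<open>x \<in> carrier G\<close> y by (simp add: m_assoc)
    ultimately have "y \<in> M #> x" unfolding r_coset_def by blast
    then have "z = M #> x"
      using repr_independence[of y M x] y M \<open>x \<in> carrier G\<close> by (simp add: normal_imp_subgroup)
    then show "z \<in> (\<lambda>x. M #> x) ` F" using x by blast
  qed
  then show ?thesis using F(1) by (meson finite_imageI finite_subset)
qed

text \<open>Builds an element from approximations modulo every open normal subgroup; the family is
  directed since these subgroups are closed under intersection.\<close>

lemma onorm_fip:
  assumes cl: "\<And>M. onorm M \<Longrightarrow> closedin T (C M)" and ne: "\<And>M. onorm M \<Longrightarrow> C M \<noteq> {}"
    and mono: "\<And>M M'. onorm M \<Longrightarrow> onorm M' \<Longrightarrow> M \<subseteq> M' \<Longrightarrow> C M \<subseteq> C M'"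
  obtains x where "\<forall>M. onorm M \<longrightarrow> x \<in> C M"
proof -
  have "\<Inter> (C ` {M. onorm M}) \<noteq> {}"
  proof (rule compact[unfolded compact_space_fip, rule_format], intro conjI ballI allI impI)
    fix D assume "D \<in> C ` {M. onorm M}"
    then show "closedin T D" using cl by auto
  next
    fix \<F> assume F: "finite \<F> \<and> \<F> \<subseteq> C ` {M. onorm M}"
    then obtain \<M> where m: "finite \<M>" "\<M> \<subseteq> {M. onorm M}" "\<F> = C ` \<M>"
      by (metis finite_subset_image)
    have "\<exists>M. onorm M \<and> (\<forall>M' \<in> \<M>. M \<subseteq> M')"
      using m(1,2)
    proof (induction \<M> rule: finite_induct)
      case empty
      then show ?case using onorm_carrier by blast
    next
      case (insert M0 \<M>)
      then obtain M where "onorm M" "\<forall>M' \<in> \<M>. M \<subseteq> M'" by blast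
      then show ?case using insert.prems onorm_Int[of M M0] by (intro exI[of _ "M \<inter> M0"]) auto
    qed
    then obtain M where M: "onorm M" "\<forall>M' \<in> \<M>. M \<subseteq> M'" by blast
    then have "C M \<subseteq> \<Inter>\<F>" using m mono by blast
    then show "\<Inter>\<F> \<noteq> {}" using ne[OF M(1)] by blast
  qed
  then show thesis using that by blast
qed

end

subsection \<open>Sets of primes and parts of elements\<close>

context topological_group
begin

text \<open>The prime divisors of the order of \<open>x\<close> lie in \<open>I\<close>; see \<open>element_primes_subset_iff\<close> below.\<close>

definition pi_elt :: "nat set \<Rightarrow> 'a \<Rightarrow> bool" where
  "pi_elt I x \<longleftrightarrow> x \<in> carrier G \<and> (\<forall>M. onorm M \<longrightarrow> (\<exists>n. pi_num I n \<and> x [^] n \<in> M))"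

lemma pi_elt_carrier [simp]: "pi_elt I x \<Longrightarrow> x \<in> carrier G"
  by (simp add: pi_elt_def)

lemma pi_eltE:
  assumes "pi_elt I x" "onorm M"
  obtains n where "pi_num I n" "x [^] n \<in> M"
  using assms unfolding pi_elt_def by blast

lemma pi_elt_one: "pi_elt I \<one>"
  unfolding pi_elt_def
proof (intro conjI allI impI)
  fix M assume "onorm M"
  then show "\<exists>n. pi_num I n \<and> \<one> [^] n \<in> M" by (intro exI[of _ 1]) (simp add: normal_one)
qed simp

lemma pi_elt_mono: "pi_elt I x \<Longrightarrow> I \<inter> {p. prime p} \<subseteq> J \<Longrightarrow> pi_elt J x"
  unfolding pi_elt_def using pi_num_mono by blast

lemma pi_elt_inv: "pi_elt I x \<Longrightarrow> pi_elt I (inv x)"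
  unfolding pi_elt_def by (simp add: nat_pow_inv) (meson normal_inverse onorm_normal)

lemma pi_elt_conjg: "g \<in> carrier G \<Longrightarrow> pi_elt I x \<Longrightarrow> pi_elt I (conjg G g x)"
  unfolding pi_elt_def by (simp flip: conjg_pow) (meson normal_conjg onorm_normal)

lemma pi_elt_conjg_iff: "g \<in> carrier G \<Longrightarrow> x \<in> carrier G \<Longrightarrow> pi_elt I (conjg G g x) \<longleftrightarrow> pi_elt I x"
  using pi_elt_conjg[of g I x] pi_elt_conjg[of "inv g" I "conjg G g x"] by auto

lemma pi_elt_inv_iff: "x \<in> carrier G \<Longrightarrow> pi_elt I (inv x) \<longleftrightarrow> pi_elt I x"
  using pi_elt_inv[of I x] pi_elt_inv[of I "inv x"] by auto

lemma pi_elt_mult_commuting: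
  assumes "pi_elt I x" "pi_elt I y" "x \<otimes> y = y \<otimes> x"
  shows "pi_elt I (x \<otimes> y)"
  unfolding pi_elt_def
proof (intro conjI allI impI)
  fix M assume M: "onorm M"
  obtain m n where mn: "pi_num I m" "x [^] m \<in> M" "pi_num I n" "y [^] n \<in> M"
    using pi_eltE[OF assms(1) M] pi_eltE[OF assms(2) M] by metis
  have "x [^] (m * n) \<in> M" "y [^] (m * n) \<in> M"
    using normal_pow[OF onorm_normal[OF M] mn(2), of n] normal_pow[OF onorm_normal[OF M] mn(4), of m] assms
    by (simp_all add: nat_pow_pow mult.commute)
  then have "(x \<otimes> y) [^] (m * n) \<in> M"
    using assms M pow_mult_distrib[OF assms(3), of "m * n"] by (simp add: normal_mult)
  then show "\<exists>n. pi_num I n \<and> (x \<otimes> y) [^] n \<in> M" using mn pi_num_mult by blast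
qed (use assms in simp)

lemma pi_elt_mem_coprime:
  assumes "pi_elt I x" "onorm M" "x [^] m \<in> M" "pi_num J m" "I \<inter> J \<inter> {p. prime p} = {}"
  shows "x \<in> M"
proof -
  obtain n where "pi_num I n" "x [^] n \<in> M" using pi_eltE[OF assms(1,2)] .
  then show ?thesis
    using assms pi_num_coprime[of I n J m] by (intro subgroup_coprime_pow_mem[of M x n m]) (auto simp: normal_imp_subgroup)
qed

lemma subgroup_closed_commuting:
  assumes "Hausdorff_space T" "y \<in> carrier G"
  shows "subgroup {g \<in> carrier G. y \<otimes> g = g \<otimes> y} G" "closedin T {g \<in> carrier G. y \<otimes> g = g \<otimes> y}"
proof -
  have "{g \<in> carrier G. y \<otimes> g = g \<otimes> y} = {c \<in> carrier G. \<forall>d \<in> {y}. commutator G d c \<in> {\<one>}}"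
    using assms by (auto simp: commutator_eq_one_iff)
  then show "subgroup {g \<in> carrier G. y \<otimes> g = g \<otimes> y} G"
    using subgroup_commutator_right_mem[OF one_is_normal, of "{y}"] assms by simp
  have "closedin T {g \<in> topspace T. commutator G y g \<in> {\<one>}}"
    using assms by (intro closedin_continuous_map_preimage[of T T] continuous_commutator continuous_group)
      (auto simp: closedin_Hausdorff_singleton topspace_eq_carrier)
  moreover have "{g \<in> topspace T. commutator G y g \<in> {\<one>}} = {g \<in> carrier G. y \<otimes> g = g \<otimes> y}"
    using assms by (auto simp: commutator_eq_one_iff topspace_eq_carrier)
  ultimately show "closedin T {g \<in> carrier G. y \<otimes> g = g \<otimes> y}" by simp
qed

end

section \<open>Parts of an element for a set of primes, and the meaning of its Steinitz
  order\<close>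

context profinite_group
begin

definition index :: "'a set \<Rightarrow> nat" where
  "index M = order (G Mod M)"

lemma index_pos: "onorm M \<Longrightarrow> index M > 0"
  using finite_cosets[of M] by (auto simp: index_def order_def carrier_FactGroup card_gt_0_iff)

lemma pow_index_mem:
  assumes M: "onorm M" and x: "x \<in> carrier G"
  shows "x [^] index M \<in> M"
proof -
  interpret q: group_hom G "G Mod M" "\<lambda>x. M #> x" using M by (intro mod_hom) simp
  have "(M #> x) [^]\<^bsub>G Mod M\<^esub> index M = \<one>\<^bsub>G Mod M\<^esub>"
    unfolding index_def using x by (intro q.H.pow_order_eq_1 q.hom_closed)
  then have "M #> (x [^] index M) = \<one>\<^bsub>G Mod M\<^esub>" using x by (simp add: q.hom_nat_pow del: one_FactGroup)
  then show ?thesis using x M by (subst (asm) mod_eq_one_iff) auto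
qed

lemma pi_elt_disjoint_eq_one:
  assumes "pi_elt I x" "pi_elt J x" "I \<inter> J \<inter> {p. prime p} = {}"
  shows "x = \<one>"
proof (rule eq_one_if_mem_all_onorm)
  fix M assume M: "onorm M"
  obtain m where "pi_num J m" "x [^] m \<in> M" using pi_eltE[OF assms(2) M] .
  then show "x \<in> M" using pi_elt_mem_coprime[OF assms(1) M] assms(3) by blast
qed (use assms in simp)

lemma coset_pow_mem_iff:
  assumes "onorm M" "x \<in> carrier G" "m \<in> M"
  shows "(x \<otimes> m) [^] (n::nat) \<in> M \<longleftrightarrow> x [^] n \<in> M"
proof
  have m: "m \<in> carrier G" using assms normal_in_carrier[of M] by simp
  show "(x \<otimes> m) [^] n \<in> M" if "x [^] n \<in> M"
    using assms that by (intro mod_pow_mult_normal) auto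
  show "x [^] n \<in> M" if "(x \<otimes> m) [^] n \<in> M"
    using mod_pow_mult_normal(1)[of M "x \<otimes> m" "inv m" n] assms that m
    by (simp add: m_assoc normal_inverse)
qed

lemma closedin_pi_num_pow:
  assumes M: "onorm M"
  shows "closedin T {x \<in> carrier G. \<exists>n. pi_num I n \<and> x [^] n \<in> M}"
  using coset_pow_mem_iff[OF M] by (intro coset_invariant_open_closed[OF M]) auto

lemma closedin_pi_elt: "closedin T {x. pi_elt I x}"
proof -
  have "{x. pi_elt I x} = (\<Inter>M \<in> {M. onorm M}. {x \<in> carrier G. \<exists>n. pi_num I n \<and> x [^] n \<in> M})"
    unfolding pi_elt_def using onorm_carrier by auto
  then show ?thesis using closedin_pi_num_pow onorm_carrier by (auto intro!: closedin_INT)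
qed

lemma closure_generate_subset:
  assumes "subgroup K G" "closedin T K" "x \<in> K"
  shows "T closure_of (generate G {x}) \<subseteq> K"
  using assms by (intro closure_of_minimal generate_subgroup_incl) auto

text \<open>Modulo each \<open>M\<close> the two parts are powers of \<open>x\<close> found by
  Bezout, and compactness yields a simultaneous choice. The last conclusion expresses that both lie
  in the closed subgroup generated by \<open>x\<close>, in the form in which it is applied.\<close>

lemma ex_pi_parts:
  assumes x: "x \<in> carrier G"
  obtains u v where "x = u \<otimes> v" "u \<otimes> v = v \<otimes> u" "pi_elt I u" "pi_elt (- I) v"
    "\<And>K. subgroup K G \<Longrightarrow> closedin T K \<Longrightarrow> x \<in> K \<Longrightarrow> u \<in> K \<and> v \<in> K"
proof -
  define K where "K = T closure_of (generate G {x})"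
  have gx: "subgroup (generate G {x}) G" using x by (intro generate_is_subgroup) auto
  have K: "subgroup K G" "closedin T K"
    unfolding K_def by (auto intro!: subgroup_closure_of gx)
  have "generate G {x} \<subseteq> K"
    unfolding K_def using subgroup.subset[OF gx] by (intro closure_of_subset) (simp add: topspace_eq_carrier)
  then have xK: "x \<in> K" by (meson generate.incl insertI1 subsetD)
  define A where "A M = K \<inter> {u \<in> carrier G. \<exists>n. pi_num I n \<and> u [^] n \<in> M}
    \<inter> {u \<in> topspace T. inv u \<otimes> x \<in> {v \<in> carrier G. \<exists>n. pi_num (- I) n \<and> v [^] n \<in> M}}" for M
  have "closedin T (A M)" if "onorm M" for M
    unfolding A_def using x that K
    by (intro closedin_Int closedin_continuous_map_preimage[of T T] closedin_pi_num_pow continuous_group) auto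
  moreover have "A M \<noteq> {}" if M: "onorm M" for M
  proof -
    obtain a b where ab: "index M = a * b" "pi_num I a" "pi_num (- I) b"
      using pi_num_split[OF index_pos[OF M], of I] .
    have cop: "coprime b a" using pi_num_coprime[OF ab(3,2)] by blast
    have "b \<noteq> 0" using ab(3) by (simp add: pi_num_def)
    then obtain s t where "b * s = a * t + gcd b a" using bezout_nat by blast
    then have st: "b * s = Suc (a * t)" using cop by simp
    \<comment> \<open>Since \<open>b * s = Suc (a * t)\<close>, the complement of \<open>u\<close>
      in \<open>x\<close> is \<open>x\<close> to the power \<open>- a * t\<close>. Hence the
      \<open>a\<close>-th power of \<open>u\<close> and the \<open>b\<close>-th power of its
      complement are powers of \<open>x [^] index M\<close>, up to inversion.\<close>
    define u where "u = x [^] (b * s)"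
    have uK: "u \<in> K" unfolding u_def using xK K by (simp add: subgroup_pow)
    have xi: "x [^] (a * b * j) \<in> M" for j
    proof -
      have "(x [^] index M) [^] j \<in> M" using pow_index_mem[OF M x] M by (simp add: normal_pow)
      then show ?thesis using x by (simp add: nat_pow_pow ab(1))
    qed
    have "u [^] a \<in> M" unfolding u_def using xi[of s] x by (simp add: nat_pow_pow ac_simps)
    moreover have "inv u \<otimes> x = inv (x [^] (a * t))"
      unfolding u_def st nat_pow_Suc2[OF x] using x by (simp add: inv_mult_group m_assoc)
    then have "(inv u \<otimes> x) [^] b = inv (x [^] (a * t * b))"
      using x by (simp add: nat_pow_inv nat_pow_pow)
    then have "(inv u \<otimes> x) [^] b \<in> M" using xi[of t] M by (simp add: normal_inverse ac_simps)
    ultimately have "u \<in> A M"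
      using uK ab(2,3) x subgroup.mem_carrier[OF K(1) uK] by (auto simp: A_def topspace_eq_carrier)
    then show ?thesis by blast
  qed
  moreover have "A M \<subseteq> A M'" if "M \<subseteq> M'" for M M' using that by (auto simp: A_def)
  ultimately obtain u where u: "\<forall>M. onorm M \<longrightarrow> u \<in> A M" by (rule onorm_fip)
  have uK: "u \<in> K" using u onorm_carrier by (auto simp: A_def)
  have uc: "u \<in> carrier G" using uK subgroup.mem_carrier[OF K(1)] by blast
  define v where "v = inv u \<otimes> x"
  have vK: "v \<in> K" unfolding v_def using uK xK K(1) by (simp add: subgroup.m_closed subgroup.m_inv_closed)
  have 1: "x = u \<otimes> v" unfolding v_def using x uc by simp
  have min: "u \<in> K' \<and> v \<in> K'" if "subgroup K' G" "closedin T K'" "x \<in> K'" for K'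
    using closure_generate_subset[OF that] uK vK by (auto simp: K_def)
  \<comment> \<open>The centraliser of \<open>x\<close> is a closed subgroup containing
    \<open>x\<close>, so it contains \<open>u\<close>.\<close>
  have "x \<otimes> u = u \<otimes> x"
    using min[OF subgroup_closed_commuting[OF Hausdorff x]] x by auto
  then have "u \<otimes> v \<otimes> u = u \<otimes> (u \<otimes> v)" using 1 by simp
  then have uv: "u \<otimes> v = v \<otimes> u" using uc vK subgroup.mem_carrier[OF K(1)] by (simp add: m_assoc)
  have "\<exists>n. pi_num I n \<and> u [^] n \<in> M" "\<exists>n. pi_num (- I) n \<and> v [^] n \<in> M" if "onorm M" for M
    using u that unfolding A_def v_def by blast+
  then have "pi_elt I u" "pi_elt (- I) v"
    using uc x unfolding pi_elt_def v_def by auto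
  then show thesis using that[OF 1 uv _ _ min] by blast
qed

lemma pi_elt_if_mult_commuting_disjoint:
  assumes x: "pi_elt I x" "pi_elt J y" "pi_elt I (x \<otimes> y)" "x \<otimes> y = y \<otimes> x" and "I \<inter> J \<inter> {p. prime p} = {}"
  shows "y = \<one>"
proof (rule pi_elt_disjoint_eq_one[of I])
  have c: "x \<in> carrier G" "y \<in> carrier G" using x by auto
  have "x \<otimes> y \<otimes> inv x = y" unfolding x(4) using c by (simp add: m_assoc)
  then have "inv x \<otimes> (x \<otimes> y) = x \<otimes> y \<otimes> inv x" using c by simp
  then have "pi_elt I (inv x \<otimes> (x \<otimes> y))"
    by (rule pi_elt_mult_commuting[OF pi_elt_inv[OF x(1)] x(3)])
  then show "pi_elt I y" using c by simp
qed (use assms in auto)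

text \<open>The bridge from Steinitz orders to powers. The image of \<open>x\<close> generates each
  finite quotient of the procyclic group \<open>H\<close> by an open normal \<open>U\<close>, so the
  index of \<open>U\<close> is the order of that image.\<close>

lemma element_primes_subset_iff:
  assumes x: "x \<in> carrier G"
  shows "element_primes G T x \<subseteq> I \<longleftrightarrow> pi_elt I x"
proof -
  define H where "H = T closure_of (generate G {x})"
  let ?H = "G\<lparr>carrier := H\<rparr>"
  have gx: "subgroup (generate G {x}) G" using x by (intro generate_is_subgroup) auto
  have H: "subgroup H G" unfolding H_def by (rule subgroup_closure_of[OF gx])
  note Hc = subgroup.mem_carrier[OF H]
  interpret h: group ?H using H by (rule subgroup.subgroup_is_group) (rule is_group)
  have "generate G {x} \<subseteq> H"
    unfolding H_def using subgroup.subset[OF gx] by (intro closure_of_subset) (simp add: topspace_eq_carrier)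
  then have xH: "x \<in> H" by (meson generate.incl insertI1 subsetD)
  have coset: "U #>\<^bsub>?H\<^esub> a = U #> a" for U a by (simp add: r_coset_def)
  have rcos: "rcosets\<^bsub>?H\<^esub> U = (\<lambda>a. U #> a) ` H" for U
    by (auto simp: RCOSETS_def coset)
  have pow: "a [^]\<^bsub>?H\<^esub> (n::nat) = a [^] n" for a n by (simp flip: nat_pow_consistent)
  have prim: "p \<in> element_primes G T x \<longleftrightarrow> prime p \<and>
      (\<exists>U. U \<lhd> ?H \<and> openin (subtopology T H) U \<and> multiplicity p (card (rcosets\<^bsub>?H\<^esub> U)) \<noteq> 0)" for p
  proof -
    have "(SUP U \<in> {U. U \<lhd> ?H \<and> openin (subtopology T H) U}. enat (multiplicity p (card (rcosets\<^bsub>?H\<^esub> U)))) \<noteq> 0 \<longleftrightarrow>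
      (\<exists>U. U \<lhd> ?H \<and> openin (subtopology T H) U \<and> multiplicity p (card (rcosets\<^bsub>?H\<^esub> U)) \<noteq> 0)"
      unfolding bot_enat_def[symmetric] SUP_bot_conv by (auto simp: bot_enat_def zero_enat_def)
    then show ?thesis
      by (auto simp: element_primes_def element_order_def closed_generate_def Let_def steinitz_order_def
          simp flip: H_def)
  qed
  have ex_M: "\<exists>M. onorm M \<and> M \<inter> H \<subseteq> U" if "U \<lhd> ?H" "openin (subtopology T H) U" for U
  proof -
    obtain W where W: "openin T W" "U = W \<inter> H" using \<open>openin _ U\<close> by (auto simp: openin_subtopology)
    have "\<one> \<in> W" using h.normal_one[OF \<open>U \<lhd> ?H\<close>] W by simp
    then obtain M where "onorm M" "M \<subseteq> W" using ex_onorm_subset W by blast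
    then show ?thesis using W by blast
  qed
  have fin: "finite (rcosets\<^bsub>?H\<^esub> (M \<inter> H))" if M: "onorm M" for M
    unfolding rcos
  proof (rule finite_image_factor[where f = "\<lambda>a. M #> a"])
    show "finite ((\<lambda>a. M #> a) ` H)"
      using finite_cosets[OF M] subgroup.subset[OF H] by (meson finite_subset image_mono)
    fix a b assume ab: "a \<in> H" "b \<in> H" "M #> a = M #> b"
    then have "a \<in> M #> b" using M Hc by (metis normal_imp_subgroup onorm_normal rcos_self)
    then obtain m where m: "m \<in> M" "a = m \<otimes> b" by (auto simp: r_coset_def)
    then have mc: "m \<in> carrier G" using M normal_in_carrier[of M] by simp
    have "m = a \<otimes> inv b" using m mc Hc[OF ab(2)] by (simp add: m_assoc)
    then have "m \<in> H" using ab H by (simp add: subgroup.m_closed subgroup.m_inv_closed)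
    then have "a \<in> (M \<inter> H) #> b" using m by (auto simp: r_coset_def)
    moreover have "subgroup (M \<inter> H) G" using M H by (simp add: subgroups_Inter_pair normal_imp_subgroup)
    ultimately show "(M \<inter> H) #> a = (M \<inter> H) #> b"
      using repr_independence[of a "M \<inter> H" b] Hc ab by simp
  qed
  have norm: "M \<inter> H \<lhd> ?H" if "onorm M" for M
    using normal_restrict_supergroup[OF H] normal_Int_subgroup[OF H] that onorm_normal by blast
  show ?thesis
  proof
    assume sub: "element_primes G T x \<subseteq> I"
    show "pi_elt I x"
      unfolding pi_elt_def
    proof (intro conjI allI impI x)
      fix M assume M: "onorm M"
      let ?n = "card (rcosets\<^bsub>?H\<^esub> (M \<inter> H))"
      have op: "openin (subtopology T H) (M \<inter> H)"
        using M by (auto simp: openin_subtopology onorm_def)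
      have "H \<noteq> {}" using xH by blast
      then have n: "?n > 0" using fin[OF M] by (auto simp: card_gt_0_iff rcos)
      interpret q: group_hom ?H "?H Mod (M \<inter> H)" "\<lambda>a. (M \<inter> H) #>\<^bsub>?H\<^esub> a"
        using norm[OF M] by (rule h.mod_hom)
      have "((M \<inter> H) #>\<^bsub>?H\<^esub> x) [^]\<^bsub>?H Mod (M \<inter> H)\<^esub> order (?H Mod (M \<inter> H)) = \<one>\<^bsub>?H Mod (M \<inter> H)\<^esub>"
        using xH by (intro q.H.pow_order_eq_1 q.hom_closed) simp
      moreover have "order (?H Mod (M \<inter> H)) = ?n" by (simp add: order_def FactGroup_def)
      ultimately have "(M \<inter> H) #>\<^bsub>?H\<^esub> (x [^]\<^bsub>?H\<^esub> ?n) = \<one>\<^bsub>?H Mod (M \<inter> H)\<^esub>"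
        using xH q.hom_nat_pow[of x ?n] by (simp del: one_FactGroup)
      then have "x [^] ?n \<in> M \<inter> H"
        using xH H by (subst (asm) h.mod_eq_one_iff[OF norm[OF M]]) (simp_all add: subgroup_pow pow)
      moreover have "pi_num I ?n"
        unfolding pi_num_def
      proof (intro conjI n allI impI)
        fix p assume p: "prime p" "p dvd ?n"
        then have "multiplicity p ?n \<noteq> 0" using n by (simp add: prime_multiplicity_gt_zero_iff[THEN iffD2, of p ?n] gr_implies_not0)
        then show "p \<in> I" using sub p norm[OF M] op prim by blast
      qed
      ultimately show "\<exists>n. pi_num I n \<and> x [^] n \<in> M" by blast
    qed
  next
    assume pi: "pi_elt I x"
    show "element_primes G T x \<subseteq> I"
    proof
      fix p assume "p \<in> element_primes G T x"
      then obtain U where U: "prime p" "U \<lhd> ?H" "openin (subtopology T H) U"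
        "multiplicity p (card (rcosets\<^bsub>?H\<^esub> U)) \<noteq> 0" using prim by blast
      obtain M where M: "onorm M" "M \<inter> H \<subseteq> U" using ex_M[OF U(2,3)] by blast
      interpret q: group_hom ?H "?H Mod U" "\<lambda>a. U #>\<^bsub>?H\<^esub> a"
        using U(2) by (rule h.mod_hom)
      obtain m where m: "pi_num I m" "x [^] m \<in> M" using pi_eltE[OF pi M(1)] .
      then have "x [^] m \<in> U" using M xH H by (auto simp: subgroup_pow)
      then have "(U #>\<^bsub>?H\<^esub> x) [^]\<^bsub>?H Mod U\<^esub> m = \<one>\<^bsub>?H Mod U\<^esub>"
        using xH h.mod_eq_one_iff[OF U(2), of "x [^] m"] q.hom_nat_pow[of x m] H
        by (simp add: subgroup_pow pow del: one_FactGroup)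
      then have "q.H.ord (U #>\<^bsub>?H\<^esub> x) dvd m"
        using xH q.H.pow_eq_id[of "U #>\<^bsub>?H\<^esub> x" m] q.hom_closed[of x] by simp
      moreover have "q.H.ord (U #>\<^bsub>?H\<^esub> x) = card (rcosets\<^bsub>?H\<^esub> U)"
      proof -
        \<comment> \<open>Density: every coset of the open subgroup \<open>U\<close> meets the
          abstract subgroup generated by \<open>x\<close>.\<close>
        have "rcosets\<^bsub>?H\<^esub> U \<subseteq> generate (?H Mod U) {U #>\<^bsub>?H\<^esub> x}"
        proof
          fix c assume "c \<in> rcosets\<^bsub>?H\<^esub> U"
          then obtain a where a: "a \<in> H" "c = U #>\<^bsub>?H\<^esub> a" by (auto simp: rcos coset)
          have "openin T {y \<in> topspace T. inv a \<otimes> y \<in> M}"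
            using Hc[OF a(1)] M by (intro openin_continuous_map_preimage[OF continuous_left_mult]) (auto simp: onorm_def)
          moreover have "a \<in> {y \<in> topspace T. inv a \<otimes> y \<in> M}"
            using Hc[OF a(1)] M by (auto simp: topspace_eq_carrier normal_one)
          moreover have "a \<in> T closure_of (generate G {x})" using a(1) by (simp add: H_def)
          ultimately have "\<exists>g. g \<in> generate G {x} \<and> g \<in> {y \<in> topspace T. inv a \<otimes> y \<in> M}"
            by (simp only: in_closure_of)
          then obtain g where g: "g \<in> generate G {x}" "inv a \<otimes> g \<in> M" by auto
          have gH: "g \<in> H" using g \<open>generate G {x} \<subseteq> H\<close> by blast
          have "inv a \<otimes> g \<in> U" using g gH a M H by (auto simp: subgroup.m_closed subgroup.m_inv_closed)
          have ac: "a \<in> carrier ?H" "g \<in> carrier ?H" using a gH by simp_all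
          have "U #>\<^bsub>?H\<^esub> (inv\<^bsub>?H\<^esub> a \<otimes>\<^bsub>?H\<^esub> g) = \<one>\<^bsub>?H Mod U\<^esub>"
            using \<open>inv a \<otimes> g \<in> U\<close> gH a H by (subst h.mod_eq_one_iff[OF U(2)]) (auto simp: m_inv_consistent subgroup.m_closed subgroup.m_inv_closed)
          then have "inv\<^bsub>?H Mod U\<^esub> c \<otimes>\<^bsub>?H Mod U\<^esub> (U #>\<^bsub>?H\<^esub> g) = \<one>\<^bsub>?H Mod U\<^esub>"
            unfolding a(2) q.hom_mult[OF h.inv_closed[OF ac(1)] ac(2)] q.hom_inv[OF ac(1)] .
          then have "c = U #>\<^bsub>?H\<^esub> g"
            using q.H.inv_solve_left'[OF _ q.hom_closed[OF ac(1)] q.hom_closed[OF ac(2)] , of "\<one>\<^bsub>?H Mod U\<^esub>"] a(2)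
              q.hom_closed[OF ac(1)] by (simp only: q.H.one_closed q.H.r_one)
          moreover have "generate G {x} = generate ?H {x}"
            using generate_consistent[of "{x}" H] xH H by simp
          then have "U #>\<^bsub>?H\<^esub> g \<in> generate (?H Mod U) ((\<lambda>a. U #>\<^bsub>?H\<^esub> a) ` {x})"
            using q.generate_img[of "{x}"] xH g by auto
          ultimately show "c \<in> generate (?H Mod U) {U #>\<^bsub>?H\<^esub> x}" by simp
        qed
        moreover have "generate (?H Mod U) {U #>\<^bsub>?H\<^esub> x} \<subseteq> rcosets\<^bsub>?H\<^esub> U"
          using q.H.generate_incl[of "{U #>\<^bsub>?H\<^esub> x}"] xH q.hom_closed[of x] by (simp add: FactGroup_def)
        ultimately show ?thesis
          using q.H.generate_pow_card[of "U #>\<^bsub>?H\<^esub> x"] q.hom_closed[of x] xH by simp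
      qed
      moreover have "p dvd card (rcosets\<^bsub>?H\<^esub> U)"
        using U(4) by (rule contrapos_np) (rule not_dvd_imp_multiplicity_0)
      ultimately have "p dvd m" by (metis dvd_trans)
      then show "p \<in> I" using m(1) U(1) unfolding pi_num_def by blast
    qed
  qed
qed

end

subsection \<open>Locally constant words and uniform commutators\<close>

text \<open>A nonempty compact Hausdorff space with fewer than continuum many points is not perfect; the
  preimage of an isolated point of the image is the required open set.\<close>

lemma locally_constant_if_few_values:
  assumes X: "compact_space X" "topspace X \<noteq> {}" and Y: "Hausdorff_space Y"
    and f: "continuous_map X Y f" and few: "f ` topspace X \<prec> (UNIV :: nat set set)"
  obtains W where "openin X W" "W \<noteq> {}" "\<forall>x \<in> W. \<forall>y \<in> W. f x = f y"
proof -
  define S where "S = f ` topspace X"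
  have S: "compactin Y S" unfolding S_def using f X(1) by (simp add: compact_space_def image_compactin)
  then have Z: "compact_space (subtopology Y S)" "Hausdorff_space (subtopology Y S)"
    using Y by (simp_all add: compact_space_subtopology Hausdorff_space_subtopology)
  have tZ: "topspace (subtopology Y S) = S" using compactin_subset_topspace[OF S] by auto
  have "subtopology Y S derived_set_of S \<noteq> S"
  proof
    assume "subtopology Y S derived_set_of S = S"
    then have "(UNIV :: real set) \<lesssim> S"
      using Z X(2) by (intro lepoll_perfect_set[of "subtopology Y S"])
        (auto simp: S_def compact_imp_locally_compact_space)
    then have "(UNIV :: nat set set) \<lesssim> S" using nat_sets_eqpoll_reals lepoll_trans1 by blast
    then show False using few lesspoll_trans2 unfolding S_def by blast
  qed
  moreover have "subtopology Y S derived_set_of S \<subseteq> S"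
    using derived_set_of_subset_topspace[of "subtopology Y S" S] tZ by simp
  ultimately obtain y where y: "y \<in> S" "y \<notin> subtopology Y S derived_set_of S" by blast
  then obtain U where U: "openin (subtopology Y S) U" "y \<in> U" "\<And>z. z \<in> S \<Longrightarrow> z \<in> U \<Longrightarrow> z = y"
    using tZ unfolding derived_set_of_def by blast
  then obtain V where V: "openin Y V" "U = V \<inter> S" by (auto simp: openin_subtopology)
  show thesis
  proof (rule that[of "{x \<in> topspace X. f x \<in> V}"])
    show "openin X {x \<in> topspace X. f x \<in> V}" using f V by (intro openin_continuous_map_preimage)
    obtain x where "x \<in> topspace X" "y = f x" using y(1) unfolding S_def by blast
    then show "{x \<in> topspace X. f x \<in> V} \<noteq> {}" using U(2) V(2) by blast
    have "f x = y" if "x \<in> {x \<in> topspace X. f x \<in> V}" for x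
      using U(3)[of "f x"] that V(2) unfolding S_def by blast
    then show "\<forall>x \<in> {x \<in> topspace X. f x \<in> V}. \<forall>y \<in> {x \<in> topspace X. f x \<in> V}. f x = f y"
      by metis
  qed
qed

context profinite_group
begin

lemma locally_constant:
  fixes f :: "(nat \<Rightarrow> 'a) \<Rightarrow> 'a"
  assumes A: "\<And>i. i < n \<Longrightarrow> closedin T (A i)" "\<And>i. i < n \<Longrightarrow> A i \<noteq> {}"
    and D: "\<And>i. i < n \<Longrightarrow> D i \<subseteq> A i" "\<And>i. i < n \<Longrightarrow> A i \<subseteq> T closure_of (D i)"
    and f: "continuous_map (product_topology (\<lambda>_. T) {..<n}) T f"
    and ext: "\<And>b b'. (\<forall>i < n. b i = b' i) \<Longrightarrow> f b = f b'"
    and few: "{f b |b. \<forall>i < n. b i \<in> A i} \<prec> (UNIV :: nat set set)"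
  obtains a N where "\<forall>i < n. a i \<in> D i" "onorm N"
    "\<forall>b. (\<forall>i < n. b i \<in> A i \<and> inv (a i) \<otimes> b i \<in> N) \<longrightarrow> f b = f a"
proof -
  let ?P = "product_topology (\<lambda>_. T) {..<n}"
  have Ac: "A i \<subseteq> topspace T" if "i < n" for i using closedin_subset A(1) that by blast
  have cA: "compactin T (A i)" if "i < n" for i
    using A(1)[OF that] compact by (simp add: closedin_compact_space)
  let ?X = "subtopology ?P (PiE {..<n} A)"
  have PA: "compactin ?P (PiE {..<n} A)" using cA by (simp add: compactin_PiE)
  have tX: "topspace ?X = PiE {..<n} A"
    using compactin_subset_topspace[OF PA] by auto
  have "compact_space ?X" using PA by (simp add: compact_space_subtopology)
  moreover have "topspace ?X \<noteq> {}" unfolding tX using A(2) by (auto simp: PiE_eq_empty_iff)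
  moreover have "continuous_map ?X T f" using f by (rule continuous_map_from_subtopology)
  moreover have "f ` topspace ?X \<prec> (UNIV :: nat set set)"
  proof (rule lesspoll_trans1[OF subset_imp_lepoll few])
    show "f ` topspace ?X \<subseteq> {f b |b. \<forall>i < n. b i \<in> A i}" unfolding tX by auto
  qed
  ultimately obtain W where W: "openin ?X W" "W \<noteq> {}" "\<forall>x \<in> W. \<forall>y \<in> W. f x = f y"
    using locally_constant_if_few_values[of ?X T f] Hausdorff by blast
  then obtain V where V: "openin ?P V" "W = V \<inter> PiE {..<n} A" by (auto simp: openin_subtopology)
  obtain x where x: "x \<in> V" "x \<in> PiE {..<n} A" using W(2) V(2) by blast
  obtain U where U: "x \<in> PiE {..<n} U" "\<forall>i. openin T (U i)" "PiE {..<n} U \<subseteq> V"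
    using product_topology_open_contains_basis[OF V(1) x(1)] by blast
  have "\<exists>d. d \<in> D i \<and> d \<in> U i" if "i < n" for i
  proof -
    have "x i \<in> A i" "x i \<in> U i" using that x(2) U(1) by (auto simp: PiE_iff)
    then have "x i \<in> T closure_of (D i)" using D(2)[OF that] by blast
    then show ?thesis using U(2) \<open>x i \<in> U i\<close> unfolding in_closure_of by blast
  qed
  then obtain a where a: "\<And>i. i < n \<Longrightarrow> a i \<in> D i \<and> a i \<in> U i" by metis
  have "\<exists>M. onorm M \<and> (\<forall>m \<in> M. a i \<otimes> m \<in> U i)" if "i < n" for i
    using ex_onorm_nbhd[of "U i" "a i"] U(2) a[OF that] by metis
  then obtain M where M: "\<And>i. i < n \<Longrightarrow> onorm (M i) \<and> (\<forall>m \<in> M i. a i \<otimes> m \<in> U i)" by metis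
  have "\<exists>N. onorm N \<and> (\<forall>i < j. N \<subseteq> M i)" if "j \<le> n" for j
    using that
  proof (induction j)
    case 0
    then show ?case using onorm_carrier by blast
  next
    case (Suc j)
    then obtain N where "onorm N" "\<forall>i < j. N \<subseteq> M i" by auto
    then show ?case using M[of j] Suc.prems onorm_Int[of N "M j"]
      by (intro exI[of _ "N \<inter> M j"]) (auto simp: less_Suc_eq)
  qed
  then obtain N where N: "onorm N" "\<forall>i < n. N \<subseteq> M i" by blast
  have key: "f b = f x" if b: "\<forall>i < n. b i \<in> A i \<and> inv (a i) \<otimes> b i \<in> N" for b
  proof -
    have "b i \<in> U i" if "i < n" for i
    proof -
      have ab: "a i \<in> carrier G" "b i \<in> carrier G"
        using a[OF that] D(1)[OF that] Ac[OF that] b that by (auto simp: topspace_eq_carrier)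
      then have "b i = a i \<otimes> (inv (a i) \<otimes> b i)" by simp
      then show ?thesis using b that N M[OF that] by (metis subsetD)
    qed
    then have "restrict b {..<n} \<in> PiE {..<n} U" "restrict b {..<n} \<in> PiE {..<n} A"
      using b by (simp_all add: PiE_iff)
    then have "restrict b {..<n} \<in> V \<inter> PiE {..<n} A" using U(3) by blast
    moreover have "x \<in> V \<inter> PiE {..<n} A" using x by blast
    ultimately have "f (restrict b {..<n}) = f x" using W(3) V(2) by blast
    moreover have "f (restrict b {..<n}) = f b" by (rule ext) simp
    ultimately show ?thesis by simp
  qed
  have "f a = f x"
  proof (rule key, intro allI impI conjI)
    fix i assume i: "i < n"
    show "a i \<in> A i" using a[OF i] D(1)[OF i] by blast
    then show "inv (a i) \<otimes> a i \<in> N" using Ac[OF i] N by (auto simp: topspace_eq_carrier normal_one)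
  qed
  show thesis
  proof (rule that[of a N])
    show "\<forall>i < n. a i \<in> D i" using a by blast
    show "\<forall>b. (\<forall>i < n. b i \<in> A i \<and> inv (a i) \<otimes> b i \<in> N) \<longrightarrow> f b = f a"
      using key \<open>f a = f x\<close> by simp
  qed (rule N)
qed

section \<open>Uniform commutators and elements with open centraliser\<close>

lemma element_primes_cong:
  assumes "x \<in> carrier G" "y \<in> carrier G" "\<And>I. pi_elt I x \<longleftrightarrow> pi_elt I y"
  shows "element_primes G T x = element_primes G T y"
proof (rule subset_antisym)
  show "element_primes G T x \<subseteq> element_primes G T y"
    using element_primes_subset_iff[OF assms(1), of "element_primes G T y"]
      element_primes_subset_iff[OF assms(2), of "element_primes G T y"] assms(3) by blast
  show "element_primes G T y \<subseteq> element_primes G T x"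
    using element_primes_subset_iff[OF assms(1), of "element_primes G T x"]
      element_primes_subset_iff[OF assms(2), of "element_primes G T x"] assms(3) by blast
qed

lemma element_primes_prime:
  assumes p: "pi_elt {p} x" "x \<noteq> \<one>" shows "element_primes G T x = {p}"
proof -
  have "element_primes G T x \<subseteq> {p}" using p by (simp add: element_primes_subset_iff)
  moreover have "\<not> element_primes G T x \<subseteq> {}"
    using p pi_elt_disjoint_eq_one[of "{}" x "{}"] element_primes_subset_iff[of x "{}"] by auto
  ultimately show ?thesis by blast
qed

lemma element_primes_conjg:
  "g \<in> carrier G \<Longrightarrow> x \<in> carrier G \<Longrightarrow> element_primes G T (conjg G g x) = element_primes G T x"
  by (intro element_primes_cong) (auto simp: pi_elt_conjg_iff)

lemma element_primes_inv:
  "x \<in> carrier G \<Longrightarrow> element_primes G T (inv x) = element_primes G T x"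
  by (intro element_primes_cong) (auto simp: pi_elt_inv_iff)

lemma uniform_commutatorsI:
  assumes "x \<in> carrier G" "set xs \<subseteq> carrier G" "length xs = m"
    and "\<And>y. y \<in> set xs \<Longrightarrow> element_primes G T y = element_primes G T x"
  shows "lcomm G x xs \<in> uniform_commutators G T (Suc m)"
  unfolding uniform_commutators_def long_commutator_def
  using assms by (intro CollectI exI[of _ "x # xs"]) auto

lemma uniform_commutatorsE:
  assumes "c \<in> uniform_commutators G T (Suc m)"
  obtains x xs where "c = lcomm G x xs" "x \<in> carrier G" "set xs \<subseteq> carrier G" "length xs = m"
    "\<forall>y \<in> set xs. element_primes G T y = element_primes G T x"
proof -
  obtain ys where ys: "c = long_commutator G ys" "length ys = Suc m" "set ys \<subseteq> carrier G"
    "\<forall>x \<in> set ys. \<forall>y \<in> set ys. element_primes G T x = element_primes G T y"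
    using assms unfolding uniform_commutators_def by (elim CollectE exE conjE)
  obtain x xs where x: "ys = x # xs" using ys(2) by (cases ys) auto
  show thesis
  proof (rule that[of x xs])
    have "x \<in> set ys" "set xs \<subseteq> set ys" using x by auto
    then show "\<forall>y \<in> set xs. element_primes G T y = element_primes G T x" using ys(4) by blast
  qed (use ys(1-3) x in \<open>simp_all add: long_commutator_def\<close>)
qed

lemma uniform_commutators_conjg:
  assumes c: "c \<in> uniform_commutators G T (Suc m)" and g: "g \<in> carrier G"
  shows "conjg G g c \<in> uniform_commutators G T (Suc m)"
proof -
  obtain x xs where x: "c = lcomm G x xs" "x \<in> carrier G" "set xs \<subseteq> carrier G" "length xs = m"
    "\<forall>y \<in> set xs. element_primes G T y = element_primes G T x"
    using uniform_commutatorsE[OF c] .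
  then have "conjg G g c = lcomm G (conjg G g x) (map (conjg G g) xs)"
    using g by (simp add: conjg_lcomm)
  also have "\<dots> \<in> uniform_commutators G T (Suc m)"
    using x g by (intro uniform_commutatorsI) (auto simp: element_primes_conjg subset_iff)
  finally show ?thesis .
qed

lemma uniform_commutators_one: "\<one> \<in> uniform_commutators G T (Suc m)"
proof -
  have "set (replicate m \<one>) \<subseteq> carrier G" by (auto simp: set_replicate_conv_if)
  moreover have "element_primes G T y = element_primes G T \<one>" if "y \<in> set (replicate m \<one>)" for y
    using that by (auto simp: set_replicate_conv_if split: if_splits)
  ultimately show ?thesis
    using uniform_commutatorsI[of \<one> "replicate m \<one>" m] lcomm_one[of "replicate m \<one>"] by simp
qed

lemma uniform_commutators_conjugates:
  assumes "z \<in> carrier G" "g \<in> carrier G" "set gs \<subseteq> carrier G" "length gs = m"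
  shows "lcomm G (conjg G g z) (map (\<lambda>h. conjg G h z) gs) \<in> uniform_commutators G T (Suc m)"
  using assms by (intro uniform_commutatorsI) (auto simp: element_primes_conjg subset_iff)

text \<open>A trivial entry has no primes and may spoil uniformity of the tuple, but then the
  commutator is \<open>\<one>\<close>, which is uniform through the constant tuple.\<close>

lemma uniform_commutators_prime:
  assumes "pi_elt {p} x" "\<forall>y \<in> set xs. pi_elt {p} y" "length xs = m"
  shows "lcomm G x xs \<in> uniform_commutators G T (Suc m)"
proof (cases "\<one> \<in> set (x # xs)")
  case True
  have "set xs \<subseteq> carrier G" "x \<in> carrier G" using assms by auto
  then have "lcomm G x xs = \<one>"
    using True lcomm_one[of xs] lcomm_one_mem[of x xs] by auto
  then show ?thesis by (simp add: uniform_commutators_one)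
next
  case False
  then have "element_primes G T y = {p}" if "y \<in> set (x # xs)" for y
    using that assms element_primes_prime by auto
  then show ?thesis using assms by (intro uniform_commutatorsI) auto
qed

text \<open>Since \<open>[g, z] = (z\<^sup>-\<^sup>1)\<^sup>g z\<close>, Engel values are conjugate to commutators whose entries are
  conjugates of powers of \<open>z\<close>.\<close>

lemma uniform_commutators_engel:
  assumes c: "g \<in> carrier G" "z \<in> carrier G"
  shows "lcomm G g (replicate (Suc m) z) \<in> uniform_commutators G T (Suc m)"
proof (cases m)
  case 0
  then show ?thesis using uniform_commutatorsI[of "commutator G g z" "[]"] c by simp
next
  case (Suc l)
  let ?a = "conjg G g (inv z)"
  have "commutator G (commutator G g z) z = conjg G z (commutator G ?a z)"
    using c by (simp add: word)
  moreover have "conjg G z z = z" using c by (simp add: word)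
  then have "map (conjg G z) (replicate l z) = replicate l z" by (simp only: map_replicate)
  moreover have "set (replicate l z) \<subseteq> carrier G" using c by (auto simp: set_replicate_conv_if)
  ultimately have "lcomm G g (replicate (Suc m) z) = conjg G z (lcomm G ?a (replicate m z))"
    using c conjg_lcomm[of z "commutator G ?a z" "replicate l z"] Suc
    by (simp del: map_replicate)
  also have "\<dots> \<in> uniform_commutators G T (Suc m)"
    using c by (intro uniform_commutators_conjg uniform_commutatorsI)
      (auto simp: element_primes_conjg element_primes_inv set_replicate_conv_if split: if_splits)
  finally show ?thesis .
qed

text \<open>The FC-centre: in a profinite group an element has finitely many conjugates exactly if
  its centraliser is open.\<close>

definition FC :: "'a set" where
  "FC = {x \<in> carrier G. \<exists>N. onorm N \<and> (\<forall>n \<in> N. n \<otimes> x = x \<otimes> n)}"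

lemma FC_normal: "FC \<lhd> G"
proof -
  have "subgroup FC G"
  proof (rule subgroupI)
    show "FC \<noteq> {}" using onorm_carrier by (auto simp: FC_def intro!: exI[of _ \<one>])
    fix a assume a: "a \<in> FC"
    then obtain N where N: "onorm N" "\<forall>n \<in> N. n \<otimes> a = a \<otimes> n" "a \<in> carrier G" by (auto simp: FC_def)
    have "n \<otimes> inv a = inv a \<otimes> n" if "n \<in> N" for n
    proof -
      have nc: "n \<in> carrier G" using that N normal_in_carrier[of N] by simp
      have "n \<otimes> inv a = inv a \<otimes> (a \<otimes> n) \<otimes> inv a" using nc N(3) by (simp add: m_assoc)
      also have "\<dots> = inv a \<otimes> (n \<otimes> a) \<otimes> inv a" using N(2) that by simp
      finally show ?thesis using nc N(3) by (simp add: m_assoc)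
    qed
    then show "inv a \<in> FC" using N by (auto simp: FC_def)
    fix b assume "b \<in> FC"
    then obtain M where M: "onorm M" "\<forall>n \<in> M. n \<otimes> b = b \<otimes> n" "b \<in> carrier G" by (auto simp: FC_def)
    have "n \<otimes> (a \<otimes> b) = (a \<otimes> b) \<otimes> n" if "n \<in> N \<inter> M" for n
    proof -
      have nc: "n \<in> carrier G" using that N normal_in_carrier[of N] by simp
      have "n \<otimes> (a \<otimes> b) = (n \<otimes> a) \<otimes> b" using nc N M by (simp add: m_assoc)
      also have "\<dots> = a \<otimes> (n \<otimes> b)" using that nc N M by (simp add: m_assoc)
      finally show ?thesis using that nc N M by (simp add: m_assoc)
    qed
    then show "a \<otimes> b \<in> FC" using N M onorm_Int[of N M] unfolding FC_def by blast
  qed (auto simp: FC_def)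
  moreover have "g \<otimes> x \<otimes> inv g \<in> FC" if g: "g \<in> carrier G" and x: "x \<in> FC" for g x
  proof -
    obtain N where N: "onorm N" "\<forall>n \<in> N. n \<otimes> x = x \<otimes> n" "x \<in> carrier G" using x by (auto simp: FC_def)
    have "n \<otimes> (g \<otimes> x \<otimes> inv g) = (g \<otimes> x \<otimes> inv g) \<otimes> n" if n: "n \<in> N" for n
    proof -
      have nc: "n \<in> carrier G" using n N normal_in_carrier[of N] by simp
      have "conjg G g n \<otimes> x = x \<otimes> conjg G g n" using N n g normal_conjg[of N g n] by simp
      then have "g \<otimes> (conjg G g n \<otimes> x) \<otimes> inv g = g \<otimes> (x \<otimes> conjg G g n) \<otimes> inv g" by simp
      then show ?thesis using nc g N(3) by (simp add: word)
    qed
    then show ?thesis using N g by (auto simp: FC_def)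
  qed
  ultimately show ?thesis by (simp add: normal_inv_iff)
qed

lemma FC_common:
  assumes "finite S" "S \<subseteq> FC"
  obtains N where "onorm N" "\<forall>n \<in> N. \<forall>x \<in> S. n \<otimes> x = x \<otimes> n"
proof -
  have "\<exists>N. onorm N \<and> (\<forall>n \<in> N. \<forall>x \<in> S. n \<otimes> x = x \<otimes> n)" using assms
  proof (induction S rule: finite_induct)
    case empty
    then show ?case using onorm_carrier by blast
  next
    case (insert x S)
    then obtain N M where "onorm N" "\<forall>n \<in> N. \<forall>x \<in> S. n \<otimes> x = x \<otimes> n"
      "onorm M" "\<forall>n \<in> M. n \<otimes> x = x \<otimes> n" by (auto simp: FC_def)
    then show ?case using onorm_Int[of N M] by (intro exI[of _ "N \<inter> M"]) auto
  qed
  then show thesis using that by blast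
qed

end

subsection \<open>Pronilpotent normal subgroups\<close>

lemma (in group) pow_mult_normal:
  assumes R: "R \<lhd> G" and "x \<in> carrier G" "v \<in> R"
  shows "\<exists>w \<in> R. (x \<otimes> v) [^] (n::nat) = x [^] n \<otimes> w"
proof (induction n)
  case 0
  then show ?case using normal_one[OF R] by (intro bexI[of _ \<one>]) auto
next
  case (Suc n)
  then obtain w where w: "w \<in> R" "(x \<otimes> v) [^] n = x [^] n \<otimes> w" by blast
  note c = normal_in_carrier[OF R w(1)] normal_in_carrier[OF R assms(3)] assms(2)
  have "(x \<otimes> v) [^] Suc n = x [^] n \<otimes> w \<otimes> (x \<otimes> v)" using w by simp
  also have "\<dots> = x [^] Suc n \<otimes> (conjg G x w \<otimes> v)"
    using c by (simp add: word)
  finally show ?case using w assms by (blast intro: normal_mult[OF R] normal_conjg[OF R])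
qed

context profinite_group
begin

lemma pi_elt_mult_normal:
  assumes R: "R \<lhd> G" "\<And>r. r \<in> R \<Longrightarrow> pi_elt I r" and x: "pi_elt I x" "v \<in> R"
  shows "pi_elt I (x \<otimes> v)"
  unfolding pi_elt_def
proof (intro conjI allI impI)
  fix M assume M: "onorm M"
  obtain n where n: "pi_num I n" "x [^] n \<in> M" using pi_eltE[OF x(1) M] .
  obtain w where w: "w \<in> R" "(x \<otimes> v) [^] n = x [^] n \<otimes> w"
    using pow_mult_normal[OF R(1) _ x(2), of x n] x(1) by auto
  obtain l where l: "pi_num I l" "w [^] l \<in> M" using pi_eltE[OF R(2)[OF w(1)] M] .
  have "(x [^] n \<otimes> w) [^] l \<in> M"
    using n l M normal_in_carrier[OF R(1) w(1)] by (intro mod_pow_mult_normal(2)) auto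
  then have "((x \<otimes> v) [^] n) [^] l \<in> M" by (simp only: w(2))
  then have "(x \<otimes> v) [^] (n * l) \<in> M"
    using x normal_in_carrier[OF R(1) x(2)] by (simp add: nat_pow_pow)
  then show "\<exists>n. pi_num I n \<and> (x \<otimes> v) [^] n \<in> M" using n l pi_num_mult by blast
qed (use x normal_in_carrier[OF R(1)] in auto)

text \<open>The criterion behind pronilpotency. The commutators of conjugates need to vanish only up
  to a normal subgroup \<open>R\<close> of \<open>I\<close>-elements: the exponent lemma is applied
  modulo the product of \<open>R\<close> and \<open>M\<close>, and the remaining factor from
  \<open>R\<close> has an \<open>I\<close>-power in \<open>M\<close>.\<close>

lemma pi_elt_mult_if_conjugate_commutators:
  assumes B: "subgroup B G" and xy: "x \<in> B" "y \<in> B" "pi_elt I x" "pi_elt I y"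
    and R: "R \<lhd> G" "\<And>r. r \<in> R \<Longrightarrow> pi_elt I r"
    and c: "\<And>g gs. g \<in> B \<Longrightarrow> set gs \<subseteq> B \<Longrightarrow> length gs = k \<Longrightarrow>
        lcomm G (conjg G g x) (map (\<lambda>h. conjg G h x) gs) \<in> R"
  shows "pi_elt I (x \<otimes> y)"
  unfolding pi_elt_def
proof (intro conjI allI impI)
  fix M assume M: "onorm M"
  let ?P = "{r \<otimes> m |r m. r \<in> R \<and> m \<in> M}"
  have P: "?P \<lhd> G" using R M by (intro normal_set_mult) auto
  have RP: "r \<in> ?P" if "r \<in> R" for r
  proof -
    have "r = r \<otimes> \<one>" "\<one> \<in> M" using that R normal_in_carrier[of R] M by (auto simp: normal_one)
    then show ?thesis using that by blast
  qed
  have MP: "m \<in> ?P" if "m \<in> M" for m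
  proof -
    have "m = \<one> \<otimes> m" "\<one> \<in> R" using that M normal_in_carrier[of M] R by (auto simp: normal_one)
    then show ?thesis using that by blast
  qed
  obtain n where n: "pi_num I n" "x [^] n \<in> M" using pi_eltE[OF xy(3) M] .
  obtain l where l: "pi_num I l" "y [^] l \<in> M" using pi_eltE[OF xy(4) M] .
  have "(x \<otimes> y) [^] (l * n ^ Suc k) \<in> ?P"
    using n l RP MP c by (intro mod_pow_mult_conjg_commutators_subgroup[OF B P]) (use xy in auto)
  then obtain r \<mu> where r: "(x \<otimes> y) [^] (l * n ^ Suc k) = r \<otimes> \<mu>" "r \<in> R" "\<mu> \<in> M" by blast
  obtain j where j: "pi_num I j" "r [^] j \<in> M" using pi_eltE[OF R(2)[OF r(2)] M] .
  have "(r \<otimes> \<mu>) [^] j \<in> M"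
    using r j M normal_in_carrier[OF R(1) r(2)] by (intro mod_pow_mult_normal(1)) auto
  then have "((x \<otimes> y) [^] (l * n ^ Suc k)) [^] j \<in> M" by (simp only: r(1))
  then have "(x \<otimes> y) [^] (l * n ^ Suc k * j) \<in> M"
    using xy by (simp add: nat_pow_pow)
  moreover have "pi_num I (l * n ^ Suc k * j)"
    using n l j by (intro pi_num_mult pi_num_power)
  ultimately show "\<exists>n. pi_num I n \<and> (x \<otimes> y) [^] n \<in> M" by blast
qed (use xy in auto)

text \<open>By \<open>engel_pow\<close> some \<open>z [^] m\<close> with a \<open>J\<close>-number
  \<open>m\<close> centralises \<open>y\<close> modulo \<open>M\<close>. A further power, prime to
  \<open>I\<close>, removes \<open>v\<close>; the resulting exponent of \<open>u\<close> is coprime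
  to the order of \<open>u\<close> modulo \<open>M\<close>, so \<open>u\<close> itself centralises
  \<open>y\<close> there.\<close>

lemma engel_pi_part:
  assumes W: "subgroup W G" "\<And>w. w \<in> W \<Longrightarrow> pi_elt J w" "I \<inter> J \<inter> {p. prime p} = {}"
    and z: "z \<in> carrier G" "\<And>w. w \<in> W \<Longrightarrow> conjg G z w \<in> W"
    and engel: "\<And>y. y \<in> W \<Longrightarrow> lcomm G y (replicate j z) = \<one>"
    and uv: "z = u \<otimes> v" "u \<otimes> v = v \<otimes> u" "pi_elt I u" "pi_elt (- I) v"
    and y: "y \<in> W"
  shows "y \<otimes> u = u \<otimes> y"
proof -
  have c: "u \<in> carrier G" "v \<in> carrier G" "y \<in> carrier G" using uv(3,4) y subgroup.mem_carrier[OF W(1)] by auto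
  have "commutator G y u = \<one>"
  proof (rule eq_one_if_mem_all_onorm)
    fix M assume M: "onorm M"
    let ?S = "{g \<in> carrier G. \<forall>d \<in> {y}. commutator G d g \<in> M}"
    have S: "subgroup ?S G" using M c by (intro subgroup_commutator_right_mem) auto
    have MS: "M \<subseteq> ?S" using M c normal_in_carrier[of M] by (auto intro: normal_commutator_right)
    have "\<exists>m. pi_num J m \<and> commutator G y (z [^] m) \<in> M"
    proof (rule engel_pow[OF W(1) onorm_normal[OF M] z])
      show "\<exists>l. pi_num J l \<and> w [^] l \<in> M" if "w \<in> W" for w
        using pi_eltE[OF W(2)[OF that] M] by blast
      show "lcomm G y (replicate j z) \<in> M" using engel[OF y] M by (simp add: normal_one)
    qed (use y in auto)
    then obtain m where m: "pi_num J m" "z [^] m \<in> ?S" using z(1) by auto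
    obtain q where q: "pi_num (- I) q" "v [^] q \<in> M" using pi_eltE[OF uv(4) M] .
    obtain n where n: "pi_num I n" "u [^] n \<in> M" using pi_eltE[OF uv(3) M] .
    have "(z [^] m) [^] q \<in> ?S" using subgroup_pow[OF S m(2)] .
    then have "u [^] (m * q) \<otimes> v [^] (m * q) \<in> ?S"
      using z(1) uv(1) pow_mult_distrib[OF uv(2) c(1,2), of "m * q"] by (simp add: nat_pow_pow)
    moreover have "v [^] (m * q) \<in> ?S"
    proof -
      have "(v [^] q) [^] m \<in> M" using q M by (simp add: normal_pow)
      then show ?thesis using MS c by (auto simp: nat_pow_pow mult.commute)
    qed
    ultimately have "u [^] (m * q) \<otimes> v [^] (m * q) \<otimes> inv (v [^] (m * q)) \<in> ?S"
      by (rule subgroup.m_closed[OF S _ subgroup.m_inv_closed[OF S]])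
    then have "u [^] (m * q) \<in> ?S" using c by (simp add: m_assoc)
    moreover have "u [^] n \<in> ?S" using n MS by blast
    moreover have "coprime n (m * q)"
      using pi_num_coprime[OF n(1) m(1) W(3)] pi_num_coprime[OF n(1) q(1)] by simp
    ultimately have "u \<in> ?S" using subgroup_coprime_pow_mem[OF S c(1)] by blast
    then show "commutator G y u \<in> M" by simp
  qed (use c in simp)
  then show ?thesis using c by (simp add: commutator_eq_one_iff)
qed

text \<open>For closed normal subgroups this is equivalent to pronilpotency.\<close>

definition pronil :: "'a set \<Rightarrow> bool" where
  "pronil N \<longleftrightarrow> N \<lhd> G \<and> closedin T N \<and>
    (\<forall>I. \<forall>x \<in> N. \<forall>y \<in> N. pi_elt I x \<longrightarrow> pi_elt I y \<longrightarrow> pi_elt I (x \<otimes> y))"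

text \<open>For \<open>pronil N\<close> this is the normal Hall subgroup of \<open>N\<close> for the
  primes in \<open>I\<close>, closed by \<open>closedin_part\<close>.\<close>

definition part :: "'a set \<Rightarrow> nat set \<Rightarrow> 'a set" where
  "part N I = {x \<in> N. pi_elt I x}"

lemma part_normal:
  assumes "pronil N" shows "part N I \<lhd> G"
proof -
  have N: "N \<lhd> G" using assms by (simp add: pronil_def)
  have "subgroup (part N I) G"
    using assms N normal_in_carrier[OF N] pi_elt_one
    by (intro subgroupI) (auto simp: part_def pronil_def normal_mult normal_inverse pi_elt_inv intro!: exI[of _ \<one>] normal_one)
  moreover have "g \<otimes> x \<otimes> inv g \<in> part N I" if "g \<in> carrier G" "x \<in> part N I" for g x
    using that normal_conjg[OF N, of "inv g" x] pi_elt_conjg[of "inv g" I x] by (simp add: part_def conjg_def)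
  ultimately show ?thesis by (simp add: normal_inv_iff)
qed

lemma closedin_part: "pronil N \<Longrightarrow> closedin T (part N I)"
  using closedin_Int[OF _ closedin_pi_elt[of I], of N] by (simp add: part_def pronil_def Int_def)

lemma part_pi_elt: "x \<in> part N I \<Longrightarrow> pi_elt I x"
  by (simp add: part_def)

lemma part_subset: "part N I \<subseteq> N"
  by (auto simp: part_def)

text \<open>Both parts are normal, so the commutator belongs to both and has no primes left.\<close>

lemma part_commute:
  assumes N: "pronil N" and x: "x \<in> part N I" and y: "y \<in> part N J" and "I \<inter> J \<inter> {p. prime p} = {}"
  shows "x \<otimes> y = y \<otimes> x"
proof -
  have c: "x \<in> carrier G" "y \<in> carrier G" using x y by (auto simp: part_def)
  have "commutator G x y \<in> part N I" using normal_commutator_left[OF part_normal[OF N] x] c by blast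
  moreover have "commutator G x y \<in> part N J" using normal_commutator_right[OF part_normal[OF N] y] c by blast
  ultimately have "commutator G x y = \<one>"
    using pi_elt_disjoint_eq_one assms(4) part_pi_elt by blast
  then show ?thesis using c by (simp add: commutator_eq_one_iff)
qed

lemma part_split:
  assumes N: "pronil N" and x: "x \<in> N"
  obtains u v where "x = u \<otimes> v" "u \<otimes> v = v \<otimes> u" "u \<in> part N I" "v \<in> part N (- I)"
    "\<And>K. subgroup K G \<Longrightarrow> closedin T K \<Longrightarrow> x \<in> K \<Longrightarrow> u \<in> K \<and> v \<in> K"
proof -
  have xc: "x \<in> carrier G" using x N normal_in_carrier[of N] by (simp add: pronil_def)
  obtain u v where uv: "x = u \<otimes> v" "u \<otimes> v = v \<otimes> u" "pi_elt I u" "pi_elt (- I) v"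
    and K: "\<And>K. subgroup K G \<Longrightarrow> closedin T K \<Longrightarrow> x \<in> K \<Longrightarrow> u \<in> K \<and> v \<in> K"
    using ex_pi_parts[OF xc, of I] by metis
  have "u \<in> N \<and> v \<in> N" using K[of N] N x by (simp add: pronil_def normal_imp_subgroup)
  then show thesis using that[OF uv(1,2) _ _ K] uv(3,4) by (simp add: part_def)
qed

end

section \<open>Few uniform commutators, with \<open>m = k - 1\<close> entries after the first: an
  open pronilpotent subgroup\<close>

locale few_uniform_commutators = profinite_group +
  fixes m :: nat
  assumes few: "uniform_commutators G T (Suc m) \<prec> (UNIV :: nat set set)"
begin

abbreviation X :: "'a set" where "X \<equiv> uniform_commutators G T (Suc m)"

lemma few_subset: "S \<subseteq> X \<Longrightarrow> S \<prec> (UNIV :: nat set set)"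
  using few lesspoll_trans1 subset_imp_lepoll by blast

lemma X_carrier: "X \<subseteq> carrier G"
  by (auto elim!: uniform_commutatorsE)

lemma X_FC: "X \<subseteq> FC"
proof
  fix c assume c: "c \<in> X"
  have cc: "c \<in> carrier G" using c X_carrier by blast
  obtain a N where a: "\<forall>i < Suc 0. a i \<in> carrier G" "onorm N"
    "\<forall>b. (\<forall>i < Suc 0. b i \<in> carrier G \<and> inv (a i) \<otimes> b i \<in> N) \<longrightarrow> conjg G (b 0) c = conjg G (a 0) c"
  proof (rule locally_constant[where n = "Suc 0" and f = "\<lambda>b. conjg G (b 0) c" and A = "\<lambda>_. carrier G" and D = "\<lambda>_. carrier G"])
    show "carrier G \<subseteq> T closure_of carrier G" by (simp add: closure_of_subset topspace_eq_carrier)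
    show "continuous_map (product_topology (\<lambda>_. T) {..<Suc 0}) T (\<lambda>b. conjg G (b 0) c)"
      using cc by (intro continuous_conjg continuous_const_carrier continuous_map_product_projection) auto
    show "{conjg G (b 0) c |b. \<forall>i < Suc 0. b i \<in> carrier G} \<prec> (UNIV :: nat set set)"
      using uniform_commutators_conjg[OF c] by (intro few_subset) auto
  qed (use closedin_topspace[of T] in \<open>auto simp: topspace_eq_carrier\<close>)
  have "n \<otimes> c = c \<otimes> n" if n: "n \<in> N" for n
  proof -
    have nc: "n \<in> carrier G" using n a(2) normal_in_carrier[of N] by simp
    \<comment> \<open>By normality \<open>n \<otimes> a 0\<close> lies in the left coset on which
      conjugation of \<open>c\<close> is constant.\<close>
    have "inv (a 0) \<otimes> (n \<otimes> a 0) = conjg G (a 0) n" using a(1) nc by (simp add: word)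
    then have "inv (a 0) \<otimes> (n \<otimes> a 0) \<in> N" using a n by (simp add: normal_conjg)
    then have "conjg G (n \<otimes> a 0) c = conjg G (a 0) c"
      using a nc a(3)[rule_format, of "\<lambda>_. n \<otimes> a 0"] by simp
    then have "conjg G (inv (a 0)) (conjg G (n \<otimes> a 0) c) = conjg G (inv (a 0)) (conjg G (a 0) c)" by simp
    then have "conjg G n c = c" using a(1) nc cc by (simp add: conjg_conjg m_assoc)
    then show ?thesis using nc cc by (simp add: conjg_eq_iff)
  qed
  then show "c \<in> FC" using cc a(2) by (auto simp: FC_def)
qed

text \<open>\<open>FC\<close> need not be closed; the closure gives a profinite quotient in which
  all uniform commutators vanish, and in which \<open>FC\<close> supplies dense centres.\<close>

definition Fbar :: "'a set" where
  "Fbar = T closure_of FC"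

lemma Fbar: "Fbar \<lhd> G" "closedin T Fbar" "FC \<subseteq> Fbar"
  unfolding Fbar_def using FC_normal normal_closure_of
  by (auto intro!: closure_of_subset simp: topspace_eq_carrier dest: normal_in_carrier)

text \<open>Commutators of conjugates of \<open>x\<close> are uniform, hence trivial modulo
  \<open>Fbar\<close>. This is the pronilpotency of the quotient by \<open>Fbar\<close>, read off
  modulo each \<open>M\<close>.\<close>

lemma pow_mult_mod_Fbar:
  assumes M: "onorm M" "Fbar \<subseteq> M" and x: "x \<in> carrier G" "pi_num I n" "x [^] n \<in> M"
    and y: "y \<in> carrier G" "pi_num I l" "y [^] l \<in> M"
  shows "\<exists>n. pi_num I n \<and> (x \<otimes> y) [^] n \<in> M"
proof -
  have "(x \<otimes> y) [^] (l * n ^ Suc m) \<in> M"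
  proof (rule mod_pow_mult_conjg_commutators)
    show "lcomm G (conjg G g x) (map (\<lambda>h. conjg G h x) gs) \<in> M"
      if "g \<in> carrier G" "set gs \<subseteq> carrier G" "length gs = m" for g gs
      using uniform_commutators_conjugates[OF x(1) that] X_FC Fbar(3) M(2) by blast
  qed (use assms in auto)
  then show ?thesis using x y pi_num_mult pi_num_power by blast
qed

text \<open>The variables run through \<open>Fbar\<close>, so the centre can be chosen in
  \<open>FC\<close> and \<open>N\<close> can be shrunk to centralise it. The word then splits into
  its values at the centre and at the displacement, and constancy makes the latter trivial.\<close>

lemma ex_onorm_conjugate_commutators_trivial:
  obtains N where "onorm N" "\<forall>x \<in> N \<inter> Fbar. \<forall>g \<in> N \<inter> Fbar. \<forall>gs. set gs \<subseteq> N \<inter> Fbar \<and> length gs = m \<longrightarrow>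
     lcomm G (conjg G g x) (map (\<lambda>h. conjg G h x) gs) = \<one>"
proof -
  let ?n = "Suc (Suc m)"
  \<comment> \<open>\<open>b 0\<close> is the element, \<open>b 1\<close> conjugates it in the first
    place, and the other \<open>m\<close> variables conjugate it in the remaining places.\<close>
  let ?f = "\<lambda>b. lcomm G (conjg G (b 1) (b 0)) (map (\<lambda>i. conjg G (b i) (b 0)) [2..<?n])"
  have Fc: "Fbar \<subseteq> carrier G" using normal_in_carrier[OF Fbar(1)] by blast
  obtain a N where a: "\<forall>i < ?n. a i \<in> FC" "onorm N"
    "\<forall>b. (\<forall>i < ?n. b i \<in> Fbar \<and> inv (a i) \<otimes> b i \<in> N) \<longrightarrow> ?f b = ?f a"
  proof (rule locally_constant[where n = ?n and f = ?f and A = "\<lambda>_. Fbar" and D = "\<lambda>_. FC"])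
    show "closedin T Fbar" by (rule Fbar)
    show "Fbar \<noteq> {}" using normal_one[OF Fbar(1)] by blast
    show "FC \<subseteq> Fbar" by (rule Fbar)
    show "Fbar \<subseteq> T closure_of FC" by (simp add: Fbar_def)
    have "continuous_map (product_topology (\<lambda>_. T) {..<?n}) T
      (\<lambda>b. lcomm G (conjg G (b 1) (b 0)) (map (\<lambda>h. h b) (map (\<lambda>i b. conjg G (b i) (b 0)) [2..<?n])))"
    proof (rule continuous_lcomm)
      show "continuous_map (product_topology (\<lambda>_. T) {..<?n}) T (\<lambda>b. conjg G (b 1) (b 0))"
        by (intro continuous_conjg continuous_map_product_projection) auto
      show "continuous_map (product_topology (\<lambda>_. T) {..<?n}) T g"
        if g: "g \<in> set (map (\<lambda>i b. conjg G (b i) (b 0)) [2..<?n])" for g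
      proof -
        obtain i where "i \<in> set [2..<?n]" "g = (\<lambda>b. conjg G (b i) (b 0))"
          using g unfolding set_map by blast
        then show ?thesis by (auto intro!: continuous_conjg continuous_map_product_projection)
      qed
    qed
    then show "continuous_map (product_topology (\<lambda>_. T) {..<?n}) T ?f" by (simp add: comp_def)
    show "?f b = ?f b'" if "\<forall>i < ?n. b i = b' i" for b b'
    proof -
      have b: "b 0 = b' 0" "b 1 = b' 1" using that by auto
      have "map (\<lambda>i. conjg G (b i) (b' 0)) [2..<?n] = map (\<lambda>i. conjg G (b' i) (b' 0)) [2..<?n]"
        using that by (intro map_cong) auto
      then show ?thesis unfolding b by (rule arg_cong)
    qed
    show "{?f b |b. \<forall>i < ?n. b i \<in> Fbar} \<prec> (UNIV :: nat set set)"
    proof (rule few_subset, safe)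
      fix b assume "\<forall>i < ?n. b i \<in> Fbar"
      then have b: "\<forall>i < ?n. b i \<in> carrier G" using Fc by blast
      have "lcomm G (conjg G (b 1) (b 0)) (map (\<lambda>h. conjg G h (b 0)) (map b [2..<?n])) \<in> X"
        using b by (intro uniform_commutators_conjugates) (auto simp: Suc_diff_le)
      then show "?f b \<in> X" by (simp add: comp_def)
    qed
  qed
  obtain M where M: "onorm M" "\<forall>n \<in> M. \<forall>x \<in> a ` {..<?n}. n \<otimes> x = x \<otimes> n"
    using FC_common[of "a ` {..<?n}"] a(1) by auto
  let ?N = "N \<inter> M"
  have N: "onorm ?N" using a(2) M(1) by (rule onorm_Int)
  note Nc = normal_in_carrier[OF onorm_normal[OF N]]
  let ?C = "{g \<in> carrier G. \<forall>d \<in> ?N. commutator G d g \<in> {\<one>}}"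
  have C: "subgroup ?C G"
    using Nc by (intro subgroup_commutator_right_mem[OF one_is_normal]) auto
  have CN: "d \<otimes> n = n \<otimes> d" if "d \<in> ?C" "n \<in> ?N" for d n
  proof -
    have "commutator G n d = \<one>" using that by blast
    then show ?thesis using that Nc[OF that(2)] by (subst (asm) commutator_eq_one_iff) auto
  qed
  have ac: "a i \<in> carrier G" if "i < ?n" for i
    using a(1) that by (auto simp: FC_def)
  have aC: "a i \<in> ?C" if "i < ?n" for i
    using that ac[OF that] M(2) Nc by (auto simp: commutator_eq_one_iff)
  have "lcomm G (conjg G g x) (map (\<lambda>h. conjg G h x) gs) = \<one>"
    if x: "x \<in> ?N \<inter> Fbar" and g: "g \<in> ?N \<inter> Fbar" and gs: "set gs \<subseteq> ?N \<inter> Fbar" "length gs = m" for x g gs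
  proof -
    define y where "y i = (x # g # gs) ! i" for i
    have yN: "y i \<in> ?N \<inter> Fbar" if "i < ?n" for i
    proof -
      have "y i \<in> set (x # g # gs)" unfolding y_def using that gs by (intro nth_mem) simp
      then show ?thesis using x g gs by auto
    qed
    \<comment> \<open>Since the centres commute with the displacements, conjugating
      \<open>a 0 \<otimes> y 0\<close> by \<open>a i \<otimes> y i\<close> gives
      \<open>\<delta> i \<otimes> \<eta> i\<close>, with factors from two subgroups that commute
      elementwise.\<close>
    define \<delta> \<eta> where "\<delta> i = conjg G (a i) (a 0)" and "\<eta> i = conjg G (y i) (y 0)" for i
    have dC: "\<delta> i \<in> ?C" if "i < ?n" for i
      unfolding \<delta>_def using that by (intro subgroup_conjg[OF C] aC) auto
    have eN: "\<eta> i \<in> ?N" if "i < ?n" for i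
      unfolding \<eta>_def using yN[OF that] yN[of 0] Nc by (intro normal_conjg[OF onorm_normal[OF N]]) auto
    have split: "conjg G (a i \<otimes> y i) (a 0 \<otimes> y 0) = \<delta> i \<otimes> \<eta> i" if i: "i < ?n" for i
    proof -
      have c: "a i \<in> carrier G" "y i \<in> carrier G" "a 0 \<in> carrier G" "y 0 \<in> carrier G"
        using ac[OF i] ac[of 0] yN[OF i] yN[of 0] Nc by auto
      have "conjg G (a i) (y 0) = y 0" using CN[OF aC[OF i], of "y 0"] yN[of 0] c by (subst conjg_eq_iff) auto
      moreover have "conjg G (y i) (\<delta> i) = \<delta> i"
        using CN[OF dC[OF i], of "y i"] yN[OF i] c dC[OF i] by (subst conjg_eq_iff) auto
      moreover have "conjg G (a i \<otimes> y i) (a 0 \<otimes> y 0) = conjg G (y i) (\<delta> i) \<otimes> conjg G (y i) (conjg G (a i) (y 0))"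
        using c by (simp add: \<delta>_def conjg_mult conjg_conjg)
      ultimately show ?thesis by (simp add: \<eta>_def)
    qed
    let ?L = "[2..<?n]"
    have e1: "?f (\<lambda>i. a i \<otimes> y i) = ?f a"
    proof (rule a(3)[rule_format], intro conjI)
      fix i assume i: "i < ?n"
      show "a i \<otimes> y i \<in> Fbar"
        using a(1) Fbar(3) yN[OF i] i by (intro normal_mult[OF Fbar(1)]) auto
      show "inv (a i) \<otimes> (a i \<otimes> y i) \<in> N" using ac[OF i] yN[OF i] Nc by auto
    qed
    have "map (\<lambda>i. conjg G (a i \<otimes> y i) (a 0 \<otimes> y 0)) ?L = map (\<lambda>i. \<delta> i \<otimes> \<eta> i) ?L"
      by (rule map_cong[OF refl], rule split) auto
    then have mp: "map (\<lambda>i. conjg G (a i \<otimes> y i) (a 0 \<otimes> y 0)) ?L = map2 (\<otimes>) (map \<delta> ?L) (map \<eta> ?L)"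
      by (simp only: map2_map_map)
    have s1: "conjg G (a 1 \<otimes> y 1) (a 0 \<otimes> y 0) = \<delta> 1 \<otimes> \<eta> 1" by (rule split) simp
    have "?f (\<lambda>i. a i \<otimes> y i) = lcomm G (\<delta> 1 \<otimes> \<eta> 1) (map2 (\<otimes>) (map \<delta> ?L) (map \<eta> ?L))"
      unfolding mp s1 ..
    also have "\<dots> = lcomm G (\<delta> 1) (map \<delta> ?L) \<otimes> lcomm G (\<eta> 1) (map \<eta> ?L)"
      using dC eN by (intro lcomm_map2_mult_commuting[OF C normal_imp_subgroup[OF onorm_normal[OF N]] CN]) auto
    finally have e2: "?f (\<lambda>i. a i \<otimes> y i) = lcomm G (\<delta> 1) (map \<delta> ?L) \<otimes> lcomm G (\<eta> 1) (map \<eta> ?L)" .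
    have e3: "?f a = lcomm G (\<delta> 1) (map \<delta> ?L)" unfolding \<delta>_def ..
    have cl: "lcomm G (\<delta> 1) (map \<delta> ?L) \<in> carrier G" "lcomm G (\<eta> 1) (map \<eta> ?L) \<in> carrier G"
      using dC eN Nc by (auto intro!: lcomm_closed simp del: upt_Suc)
    then have "lcomm G (\<delta> 1) (map \<delta> ?L) \<otimes> lcomm G (\<eta> 1) (map \<eta> ?L) = lcomm G (\<delta> 1) (map \<delta> ?L) \<otimes> \<one>"
      using e1 unfolding e2 e3 by (simp only: r_one)
    then have "lcomm G (\<eta> 1) (map \<eta> ?L) = \<one>" using cl by (simp del: upt_Suc)
    moreover have "map \<eta> ?L = map (\<lambda>h. conjg G h x) gs"
      using gs by (intro nth_equalityI) (auto simp: \<eta>_def y_def Suc_diff_le simp del: upt_Suc)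
    ultimately show ?thesis by (simp add: \<eta>_def y_def)
  qed
  then show thesis using that[OF N] by blast
qed

end

lemma (in group) normal_centralizer:
  assumes N: "N \<lhd> G"
  shows "{g \<in> carrier G. \<forall>n \<in> N. g \<otimes> n = n \<otimes> g} \<lhd> G" (is "?C \<lhd> G")
proof -
  note Nc = normal_in_carrier[OF N]
  have "?C = {c \<in> carrier G. \<forall>d \<in> N. commutator G c d \<in> {\<one>}}"
    using Nc by (auto simp: commutator_eq_one_iff)
  then have "subgroup ?C G"
    using subgroup_commutator_left_mem[OF one_is_normal, of N] Nc by auto
  moreover have "g \<otimes> x \<otimes> inv g \<in> ?C" if g: "g \<in> carrier G" and x: "x \<in> ?C" for g x
  proof -
    have "g \<otimes> x \<otimes> inv g \<otimes> n = n \<otimes> (g \<otimes> x \<otimes> inv g)" if n: "n \<in> N" for n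
    proof -
      have "conjg G (inv g) (x \<otimes> conjg G g n) = conjg G (inv g) (conjg G g n \<otimes> x)"
        using x normal_conjg[OF N g n] by simp
      then show ?thesis using x g Nc[OF n] by (simp add: word)
    qed
    then show ?thesis using g x by simp
  qed
  ultimately show ?thesis by (simp add: normal_inv_iff)
qed

context profinite_group
begin

lemma pronil_subset: "pronil N \<Longrightarrow> V \<lhd> G \<Longrightarrow> closedin T V \<Longrightarrow> V \<subseteq> N \<Longrightarrow> pronil V"
  unfolding pronil_def by blast

end

context few_uniform_commutators
begin

lemma Fbar_Int_onorm: "onorm N \<Longrightarrow> N \<inter> Fbar \<lhd> G" "onorm N \<Longrightarrow> closedin T (N \<inter> Fbar)"
  by (rule normal_subgroup_intersect[OF onorm_normal Fbar(1)], assumption)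
    (rule closedin_Int[OF onorm_closedin Fbar(2)])

lemma ex_pronil_Int_Fbar:
  obtains N where "onorm N" "pronil (N \<inter> Fbar)"
proof -
  obtain N where N: "onorm N" "\<forall>x \<in> N \<inter> Fbar. \<forall>g \<in> N \<inter> Fbar. \<forall>gs. set gs \<subseteq> N \<inter> Fbar \<and> length gs = m \<longrightarrow>
     lcomm G (conjg G g x) (map (\<lambda>h. conjg G h x) gs) = \<one>"
    by (rule ex_onorm_conjugate_commutators_trivial)
  note V = Fbar_Int_onorm[OF N(1)]
  have "pi_elt I (x \<otimes> y)" if "x \<in> N \<inter> Fbar" "y \<in> N \<inter> Fbar" "pi_elt I x" "pi_elt I y" for I x y
    using that N(2)
    by (intro pi_elt_mult_if_conjugate_commutators[OF normal_imp_subgroup[OF V(1)] _ _ _ _ one_is_normal, where k = m])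
      (auto simp: pi_elt_one)
  then have "pronil (N \<inter> Fbar)" using V by (simp add: pronil_def)
  then show thesis using that N(1) by blast
qed

text \<open>The first variable stays in \<open>Fbar\<close>, where a centre from \<open>FC\<close>
  can be cancelled. The second runs through the open subgroup \<open>N1\<close>, where
  \<open>FC\<close> is not known to be dense; therefore the offset \<open>a\<close> remains in the
  conclusion.\<close>

lemma ex_onorm_engel:
  assumes N1: "onorm N1"
  obtains N a where "onorm N" "N \<subseteq> N1" "a \<in> N1"
    "\<forall>y \<in> N \<inter> Fbar. \<forall>z \<in> N. lcomm G y (replicate (Suc m) (a \<otimes> z)) = \<one>"
proof -
  let ?f = "\<lambda>b. lcomm G (b 0) (replicate (Suc m) (b 1))"
  define A where "A i = (if i = 0 then Fbar \<inter> N1 else N1)" for i :: nat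
  define D where "D i = (if i = 0 then FC \<inter> N1 else N1)" for i :: nat
  note N1c = normal_in_carrier[OF onorm_normal[OF N1]]
  note Fc = normal_in_carrier[OF Fbar(1)]
  obtain a N where a: "\<forall>i < 2. a i \<in> D i" "onorm N"
    "\<forall>b. (\<forall>i < 2. b i \<in> A i \<and> inv (a i) \<otimes> b i \<in> N) \<longrightarrow> ?f b = ?f a"
  proof (rule locally_constant[where n = 2 and f = ?f and A = A and D = D])
    fix i :: nat assume "i < 2"
    show "closedin T (A i)" using closedin_Int[OF Fbar(2) onorm_closedin[OF N1]] onorm_closedin[OF N1] by (simp add: A_def)
    have "\<one> \<in> A i" using normal_one[OF Fbar(1)] normal_one[OF onorm_normal[OF N1]] by (simp add: A_def)
    then show "A i \<noteq> {}" by blast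
    show "D i \<subseteq> A i" using Fbar(3) by (auto simp: A_def D_def)
    have "N1 \<inter> T closure_of FC \<subseteq> T closure_of (N1 \<inter> FC)"
      using N1 by (intro openin_Int_closure_of_subset) (simp add: onorm_def)
    moreover have "N1 \<subseteq> T closure_of N1" using N1c by (intro closure_of_subset) (auto simp: topspace_eq_carrier)
    ultimately show "A i \<subseteq> T closure_of (D i)" by (auto simp: A_def D_def Fbar_def Int_commute)
  next
    have "continuous_map (product_topology (\<lambda>_. T) {..<2::nat}) T
      (\<lambda>b. lcomm G (b 0) (map (\<lambda>h. h b) (replicate (Suc m) (\<lambda>b. b 1))))"
      by (intro continuous_lcomm continuous_map_product_projection)
        (auto simp: set_replicate_conv_if split: if_splits intro!: continuous_map_product_projection)
    then show "continuous_map (product_topology (\<lambda>_. T) {..<2::nat}) T ?f" by (simp only: map_replicate)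
  next
    fix b b' :: "nat \<Rightarrow> 'a" assume "\<forall>i < 2. b i = b' i"
    then show "?f b = ?f b'" by (simp del: replicate_Suc)
  next
    show "{?f b |b. \<forall>i < 2. b i \<in> A i} \<prec> (UNIV :: nat set set)"
    proof (rule few_subset, safe)
      fix b assume b: "\<forall>i < 2. b i \<in> A i"
      have "b 0 \<in> carrier G" "b 1 \<in> carrier G"
        using b[rule_format, of 0] b[rule_format, of 1] N1c by (auto simp: A_def)
      then show "?f b \<in> X" by (rule uniform_commutators_engel)
    qed
  qed
  have d: "a 0 \<in> FC" "a 0 \<in> N1" "a 1 \<in> N1"
    using a(1)[rule_format, of 0] a(1)[rule_format, of 1] by (auto simp: D_def)
  obtain M where M: "onorm M" "\<forall>n \<in> M. \<forall>x \<in> {a 0}. n \<otimes> x = x \<otimes> n"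
    using FC_common[of "{a 0}"] d by auto
  let ?N = "N \<inter> M \<inter> N1"
  have N: "onorm ?N" using a(2) M(1) N1 by (intro onorm_Int)
  note Nc = normal_in_carrier[OF onorm_normal[OF N]]
  let ?C = "{g \<in> carrier G. \<forall>n \<in> ?N. g \<otimes> n = n \<otimes> g}"
  have "lcomm G y (replicate (Suc m) (a 1 \<otimes> z)) = \<one>" if y: "y \<in> ?N \<inter> Fbar" and z: "z \<in> ?N" for y z
  proof -
    have c: "a 0 \<in> carrier G" "a 1 \<in> carrier G" "y \<in> carrier G" "z \<in> carrier G"
      using d N1c y z by auto
    have *: "?f b = ?f a" if "b 0 = a 0 \<otimes> w" "w \<in> ?N \<inter> Fbar" "b 1 = a 1 \<otimes> z" for b :: "nat \<Rightarrow> 'a" and w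
    proof (rule a(3)[THEN spec, THEN mp, of b], intro allI impI conjI)
      fix i :: nat assume "i < 2"
      then consider "i = 0" | "i = 1" by linarith
      note i = this
      show "b i \<in> A i"
        using i
      proof cases
        case 1
        have "a 0 \<otimes> w \<in> Fbar" "a 0 \<otimes> w \<in> N1"
          using that(2) d Fbar(3) onorm_normal[OF N1] by (auto intro!: normal_mult[OF Fbar(1)] normal_mult[OF onorm_normal[OF N1]])
        then show ?thesis using 1 that by (simp add: A_def)
      next
        case 2
        then show ?thesis using that z d by (auto simp: A_def intro!: normal_mult[OF onorm_normal[OF N1]])
      qed
      show "inv (a i) \<otimes> b i \<in> N"
        using i by cases (use that z c Nc in auto)
    qed
    \<comment> \<open>The same second entry is used with first entries
      \<open>a 0 \<otimes> y\<close> and \<open>a 0\<close>; comparing the two values isolates the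
      Engel word at \<open>y\<close>.\<close>
    have "?f (\<lambda>i::nat. if i = 0 then a 0 \<otimes> y else a 1 \<otimes> z) = ?f a"
      using y by (intro *[of "\<lambda>i::nat. if i = 0 then a 0 \<otimes> y else a 1 \<otimes> z" y]) auto
    moreover have "?f (\<lambda>i::nat. if i = 0 then a 0 else a 1 \<otimes> z) = ?f a"
      using c normal_one[OF onorm_normal[OF N]] normal_one[OF Fbar(1)] by (intro *[of "\<lambda>i::nat. if i = 0 then a 0 else a 1 \<otimes> z" \<one>]) auto
    ultimately have "lcomm G (a 0 \<otimes> y) (replicate (Suc m) (a 1 \<otimes> z)) = lcomm G (a 0) (replicate (Suc m) (a 1 \<otimes> z))"
      by simp
    moreover have "lcomm G (a 0 \<otimes> y) (replicate (Suc m) (a 1 \<otimes> z)) =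
        lcomm G (a 0) (replicate (Suc m) (a 1 \<otimes> z)) \<otimes> lcomm G y (replicate (Suc m) (a 1 \<otimes> z))"
    proof (rule lcomm_mult_commuting[OF normal_centralizer[OF onorm_normal[OF N]] onorm_normal[OF N]])
      show "a 0 \<in> ?C" using c M(2) by auto
    qed (use c y in \<open>auto simp: set_replicate_conv_if\<close>)
    moreover have "set (replicate (Suc m) (a 1 \<otimes> z)) \<subseteq> carrier G" using c by (auto simp: set_replicate_conv_if)
    then have "lcomm G (a 0) (replicate (Suc m) (a 1 \<otimes> z)) \<in> carrier G" "lcomm G y (replicate (Suc m) (a 1 \<otimes> z)) \<in> carrier G"
      using c by (auto intro!: lcomm_closed)
    ultimately show ?thesis by (metis l_cancel_one)
  qed
  then show thesis using that[OF N _ d(3)] by blast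
qed

text \<open>For \<open>u \<in> N\<close> with \<open>z = a u\<close>, the element \<open>\<epsilon> = a\<^sub>I u z\<^sub>I\<^sup>-\<^sup>1\<close> lies in \<open>Fbar\<close>, because \<open>G / Fbar\<close> is
  pronilpotent; as \<open>a\<^sub>I\<close> and \<open>z\<^sub>I\<close> act trivially, \<open>u\<close> acts like the prime-to-\<open>I\<close> part of \<open>\<epsilon>\<close>.\<close>

lemma ex_onorm_pronil:
  obtains N where "onorm N" "pronil N"
proof -
  obtain N1 where N1: "onorm N1" "pronil (N1 \<inter> Fbar)" by (rule ex_pronil_Int_Fbar)
  obtain N a where N: "onorm N" "N \<subseteq> N1" "a \<in> N1"
    "\<forall>y \<in> N \<inter> Fbar. \<forall>z \<in> N. lcomm G y (replicate (Suc m) (a \<otimes> z)) = \<one>"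
    by (rule ex_onorm_engel[OF N1(1)])
  let ?V = "N \<inter> Fbar" and ?V1 = "N1 \<inter> Fbar"
  note V1n = onorm_normal[OF N1(1)] and Nn = onorm_normal[OF N(1)]
  note N1c = normal_in_carrier[OF V1n] and Nc = normal_in_carrier[OF Nn]
  have N1s: "subgroup N1 G" "closedin T N1" using N1 by (auto simp: normal_imp_subgroup onorm_closedin)
  have V: "pronil ?V" using pronil_subset[OF N1(2) Fbar_Int_onorm[OF N(1)]] N(2) by blast
  have VV1: "part ?V J \<subseteq> part ?V1 J" for J using N(2) by (auto simp: part_def)
  have ac: "a \<in> carrier G" using N(3) N1c by blast
  \<comment> \<open>For \<open>z\<close> in the coset of \<open>a\<close>, the Engel condition
    together with coprimeness makes the \<open>I\<close>-part of \<open>z\<close> centralise the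
    prime-to-\<open>I\<close> part of \<open>?V\<close>.\<close>
  have com: "y \<otimes> u = u \<otimes> y"
    if n: "n \<in> N" and y: "y \<in> part ?V (- I)" and
      uv: "a \<otimes> n = u \<otimes> v" "u \<otimes> v = v \<otimes> u" "pi_elt I u" "pi_elt (- I) v" for n y I u v
  proof (rule engel_pi_part[where W = "part ?V (- I)" and J = "- I" and z = "a \<otimes> n" and j = "Suc m"])
    show "subgroup (part ?V (- I)) G" using part_normal[OF V] normal_imp_subgroup by blast
    show "conjg G (a \<otimes> n) w \<in> part ?V (- I)" if "w \<in> part ?V (- I)" for w
      using that ac n Nc by (intro normal_conjg[OF part_normal[OF V]]) auto
    show "lcomm G y (replicate (Suc m) (a \<otimes> n)) = \<one>" if "y \<in> part ?V (- I)" for y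
      using that n N(4) part_subset[of ?V] by blast
  qed (use ac n Nc y uv part_pi_elt in auto)
  have cent: "w \<otimes> u = u \<otimes> w" if u: "u \<in> N" "pi_elt I u" and w: "w \<in> part ?V (- I)" for I u w
  proof -
    have uc: "u \<in> carrier G" using u Nc by blast
    let ?z = "a \<otimes> u"
    have zN1: "?z \<in> N1" using N u by (intro normal_mult[OF V1n]) auto
    have zc: "?z \<in> carrier G" using ac uc by simp
    obtain a1 a2 where a: "a = a1 \<otimes> a2" "a1 \<otimes> a2 = a2 \<otimes> a1" "pi_elt I a1" "pi_elt (- I) a2"
      and aK: "\<And>K. subgroup K G \<Longrightarrow> closedin T K \<Longrightarrow> a \<in> K \<Longrightarrow> a1 \<in> K \<and> a2 \<in> K"
      using ex_pi_parts[OF ac, of I] by metis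
    obtain z1 z2 where z: "?z = z1 \<otimes> z2" "z1 \<otimes> z2 = z2 \<otimes> z1" "pi_elt I z1" "pi_elt (- I) z2"
      and zK: "\<And>K. subgroup K G \<Longrightarrow> closedin T K \<Longrightarrow> ?z \<in> K \<Longrightarrow> z1 \<in> K \<and> z2 \<in> K"
      using ex_pi_parts[OF zc, of I] by metis
    have c: "a1 \<in> carrier G" "a2 \<in> carrier G" "z1 \<in> carrier G" "z2 \<in> carrier G"
      using a z by auto
    have mem: "a1 \<in> N1" "z1 \<in> N1" using aK[OF N1s N(3)] zK[OF N1s zN1] by auto
    define \<epsilon> where "\<epsilon> = a1 \<otimes> u \<otimes> inv z1"
    have ec: "\<epsilon> \<in> carrier G" using c uc by (simp add: \<epsilon>_def)
    \<comment> \<open>The two expressions show \<open>\<epsilon>\<close> modulo \<open>Fbar\<close>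
      as a product of \<open>I\<close>-elements and as a product of prime-to-\<open>I\<close>
      elements, so it is trivial there.\<close>
    have eps2: "\<epsilon> = inv a2 \<otimes> z2"
    proof -
      have "a2 \<otimes> (a1 \<otimes> u) = z2 \<otimes> z1" using a(1,2) z(1,2) c uc by (simp flip: m_assoc)
      then have "inv a2 \<otimes> (a2 \<otimes> (a1 \<otimes> u)) \<otimes> inv z1 = inv a2 \<otimes> (z2 \<otimes> z1) \<otimes> inv z1" by simp
      then show ?thesis using c uc by (simp add: \<epsilon>_def m_assoc)
    qed
    have "\<epsilon> \<in> Fbar"
    proof (rule mem_closed_normal_iff[OF Fbar(1,2) ec])
      fix M assume M: "onorm M" "Fbar \<subseteq> M"
      have pw: "\<exists>n. pi_num J n \<and> (x \<otimes> y) [^] n \<in> M"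
        if "x \<in> carrier G" "y \<in> carrier G" "\<exists>n. pi_num J n \<and> x [^] n \<in> M" "\<exists>n. pi_num J n \<and> y [^] n \<in> M" for x y J
        using that pow_mult_mod_Fbar[OF M] by blast
      have el: "\<exists>n. pi_num J n \<and> x [^] n \<in> M" if "pi_elt J x" for x J
        using pi_eltE[OF that M(1)] by blast
      have "\<exists>n. pi_num I n \<and> \<epsilon> [^] n \<in> M"
        unfolding \<epsilon>_def using c uc a u z by (intro pw el pi_elt_inv) auto
      moreover have "\<exists>n. pi_num (- I) n \<and> \<epsilon> [^] n \<in> M"
        unfolding eps2 using c a z by (intro pw el pi_elt_inv) auto
      ultimately obtain n l where "pi_num I n" "\<epsilon> [^] n \<in> M" "pi_num (- I) l" "\<epsilon> [^] l \<in> M" by blast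
      then show "\<epsilon> \<in> M"
        using subgroup_coprime_pow_mem[OF normal_imp_subgroup[OF onorm_normal[OF M(1)]] ec, of n l]
          pi_num_coprime[of I n "- I" l] by blast
    qed
    moreover have "\<epsilon> \<in> N1"
      unfolding \<epsilon>_def using mem u N(2) by (intro normal_mult[OF V1n] normal_inverse[OF V1n]) auto
    ultimately have "\<epsilon> \<in> ?V1" by blast
    then obtain e e' where e: "\<epsilon> = e \<otimes> e'" "e \<in> part ?V1 I" "e' \<in> part ?V1 (- I)"
      using part_split[OF N1(2), of \<epsilon> I] by metis
    have eec: "e \<in> carrier G" "e' \<in> carrier G" using part_pi_elt[OF e(2)] part_pi_elt[OF e(3)] by auto
    let ?W = "part ?V (- I)"
    note Wn = part_normal[OF V, of "- I"]
    note Wc = normal_in_carrier[OF Wn]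
    have a1w: "w \<otimes> a1 = a1 \<otimes> w" if "w \<in> ?W" for w
      using com[of \<one> w I a1 a2] that a ac normal_one[OF Nn] by simp
    have z1w: "w \<otimes> z1 = z1 \<otimes> w" if "w \<in> ?W" for w
      using com[of u w I z1 z2] that z u by simp
    have ew: "w \<otimes> e = e \<otimes> w" if "w \<in> ?W" for w
      using part_commute[OF N1(2), of w "- I" e I] that VV1 e by auto
    have cj: "conjg G u w = conjg G e' w" if w: "w \<in> ?W" for w
    proof -
      have u_eq: "u = inv a1 \<otimes> (e \<otimes> e') \<otimes> z1"
        using c uc by (simp add: e(1)[symmetric] \<epsilon>_def m_assoc)
      have e'w: "conjg G e' w \<in> ?W" using w eec by (intro normal_conjg[OF Wn])
      have "conjg G a1 w = w" "conjg G e w = w" "conjg G z1 (conjg G e' w) = conjg G e' w"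
        using a1w[OF w] ew[OF w] z1w[OF e'w] c eec Wc[OF w] by (simp_all add: conjg_eq_iff)
      moreover from this have "conjg G (inv a1) w = w"
        using conjg_inv_cancel(2)[of a1 w] c Wc[OF w] by simp
      moreover have "conjg G u w = conjg G z1 (conjg G e' (conjg G e (conjg G (inv a1) w)))"
        using c eec Wc[OF w] by (simp add: u_eq conjg_conjg m_assoc)
      ultimately show ?thesis by simp
    qed
    \<comment> \<open>Powers of \<open>u\<close> and \<open>e'\<close> act on \<open>?W\<close>
      alike as well. Modulo \<open>M\<close> the one has an \<open>I\<close>-number as exponent and
      the other a prime-to-\<open>I\<close> number, so the common action is trivial.\<close>
    have cjp: "conjg G (u [^] j) w = conjg G (e' [^] j) w" if w: "w \<in> ?W" for w and j :: nat
    proof (induction j)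
      case (Suc j)
      have "conjg G (e' [^] j) w \<in> ?W" using w eec by (intro normal_conjg[OF Wn]) auto
      then have "conjg G u (conjg G (e' [^] j) w) = conjg G e' (conjg G (e' [^] j) w)" by (rule cj)
      then show ?case using Suc uc eec Wc[OF w] by (simp flip: conjg_conjg)
    qed simp
    have "commutator G w u = \<one>"
    proof (rule eq_one_if_mem_all_onorm)
      fix M assume M: "onorm M"
      let ?S = "{g \<in> carrier G. \<forall>d \<in> {w}. commutator G d g \<in> M}"
      have S: "subgroup ?S G" using M Wc[OF w] by (intro subgroup_commutator_right_mem) auto
      obtain n where n: "pi_num I n" "u [^] n \<in> M" using pi_eltE[OF u(2) M] .
      obtain l where l: "pi_num (- I) l" "e' [^] l \<in> M" using pi_eltE[OF part_pi_elt[OF e(3)] M] .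
      have "e' [^] l \<in> ?S" using l M eec Wc[OF w] by (auto intro: normal_commutator_right)
      moreover have "commutator G w (e' [^] n) = commutator G w (u [^] n)"
        using cjp[OF w, of n] eec uc Wc[OF w] by (simp add: commutator_conjg)
      then have "e' [^] n \<in> ?S" using n M eec Wc[OF w] by (auto intro: normal_commutator_right)
      ultimately have "e' \<in> ?S"
        using subgroup_coprime_pow_mem[OF S eec(2)] pi_num_coprime[OF n(1) l(1)] by blast
      then show "commutator G w u \<in> M"
        using cj[OF w] eec uc Wc[OF w] by (simp add: commutator_conjg)
    qed (use uc Wc[OF w] in simp)
    then show ?thesis using uc Wc[OF w] by (simp add: commutator_eq_one_iff)
  qed
  \<comment> \<open>The criterion is applied with \<open>k = Suc m\<close>. The first
    \<open>m\<close> entries give a uniform commutator \<open>c\<close> in \<open>?V\<close>; the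
    additional one centralises the prime-to-\<open>I\<close> part of \<open>c\<close> by
    \<open>cent\<close>, so the result falls into the \<open>I\<close>-part.\<close>
  have "pi_elt I (x \<otimes> y)" if x: "x \<in> N" "pi_elt I x" and y: "y \<in> N" "pi_elt I y" for I x y
  proof (rule pi_elt_mult_if_conjugate_commutators[OF normal_imp_subgroup[OF Nn] x(1) y(1) x(2) y(2)
        part_normal[OF V, of I] part_pi_elt, where k = "Suc m"])
    fix g gs assume g: "g \<in> N" "set gs \<subseteq> N" "length gs = Suc m"
    then obtain gs' h where h: "gs = gs' @ [h]" by (metis length_0_conv nat.simps(3) rev_exhaust)
    define c where "c = lcomm G (conjg G g x) (map (\<lambda>h. conjg G h x) gs')"
    have gs: "set gs' \<subseteq> carrier G" "length gs' = m" "h \<in> N" "h \<in> carrier G" "g \<in> carrier G"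
      using g h Nc by auto
    have xc: "x \<in> carrier G" using x Nc by blast
    have "c \<in> X" unfolding c_def using gs xc by (intro uniform_commutators_conjugates) auto
    then have "c \<in> Fbar" using X_FC Fbar(3) by blast
    moreover have "c \<in> N"
      unfolding c_def using x(1) xc gs by (intro normal_lcomm[OF Nn] normal_conjg[OF Nn]) auto
    ultimately have "c \<in> ?V" by blast
    then obtain c1 c2 where c: "c = c1 \<otimes> c2" "c1 \<in> part ?V I" "c2 \<in> part ?V (- I)"
      using part_split[OF V, of c I] by metis
    have cc: "c1 \<in> carrier G" "c2 \<in> carrier G" using part_pi_elt[OF c(2)] part_pi_elt[OF c(3)] by auto
    let ?w = "conjg G h x"
    have w: "?w \<in> N" "pi_elt I ?w" "?w \<in> carrier G"
      using x gs xc by (auto intro: normal_conjg[OF Nn] pi_elt_conjg)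
    have "commutator G c2 ?w = \<one>"
      using cent[OF w(1,2) c(3)] cc w by (subst commutator_eq_one_iff) auto
    then have "commutator G c ?w = conjg G c2 (commutator G c1 ?w)"
      using cc w by (simp add: c(1) commutator_mult_left)
    also have "\<dots> \<in> part ?V I"
      using c cc w by (intro normal_conjg[OF part_normal[OF V]] normal_commutator_left[OF part_normal[OF V]])
    finally show "lcomm G (conjg G g x) (map (\<lambda>h. conjg G h x) gs) \<in> part ?V I"
      by (simp add: h c_def)
  qed
  then have "pronil N" using N(1) by (simp add: pronil_def onorm_closedin)
  then show thesis using that N(1) by blast
qed

end

subsection \<open>Elements of prime power order\<close>

context topological_group
begin

lemma onorm_finite_Inter:
  assumes "finite F" "onorm N0" "\<And>x. x \<in> F \<Longrightarrow> onorm (N x)"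
  obtains M where "onorm M" "M \<subseteq> N0" "\<forall>x \<in> F. M \<subseteq> N x"
proof -
  have "\<exists>M. onorm M \<and> M \<subseteq> N0 \<and> (\<forall>x \<in> F. M \<subseteq> N x)" using assms
  proof (induction F rule: finite_induct)
    case (insert x F)
    then obtain M where "onorm M" "M \<subseteq> N0" "\<forall>x \<in> F. M \<subseteq> N x" by auto
    then show ?case using insert.prems(2)[of x] onorm_Int[of M "N x"]
      by (intro exI[of _ "M \<inter> N x"]) auto
  qed auto
  then show thesis using that by blast
qed

lemma closedin_left_coset:
  assumes a: "a \<in> carrier G" and C: "closedin T C"
  shows "closedin T {b. \<exists>c \<in> C. b = a \<otimes> c}"
proof -
  have Cc: "C \<subseteq> carrier G" using closedin_subset[OF C] by (simp add: topspace_eq_carrier)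
  have "b \<in> {b. \<exists>c \<in> C. b = a \<otimes> c} \<longleftrightarrow> b \<in> {b \<in> topspace T. inv a \<otimes> b \<in> C}" for b
  proof
    assume "b \<in> {b. \<exists>c \<in> C. b = a \<otimes> c}"
    then show "b \<in> {b \<in> topspace T. inv a \<otimes> b \<in> C}" using a Cc by (auto simp: topspace_eq_carrier)
  next
    assume b: "b \<in> {b \<in> topspace T. inv a \<otimes> b \<in> C}"
    then have "b = a \<otimes> (inv a \<otimes> b)" using a by (simp add: topspace_eq_carrier)
    then show "b \<in> {b. \<exists>c \<in> C. b = a \<otimes> c}" using b by blast
  qed
  then have "{b. \<exists>c \<in> C. b = a \<otimes> c} = {b \<in> topspace T. inv a \<otimes> b \<in> C}" by blast
  then show ?thesis
    using a C by (simp add: closedin_continuous_map_preimage[OF continuous_left_mult])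
qed

end

section \<open>The \<open>q\<close>-elements of the group acting on an open pronilpotent
  subgroup\<close>

locale pronil_few_uniform_commutators = few_uniform_commutators +
  fixes N :: "'a set" and q :: nat
  assumes N: "onorm N" "pronil N"
begin

abbreviation E :: "'a set" where "E \<equiv> part N {q}"
abbreviation P :: "'a set" where "P \<equiv> part N (- {q})"
text \<open>All \<open>q\<close>-elements of \<open>G\<close>, a closed set but in general no
  subgroup. It is stable under right multiplication by \<open>E\<close> (see
  \<open>S_mult_E\<close>), so cosets of subgroups of \<open>E\<close> centred at
  \<open>q\<close>-elements stay inside it.\<close>

abbreviation S :: "'a set" where "S \<equiv> {x. pi_elt {q} x}"

lemmas E_normal = part_normal[OF N(2), of "{q}"]
lemmas P_normal = part_normal[OF N(2), of "- {q}"]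
lemmas E_carrier = normal_in_carrier[OF E_normal]
lemmas P_carrier = normal_in_carrier[OF P_normal]

lemma S_carrier: "S \<subseteq> carrier G"
  by auto

lemma S_mult_E: "s \<in> S \<Longrightarrow> e \<in> E \<Longrightarrow> s \<otimes> e \<in> S"
  using pi_elt_mult_normal[OF E_normal part_pi_elt] by auto

text \<open>Centres from \<open>FC\<close> force the Engel word in \<open>a\<close> onto the closure
  of \<open>P \<inter> FC\<close>. A first round of \<open>Suc m\<close> entries takes values in
  \<open>X\<close> and so leads into that closure; a second round kills the result, and coprimeness
  turns this Engel condition into commuting.\<close>

lemma ex_onorm_commuting_at:
  assumes a: "a \<in> S"
  obtains N' where "onorm N'" "N' \<subseteq> N" "\<forall>y \<in> N' \<inter> P. y \<otimes> a = a \<otimes> y"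
proof -
  have ac: "a \<in> carrier G" using a by simp
  let ?r = "replicate (Suc m) a"
  let ?A = "T closure_of (P \<inter> FC)"
  have r: "set ?r \<subseteq> carrier G" using ac by (auto simp: set_replicate_conv_if)
  have PF: "P \<inter> FC \<lhd> G" using P_normal FC_normal by (rule normal_subgroup_intersect)
  have PFA: "P \<inter> FC \<subseteq> ?A" using P_carrier by (intro closure_of_subset) (auto simp: topspace_eq_carrier)
  have AP: "?A \<subseteq> P" using closedin_part[OF N(2)] by (intro closure_of_minimal) auto
  have An: "?A \<lhd> G" by (rule normal_closure_of[OF PF])
  obtain d N1 where d: "\<forall>i < Suc 0. d i \<in> P \<inter> FC" "onorm N1"
    "\<forall>b. (\<forall>i < Suc 0. b i \<in> ?A \<and> inv (d i) \<otimes> b i \<in> N1) \<longrightarrow> lcomm G (b 0) ?r = lcomm G (d 0) ?r"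
  proof (rule locally_constant[where n = "Suc 0" and f = "\<lambda>b. lcomm G (b 0) ?r" and A = "\<lambda>_. ?A" and D = "\<lambda>_. P \<inter> FC"])
    show "?A \<noteq> {}" using normal_one[OF An] by blast
    have "continuous_map (product_topology (\<lambda>_. T) {..<Suc 0}) T
      (\<lambda>b. lcomm G (b 0) (map (\<lambda>h. h b) (replicate (Suc m) (\<lambda>b. a))))"
      using ac by (intro continuous_lcomm continuous_map_product_projection)
        (auto simp: set_replicate_conv_if topspace_eq_carrier split: if_splits)
    then show "continuous_map (product_topology (\<lambda>_. T) {..<Suc 0}) T (\<lambda>b. lcomm G (b 0) ?r)"
      by (simp only: map_replicate)
    show "{lcomm G (b 0) ?r |b. \<forall>i < Suc 0. b i \<in> ?A} \<prec> (UNIV :: nat set set)"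
    proof (rule few_subset, safe)
      fix b :: "nat \<Rightarrow> 'a" assume "\<forall>i < Suc 0. b i \<in> ?A"
      then show "lcomm G (b 0) ?r \<in> X"
        using AP P_carrier ac by (intro uniform_commutators_engel) auto
    qed
  qed (use PFA in \<open>auto simp del: replicate_Suc\<close>)
  have d0: "d 0 \<in> P" "d 0 \<in> FC" "d 0 \<in> carrier G" using d(1) P_carrier by auto
  obtain M where M: "onorm M" "\<forall>n \<in> M. \<forall>x \<in> {d 0}. n \<otimes> x = x \<otimes> n"
    using FC_common[of "{d 0}"] d0 by auto
  let ?N = "N1 \<inter> M \<inter> N"
  have N': "onorm ?N" using d(2) M(1) N(1) by (intro onorm_Int)
  note N'n = onorm_normal[OF N']
  let ?C = "{g \<in> carrier G. \<forall>n \<in> ?N. g \<otimes> n = n \<otimes> g}"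
  have engel: "lcomm G y ?r = \<one>" if y: "y \<in> ?N \<inter> ?A" for y
  proof -
    have yc: "y \<in> carrier G" using y normal_in_carrier[OF An] by blast
    have "d 0 \<otimes> y \<in> ?A" using d0 PFA y by (intro normal_mult[OF An]) auto
    moreover have "inv (d 0) \<otimes> (d 0 \<otimes> y) \<in> N1" using d0 y yc by simp
    ultimately have "lcomm G (d 0 \<otimes> y) ?r = lcomm G (d 0) ?r"
      using d(3)[THEN spec, THEN mp, of "\<lambda>_. d 0 \<otimes> y"] by blast
    moreover have "lcomm G (d 0 \<otimes> y) ?r = lcomm G (d 0) ?r \<otimes> lcomm G y ?r"
    proof (rule lcomm_mult_commuting[OF normal_centralizer[OF N'n] N'n])
      show "d 0 \<in> ?C" using d0 M(2) by auto
    qed (use r y in auto)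
    moreover have "lcomm G (d 0) ?r \<in> carrier G" "lcomm G y ?r \<in> carrier G"
      using lcomm_closed[OF d0(3) r] lcomm_closed[OF yc r] .
    ultimately show ?thesis by (metis l_cancel_one)
  qed
  have W: "?N \<inter> P \<lhd> G" using N'n P_normal by (rule normal_subgroup_intersect)
  have "y \<otimes> a = a \<otimes> y" if y: "y \<in> ?N \<inter> P" for y
  proof (rule engel_pi_part[OF normal_imp_subgroup[OF W], where J = "- {q}" and I = "{q}" and z = a and v = \<one> and j = "Suc m + Suc m"])
    show "lcomm G w (replicate (Suc m + Suc m) a) = \<one>" if w: "w \<in> ?N \<inter> P" for w
    proof -
      have "lcomm G w ?r \<in> ?N \<inter> P" using w r by (rule normal_lcomm[OF W])
      moreover have "lcomm G w ?r \<in> FC"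
        using w P_carrier ac X_FC uniform_commutators_engel[of w a m] by blast
      ultimately have "lcomm G (lcomm G w ?r) ?r = \<one>" using PFA by (intro engel) blast
      then show ?thesis by (simp only: replicate_add foldl_append)
    qed
    show "conjg G a w \<in> ?N \<inter> P" if "w \<in> ?N \<inter> P" for w using that ac by (intro normal_conjg[OF W])
    show "pi_elt (- {q}) w" if "w \<in> ?N \<inter> P" for w using that part_pi_elt by blast
  qed (use a ac y pi_elt_one in auto)
  then show thesis using that[OF N'] by blast
qed

text \<open>The \<open>P\<close>-part \<open>v\<close> of the displacement commutes with the
  \<open>q\<close>-element \<open>a \<otimes> u\<close>, and the product \<open>s\<close> is again a
  \<open>q\<close>-element, so \<open>v\<close> is trivial. Thus near \<open>a\<close> the set
  \<open>S\<close> lies in a single coset of \<open>E\<close>.\<close>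

lemma commuting_coset:
  assumes a: "a \<in> S" and N': "onorm N'" "N' \<subseteq> N" "\<forall>y \<in> N' \<inter> P. y \<otimes> a = a \<otimes> y"
    and s: "s \<in> S" "inv a \<otimes> s \<in> N'"
  shows "inv a \<otimes> s \<in> E" "\<forall>y \<in> N' \<inter> P. y \<otimes> s = s \<otimes> y"
proof -
  let ?y = "inv a \<otimes> s"
  have yN: "?y \<in> N" using s N' by blast
  obtain u v where uv: "?y = u \<otimes> v" "u \<otimes> v = v \<otimes> u" "u \<in> E" "v \<in> P"
    and K: "\<And>K. subgroup K G \<Longrightarrow> closedin T K \<Longrightarrow> ?y \<in> K \<Longrightarrow> u \<in> K \<and> v \<in> K"
    using part_split[OF N(2) yN, of "{q}"] by metis
  have v: "v \<in> N'" using K[of N'] N' s onorm_closedin by (simp add: normal_imp_subgroup)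
  have c: "a \<in> carrier G" "s \<in> carrier G" "u \<in> carrier G" "v \<in> carrier G"
    using a s E_carrier[OF uv(3)] P_carrier[OF uv(4)] by auto
  have s_eq: "s = a \<otimes> u \<otimes> v"
  proof -
    have "s = a \<otimes> ?y" using c by simp
    then show ?thesis using c by (simp add: uv(1) m_assoc)
  qed
  have E_P: "u' \<otimes> w = w \<otimes> u'" if "u' \<in> E" "w \<in> P" for u' w
    using part_commute[OF N(2) that] by blast
  have au: "w \<otimes> (a \<otimes> u) = a \<otimes> u \<otimes> w" if w: "w \<in> N' \<inter> P" for w
  proof -
    have wc: "w \<in> carrier G" using w P_carrier by blast
    have "w \<otimes> (a \<otimes> u) = (w \<otimes> a) \<otimes> u" using c wc by (simp add: m_assoc)
    also have "\<dots> = a \<otimes> (w \<otimes> u)" using N'(3) w c wc by (simp add: m_assoc)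
    also have "\<dots> = a \<otimes> (u \<otimes> w)" using E_P[OF uv(3)] w by simp
    finally show ?thesis using c wc by (simp add: m_assoc)
  qed
  have "v = \<one>"
  proof (rule pi_elt_if_mult_commuting_disjoint[of "{q}" "a \<otimes> u" "- {q}"])
    show "pi_elt {q} (a \<otimes> u)" using S_mult_E[OF a uv(3)] by simp
    show "pi_elt (- {q}) v" using uv(4) by (rule part_pi_elt)
    show "pi_elt {q} (a \<otimes> u \<otimes> v)" using s s_eq by simp
    show "a \<otimes> u \<otimes> v = v \<otimes> (a \<otimes> u)" using au[of v] v uv(4) by simp
  qed auto
  then have "?y = u" "s = a \<otimes> u" using uv(1) s_eq c by auto
  then show "?y \<in> E" "\<forall>y \<in> N' \<inter> P. y \<otimes> s = s \<otimes> y" using uv(3) au by auto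
qed

lemma ex_onorm_coset:
  assumes a: "a \<in> S"
  obtains N' where "onorm N'" "N' \<subseteq> N" "\<forall>s \<in> S. inv a \<otimes> s \<in> N' \<longrightarrow> inv a \<otimes> s \<in> E \<and> (\<forall>y \<in> N' \<inter> P. y \<otimes> s = s \<otimes> y)"
proof -
  obtain N' where "onorm N'" "N' \<subseteq> N" "\<forall>y \<in> N' \<inter> P. y \<otimes> a = a \<otimes> y"
    using ex_onorm_commuting_at[OF a] .
  then show thesis using that commuting_coset[OF a] by blast
qed

lemma ex_onorm_commuting:
  obtains N' where "onorm N'" "N' \<subseteq> N" "\<forall>s \<in> S. \<forall>y \<in> N' \<inter> P. y \<otimes> s = s \<otimes> y"
proof -
  have "\<forall>a \<in> S. \<exists>N'. onorm N' \<and> (\<forall>s \<in> S. inv a \<otimes> s \<in> N' \<longrightarrow> (\<forall>y \<in> N' \<inter> P. y \<otimes> s = s \<otimes> y))"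
    using ex_onorm_coset by metis
  then obtain C where C: "\<forall>a \<in> S. onorm (C a) \<and> (\<forall>s \<in> S. inv a \<otimes> s \<in> C a \<longrightarrow> (\<forall>y \<in> C a \<inter> P. y \<otimes> s = s \<otimes> y))"
    by (elim bchoice[THEN exE])
  have C1: "\<And>a. a \<in> S \<Longrightarrow> onorm (C a)" using C by blast
  obtain F where F: "finite F" "F \<subseteq> S" "\<forall>y \<in> S. \<exists>x \<in> F. inv x \<otimes> y \<in> C x"
    by (rule finite_coset_cover[OF closedin_pi_elt[of "{q}"] C1])
  have CF: "\<And>x. x \<in> F \<Longrightarrow> onorm (C x)" using C1 F(2) by blast
  obtain M where M: "onorm M" "M \<subseteq> N" "\<forall>x \<in> F. M \<subseteq> C x"
    by (rule onorm_finite_Inter[OF F(1) N(1) CF])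
  have "y \<otimes> s = s \<otimes> y" if s: "s \<in> S" and y: "y \<in> M \<inter> P" for s y
  proof -
    obtain x where x: "x \<in> F" "inv x \<otimes> s \<in> C x" using bspec[OF F(3) s] by (elim bexE)
    have "x \<in> S" "y \<in> C x \<inter> P" using x(1) F(2) M(3) y by auto
    then show ?thesis using bspec[OF C, of x] s x(2) by blast
  qed
  then show thesis using that M by blast
qed

section \<open>Vanishing commutators with entries among the \<open>q\<close>-elements\<close>

lemma coset_list_S:
  "coset_list G F as bs \<Longrightarrow> F \<subseteq> E \<Longrightarrow> set as \<subseteq> S \<Longrightarrow> set bs \<subseteq> S"
proof (induction as arbitrary: bs)
  case (Cons a as)
  then obtain c cs where c: "c \<in> F" "coset_list G F as cs" "bs = (a \<otimes> c) # cs"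
    by (auto simp: coset_list_Cons)
  then have "a \<otimes> c \<in> S" using Cons.prems S_mult_E[of a c] by auto
  moreover have "set cs \<subseteq> S" using Cons.IH[OF c(2)] Cons.prems by auto
  ultimately show ?case using c(3) by simp
qed simp

lemma coset_list_nth:
  "coset_list G F as bs \<longleftrightarrow> length as = length bs \<and> (\<forall>i < length as. \<exists>c \<in> F. bs ! i = as ! i \<otimes> c)"
  by (simp add: coset_list_def list_all2_conv_all_nth)

text \<open>Local constancy controls the centre only up to the chosen domains, so the given entries
  move to \<open>as'\<close> within their cosets of \<open>N0 \<inter> E\<close>.\<close>

lemma ex_killed_near:
  assumes as: "set as \<subseteq> S" "length as = m" and N0: "onorm N0"
  obtains as' N' where "onorm N'" "N' \<subseteq> N0" "coset_list G (N0 \<inter> E) as as'" "killed G (N' \<inter> E) as' = N' \<inter> E"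
proof -
  let ?F = "N0 \<inter> E"
  have F: "?F \<lhd> G" using onorm_normal[OF N0] E_normal by (rule normal_subgroup_intersect)
  note Fc = normal_in_carrier[OF F]
  have Fcl: "closedin T ?F" using onorm_closedin[OF N0] closedin_part[OF N(2)] by (rule closedin_Int)
  have asc: "set as \<subseteq> carrier G" using as S_carrier by blast
  \<comment> \<open>Index \<open>0\<close> is the first entry, taken from \<open>?F\<close> itself;
    index \<open>Suc j\<close> runs through the coset around \<open>as ! j\<close>.\<close>
  define A where "A i = (case i of 0 \<Rightarrow> ?F | Suc j \<Rightarrow> {b. \<exists>c \<in> ?F. b = as ! j \<otimes> c})" for i
  let ?f = "\<lambda>b. lcomm G (b 0) (map b [1..<Suc m])"
  have A: "closedin T (A i)" "A i \<noteq> {}" if "i < Suc m" for i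
  proof -
    show "closedin T (A i)"
      unfolding A_def using that Fcl asc as(2) by (auto split: nat.split intro!: closedin_left_coset)
    show "A i \<noteq> {}" unfolding A_def using normal_one[OF F] by (auto split: nat.split)
  qed
  have fX: "?f b \<in> X" if b: "\<forall>i < Suc m. b i \<in> A i" for b
  proof (rule uniform_commutators_prime)
    show "pi_elt {q} (b 0)" using b[rule_format, of 0] part_pi_elt by (auto simp: A_def)
    show "\<forall>y \<in> set (map b [1..<Suc m]). pi_elt {q} y"
    proof
      fix y assume "y \<in> set (map b [1..<Suc m])"
      then obtain i where "1 \<le> i" "i < Suc m" "y = b i" by (auto simp del: upt_Suc)
      then obtain j where j: "j < m" "y = b (Suc j)" by (cases i) auto
      then have "y \<in> A (Suc j)" using b by simp
      then obtain c where "c \<in> ?F" "y = as ! j \<otimes> c" by (auto simp: A_def)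
      moreover have "as ! j \<in> S" using as j nth_mem[of j as] by blast
      ultimately show "pi_elt {q} y" using S_mult_E by auto
    qed
  qed simp
  obtain a N1 where a: "\<forall>i < Suc m. a i \<in> A i" "onorm N1"
    "\<forall>b. (\<forall>i < Suc m. b i \<in> A i \<and> inv (a i) \<otimes> b i \<in> N1) \<longrightarrow> ?f b = ?f a"
  proof (rule locally_constant[where n = "Suc m" and f = ?f and A = A and D = A])
    show "A i \<subseteq> T closure_of A i" if "i < Suc m" for i using A(1)[OF that] by (simp add: closure_of_closedin)
    have "continuous_map (product_topology (\<lambda>_. T) {..<Suc m}) T (\<lambda>b. lcomm G (b 0) (map (\<lambda>h. h b) (map (\<lambda>i b. b i) [1..<Suc m])))"
      by (intro continuous_lcomm continuous_map_product_projection) (auto intro!: continuous_map_product_projection)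
    then show "continuous_map (product_topology (\<lambda>_. T) {..<Suc m}) T ?f" by (simp add: comp_def del: upt_Suc)
    show "?f b = ?f b'" if "\<forall>i < Suc m. b i = b' i" for b b'
    proof -
      have "map b [1..<Suc m] = map b' [1..<Suc m]" "b 0 = b' 0" using that by auto
      then show ?thesis by (simp only:)
    qed
    show "{?f b |b. \<forall>i < Suc m. b i \<in> A i} \<prec> (UNIV :: nat set set)"
      using fX by (intro few_subset) blast
  qed (use A in auto)
  let ?N = "N1 \<inter> N0"
  let ?as = "map a [1..<Suc m]"
  have N': "onorm ?N" using a(2) N0 by (rule onorm_Int)
  have F': "?N \<inter> E \<lhd> G" using onorm_normal[OF N'] E_normal by (rule normal_subgroup_intersect)
  have ca: "coset_list G ?F as ?as"
    unfolding coset_list_nth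
  proof (intro conjI allI impI)
    fix i assume "i < length as"
    then have i: "i < m" using as by simp
    then have "a (Suc i) \<in> A (Suc i)" using a(1) by simp
    then show "\<exists>c \<in> ?F. map a [1..<Suc m] ! i = as ! i \<otimes> c" using i by (simp add: A_def del: upt_Suc)
  qed (use as in simp)
  have asc': "set ?as \<subseteq> carrier G" by (rule coset_list_carrier[OF ca _ asc]) (use Fc in auto)
  have "killed G (?N \<inter> E) ?as = ?N \<inter> E"
  proof (rule killed_if_constant[OF F' _ asc'])
    show a0: "a 0 \<in> carrier G" using a(1)[rule_format, of 0] Fc by (auto simp: A_def)
    fix y bs assume y: "y \<in> ?N \<inter> E" and bs: "coset_list G (?N \<inter> E) ?as bs"
    define b where "b i = (case i of 0 \<Rightarrow> a 0 \<otimes> y | Suc j \<Rightarrow> bs ! j)" for i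
    have lbs: "length bs = m" using coset_list_length[OF bs] by (simp del: upt_Suc)
    have "coset_list G ?F as bs"
      using coset_list_trans[OF normal_imp_subgroup[OF F] _ asc ca bs] by blast
    then have bA: "bs ! j \<in> A (Suc j)" if "j < m" for j
      using that as by (simp add: coset_list_nth A_def)
    have bs_eq: "bs = map b [1..<Suc m]"
      by (rule nth_equalityI) (simp_all add: lbs b_def del: upt_Suc)
    have "?f b = ?f a"
    proof (rule a(3)[THEN spec, THEN mp, of b], intro allI impI conjI)
      fix i assume i: "i < Suc m"
      show "b i \<in> A i"
      proof (cases i)
        case 0
        have "a 0 \<in> ?F" "y \<in> ?F" using a(1)[rule_format, of 0] y by (auto simp: A_def)
        then show ?thesis using normal_mult[OF F] 0 by (simp add: b_def A_def)
      next
        case (Suc j)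
        then show ?thesis using i bA[of j] by (simp add: b_def)
      qed
      show "inv (a i) \<otimes> b i \<in> N1"
      proof (cases i)
        case 0
        have "y \<in> carrier G" using y E_carrier by blast
        then show ?thesis using 0 y a0 by (simp add: b_def)
      next
        case (Suc j)
        then have j: "j < m" using i by simp
        then obtain c where c: "c \<in> ?N \<inter> E" "bs ! j = a (Suc j) \<otimes> c"
          using bs by (auto simp add: coset_list_nth simp del: upt_Suc)
        have "a (Suc j) \<in> carrier G" using asc' j by (auto simp del: upt_Suc)
        moreover have "c \<in> carrier G" using c E_carrier by blast
        ultimately show ?thesis using c Suc by (simp add: b_def)
      qed
    qed
    then show "lcomm G (a 0 \<otimes> y) bs = ?f a"
      unfolding bs_eq by (simp add: b_def del: upt_Suc)
  qed
  then show thesis using that[OF N' _ ca] by blast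
qed

text \<open>The entries of \<open>as\<close> are made exact one slot at a time, at the price of moving the later ones.\<close>

lemma ex_killed_prefix:
  assumes "set pre \<subseteq> S" "set post \<subseteq> S" "length pre + length post = m" "onorm N0"
  shows "\<exists>post' N'. onorm N' \<and> N' \<subseteq> N0 \<and> coset_list G (N0 \<inter> E) post post' \<and>
    killed G (N' \<inter> E) (pre @ post') = N' \<inter> E"
  using assms
proof (induction pre arbitrary: post N0 rule: rev_induct)
  case Nil
  then have "set post \<subseteq> S" "length post = m" "onorm N0" by auto
  then obtain as' N' where "onorm N'" "N' \<subseteq> N0" "coset_list G (N0 \<inter> E) post as'" "killed G (N' \<inter> E) as' = N' \<inter> E"
    by (rule ex_killed_near)
  then show ?case by auto
next
  case (snoc g pre)
  have g: "g \<in> S" and pre: "set pre \<subseteq> S" using snoc.prems by auto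
  have nF: "M \<inter> E \<lhd> G" if "onorm M" for M
    using onorm_normal[OF that] E_normal by (rule normal_subgroup_intersect)
  have prec: "set pre \<subseteq> carrier G" "set post \<subseteq> carrier G" "g \<in> carrier G"
    using pre snoc.prems g S_carrier by auto
  have len: "length pre + length (x # ys) = m" if "length ys = length post" for x ys
    using that snoc.prems(3) by simp
  \<comment> \<open>\<open>killed_slot\<close> asks for some \<open>t\<close> such that
    \<open>t\<close> and \<open>g \<otimes> t\<close> are admissible in this slot with the same
    later entries. The first call, centred at \<open>\<one>\<close>, produces a candidate
    \<open>t0\<close>.\<close>
  have "\<exists>post' N'. onorm N' \<and> N' \<subseteq> N0 \<and> coset_list G (N0 \<inter> E) (\<one> # post) post' \<and>
    killed G (N' \<inter> E) (pre @ post') = N' \<inter> E"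
    using snoc.prems pi_elt_one by (intro snoc.IH pre len) auto
  then obtain N1 t0 post1 where 1: "onorm N1" "N1 \<subseteq> N0" "t0 \<in> N0 \<inter> E" "coset_list G (N0 \<inter> E) post post1"
    "killed G (N1 \<inter> E) (pre @ (\<one> \<otimes> t0) # post1) = N1 \<inter> E"
    by (auto simp: coset_list_Cons)
  have t0: "t0 \<in> carrier G" using 1(3) E_carrier by blast
  note post1 = coset_list_S[OF 1(4) _ snoc.prems(2)]
  \<comment> \<open>The second call is centred at \<open>g \<otimes> t0\<close> and restricted to
    \<open>N1\<close>; its shift \<open>e\<close> and its later entries then remain within the box
    of the first call.\<close>
  have "\<exists>post' N'. onorm N' \<and> N' \<subseteq> N1 \<and> coset_list G (N1 \<inter> E) ((g \<otimes> t0) # post1) post' \<and>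
    killed G (N' \<inter> E) (pre @ post') = N' \<inter> E"
  proof (intro snoc.IH pre len 1)
    show "set ((g \<otimes> t0) # post1) \<subseteq> S" using post1 S_mult_E[OF g] 1(3) by auto
    show "length post1 = length post" using coset_list_length[OF 1(4)] by simp
  qed
  then obtain N2 e post2 where 2: "onorm N2" "N2 \<subseteq> N1" "e \<in> N1 \<inter> E" "coset_list G (N1 \<inter> E) post1 post2"
    "killed G (N2 \<inter> E) (pre @ (g \<otimes> t0 \<otimes> e) # post2) = N2 \<inter> E"
    by (auto simp: coset_list_Cons)
  have e: "e \<in> carrier G" using 2(3) E_carrier by blast
  let ?t = "t0 \<otimes> e"
  have post1c: "set post1 \<subseteq> carrier G" using post1 S_carrier by blast
  have post2c: "set post2 \<subseteq> carrier G"
    by (rule coset_list_carrier[OF 2(4) _ post1c]) (use E_carrier in auto)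
  have k1: "killed G (N1 \<inter> E) (pre @ t0 # post1) = N1 \<inter> E" using 1(5) t0 by simp
  have cl: "coset_list G (N1 \<inter> E) (pre @ t0 # post1) (pre @ ?t # post2)"
    using coset_list_refl[OF normal_imp_subgroup[OF nF[OF 1(1)]] prec(1)] 2(3,4)
    unfolding coset_list_append coset_list_Cons by blast
  have "killed G (N2 \<inter> E) (pre @ ?t # post2) = N2 \<inter> E"
    by (rule killed_full_mono[OF nF[OF 1(1)] _ _ k1 cl]) (use t0 prec(1) post1c 2(2) in auto)
  moreover have "killed G (N2 \<inter> E) (pre @ (g \<otimes> ?t) # post2) = N2 \<inter> E"
    using 2(5) prec t0 e by (simp add: m_assoc)
  ultimately have k: "killed G (N2 \<inter> E) (pre @ g # map (conjg G (inv ?t)) post2) = N2 \<inter> E"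
    using prec t0 e post2c by (intro killed_slot[OF nF[OF 2(1)]]) auto
  note F0 = nF[OF snoc.prems(4)]
  have "?t \<in> N0 \<inter> E" using 1(2,3) 2(3) by (intro normal_mult[OF F0]) auto
  moreover have "coset_list G (N0 \<inter> E) post post2"
    by (rule coset_list_trans[OF normal_imp_subgroup[OF F0] _ prec(2) 1(4) 2(4)]) (use 1(2) in auto)
  ultimately have "coset_list G (N0 \<inter> E) post (map (conjg G (inv ?t)) post2)"
    using prec(2) by (intro coset_list_conjg_mem[OF F0] normal_inverse[OF F0])
  then show ?case using k 2(1,2) 1(2) by (intro exI[of _ "map (conjg G (inv ?t)) post2"] exI[of _ N2]) auto
qed

text \<open>Compactness of \<open>S\<close>, one entry after the other: by
  \<open>ex_onorm_coset\<close> the \<open>q\<close>-elements near \<open>a\<close> differ from it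
  by elements of \<open>E\<close>, so the box centred at \<open>a\<close> already contains
  them.\<close>

lemma ex_killed_suffixes:
  assumes "set pre \<subseteq> S" "length pre + j = m"
  shows "\<exists>N'. onorm N' \<and> N' \<subseteq> N \<and> (\<forall>post. set post \<subseteq> S \<and> length post = j \<longrightarrow>
    killed G (N' \<inter> E) (pre @ post) = N' \<inter> E)"
  using assms
proof (induction j arbitrary: pre)
  case 0
  then show ?case using ex_killed_prefix[of pre "[]" N] N(1) by auto
next
  case (Suc j)
  have "\<exists>N'. onorm N' \<and> (\<forall>s \<in> S. inv a \<otimes> s \<in> N' \<longrightarrow> inv a \<otimes> s \<in> E) \<and> (\<forall>post. set post \<subseteq> S \<and> length post = j \<longrightarrow>
    killed G (N' \<inter> E) (pre @ a # post) = N' \<inter> E)" if a: "a \<in> S" for a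
  proof -
    have "\<exists>N'. onorm N' \<and> N' \<subseteq> N \<and> (\<forall>post. set post \<subseteq> S \<and> length post = j \<longrightarrow>
      killed G (N' \<inter> E) ((pre @ [a]) @ post) = N' \<inter> E)"
      using Suc.prems a by (intro Suc.IH) auto
    then obtain N1 where N1: "onorm N1" "\<And>post. set post \<subseteq> S \<Longrightarrow> length post = j \<Longrightarrow>
      killed G (N1 \<inter> E) (pre @ a # post) = N1 \<inter> E" by auto
    obtain N2 where N2: "onorm N2" "\<forall>s \<in> S. inv a \<otimes> s \<in> N2 \<longrightarrow> inv a \<otimes> s \<in> E"
      using ex_onorm_coset[OF a] by metis
    have "killed G (N1 \<inter> N2 \<inter> E) (pre @ a # post) = N1 \<inter> N2 \<inter> E" if "set post \<subseteq> S" "length post = j" for post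
    proof (rule killed_full_mono[OF _ _ _ N1(2)[OF that]])
      show n: "N1 \<inter> E \<lhd> G" using onorm_normal[OF N1(1)] E_normal by (rule normal_subgroup_intersect)
      show c: "set (pre @ a # post) \<subseteq> carrier G" using Suc.prems(1) a that S_carrier by auto
      show "coset_list G (N1 \<inter> E) (pre @ a # post) (pre @ a # post)"
        by (rule coset_list_refl[OF normal_imp_subgroup[OF n] c])
    qed blast
    then show ?thesis using N1(1) N2 onorm_Int[of N1 N2] by (intro exI[of _ "N1 \<inter> N2"]) blast
  qed
  then have "\<forall>a \<in> S. \<exists>N'. onorm N' \<and> (\<forall>s \<in> S. inv a \<otimes> s \<in> N' \<longrightarrow> inv a \<otimes> s \<in> E) \<and> (\<forall>post. set post \<subseteq> S \<and> length post = j \<longrightarrow>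
    killed G (N' \<inter> E) (pre @ a # post) = N' \<inter> E)" by blast
  then obtain C where C: "\<forall>a \<in> S. onorm (C a) \<and> (\<forall>s \<in> S. inv a \<otimes> s \<in> C a \<longrightarrow> inv a \<otimes> s \<in> E) \<and> (\<forall>post. set post \<subseteq> S \<and> length post = j \<longrightarrow>
    killed G (C a \<inter> E) (pre @ a # post) = C a \<inter> E)" by (elim bchoice[THEN exE])
  have C1: "\<And>a. a \<in> S \<Longrightarrow> onorm (C a)" using C by blast
  obtain F where F: "finite F" "F \<subseteq> S" "\<forall>y \<in> S. \<exists>x \<in> F. inv x \<otimes> y \<in> C x"
    by (rule finite_coset_cover[OF closedin_pi_elt[of "{q}"] C1])
  have CF: "\<And>x. x \<in> F \<Longrightarrow> onorm (C x)" using C1 F(2) by blast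
  obtain M where M: "onorm M" "M \<subseteq> N" "\<forall>x \<in> F. M \<subseteq> C x"
    by (rule onorm_finite_Inter[OF F(1) N(1) CF])
  have "killed G (M \<inter> E) (pre @ post) = M \<inter> E" if post: "set post \<subseteq> S" "length post = Suc j" for post
  proof -
    obtain s rest where s: "post = s # rest" "s \<in> S" "set rest \<subseteq> S" "length rest = j"
      using post by (cases post) auto
    obtain x where x: "x \<in> F" "inv x \<otimes> s \<in> C x" using bspec[OF F(3) s(2)] by (elim bexE)
    have xS: "x \<in> S" using x F by blast
    have xs: "inv x \<otimes> s \<in> C x \<inter> E" using bspec[OF C xS] s(2) x(2) by blast
    have k: "killed G (C x \<inter> E) (pre @ x # rest) = C x \<inter> E" using bspec[OF C xS] s(3,4) by blast
    have n: "C x \<inter> E \<lhd> G" using onorm_normal[OF C1[OF xS]] E_normal by (rule normal_subgroup_intersect)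
    have c: "set pre \<subseteq> carrier G" "set rest \<subseteq> carrier G" "x \<in> carrier G" "s \<in> carrier G"
      using Suc.prems(1) s xS S_carrier by auto
    have "s = x \<otimes> (inv x \<otimes> s)" using c by simp
    then have cl: "coset_list G (C x \<inter> E) (pre @ x # rest) (pre @ s # rest)"
      using coset_list_refl[OF normal_imp_subgroup[OF n]] c(1,2) xs
      unfolding coset_list_append coset_list_Cons by metis
    show ?thesis
      unfolding s(1) by (rule killed_full_mono[OF n _ _ k cl]) (use M(3) x(1) c in auto)
  qed
  then show ?case using M by blast
qed

lemma ex_onorm_lcomm_trivial:
  obtains N' where "onorm N'" "N' \<subseteq> N" "\<forall>y \<in> N' \<inter> E. \<forall>ss. set ss \<subseteq> S \<and> length ss = m \<longrightarrow> lcomm G y ss = \<one>"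
proof -
  obtain N' where N': "onorm N'" "N' \<subseteq> N" "\<And>post. set post \<subseteq> S \<Longrightarrow> length post = m \<Longrightarrow>
    killed G (N' \<inter> E) post = N' \<inter> E" using ex_killed_suffixes[of "[]" m] by auto
  have n: "N' \<inter> E \<lhd> G" using onorm_normal[OF N'(1)] E_normal by (rule normal_subgroup_intersect)
  have "lcomm G y ss = \<one>" if "y \<in> N' \<inter> E" "set ss \<subseteq> S" "length ss = m" for y ss
  proof -
    have "coset_list G (N' \<inter> E) ss ss"
      using that(2) S_carrier by (intro coset_list_refl[OF normal_imp_subgroup[OF n]]) auto
    then show ?thesis using N'(3)[OF that(2,3)] that(1) unfolding killed_def by blast
  qed
  then show thesis using that[OF N'(1,2)] by blast
qed

end

subsection \<open>Openness of the upper central series\<close>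

context profinite_group
begin

text \<open>\<open>y\<close> is the infinite product of the \<open>x p\<close>, described by its
  components: it agrees with \<open>x p\<close> modulo the prime-to-\<open>p\<close> part. Finite
  products satisfy any finitely many of these closed conditions.\<close>

lemma ex_infinite_product:
  assumes N: "pronil N" and x: "\<And>p. p \<in> I \<Longrightarrow> x p \<in> part N {p}"
  obtains y where "y \<in> part N I" "\<forall>p \<in> I. inv (x p) \<otimes> y \<in> part N (- {p})"
proof -
  note pn = part_normal[OF N]
  note pc = normal_in_carrier[OF pn]
  have xc: "x p \<in> carrier G" if "p \<in> I" for p using pc[OF x[OF that]] .
  define C where "C p = {y \<in> topspace T. inv (x p) \<otimes> y \<in> part N (- {p})}" for p
  have C: "closedin T (C p)" if "p \<in> I" for p
    unfolding C_def using xc[OF that] closedin_part[OF N]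
    by (intro closedin_continuous_map_preimage[OF continuous_left_mult]) auto
  have mono: "part N J \<subseteq> part N K" if "J \<subseteq> K" for J K
    using that pi_elt_mono unfolding part_def by blast
  have fin: "\<exists>y \<in> part N J. \<forall>p \<in> J. y \<in> C p" if "finite J" "J \<subseteq> I" for J
    using that
  proof (induction J rule: finite_induct)
    case empty
    then show ?case using normal_one[OF pn] by blast
  next
    case (insert p J)
    then obtain y where y: "y \<in> part N J" "\<forall>r \<in> J. y \<in> C r" by auto
    have p: "p \<in> I" using insert.prems by simp
    have c: "x p \<in> carrier G" "y \<in> carrier G" using xc[OF p] pc[OF y(1)] .
    have "y \<otimes> x p \<in> part N (insert p J)"
      using y(1) x[OF p] mono[of J "insert p J"] mono[of "{p}" "insert p J"] by (intro normal_mult[OF pn]) auto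
    moreover have "y \<otimes> x p \<in> C r" if r: "r \<in> J" for r
    proof -
      have 1: "x p \<in> part N (- {r})" using x[OF p] mono[of "{p}" "- {r}"] r insert.hyps by auto
      have 2: "inv (x r) \<otimes> y \<in> part N (- {r})" using y(2) r by (simp add: C_def)
      have "inv (x r) \<otimes> y \<otimes> x p \<in> part N (- {r})" by (rule normal_mult[OF pn 2 1])
      then show ?thesis using c xc[of r] r insert.prems by (auto simp: C_def m_assoc topspace_eq_carrier)
    qed
    moreover have "y \<otimes> x p \<in> C p"
    proof -
      have "conjg G (x p) y \<in> part N (- {p})"
        using y(1) mono[of J "- {p}"] insert.hyps c by (intro normal_conjg[OF pn]) auto
      then show ?thesis using c by (simp add: C_def conjg_def m_assoc topspace_eq_carrier)
    qed
    ultimately show ?case by blast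
  qed
  have "\<Inter> (insert (part N I) (C ` I)) \<noteq> {}"
  proof (rule compact[unfolded compact_space_fip, rule_format], intro conjI ballI allI impI)
    fix D assume "D \<in> insert (part N I) (C ` I)"
    then show "closedin T D" using C closedin_part[OF N] by auto
  next
    fix \<F> assume F: "finite \<F> \<and> \<F> \<subseteq> insert (part N I) (C ` I)"
    then have "finite (\<F> - {part N I})" "\<F> - {part N I} \<subseteq> C ` I" by auto
    then obtain J where J: "finite J" "J \<subseteq> I" "\<F> - {part N I} = C ` J"
      by (metis finite_subset_image)
    obtain y where y: "y \<in> part N J" "\<forall>p \<in> J. y \<in> C p" using fin[OF J(1,2)] by blast
    have "y \<in> D" if "D \<in> \<F>" for D
    proof (cases "D = part N I")
      case True
      then show ?thesis using y(1) mono[OF J(2)] by blast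
    next
      case False
      then show ?thesis using y(2) J(3) that by blast
    qed
    then show "\<Inter> \<F> \<noteq> {}" by blast
  qed
  then obtain y where "y \<in> part N I" "\<forall>p \<in> I. y \<in> C p" by blast
  then show thesis using that by (auto simp: C_def)
qed

text \<open>If a coset of \<open>M\<close> separates \<open>x\<close> from \<open>K\<close>, only
  the finitely many primes dividing \<open>index M\<close> matter: the complementary part of
  \<open>x\<close> lies in \<open>M\<close>, and the other is a product of finitely many elements of
  prime power order in \<open>U\<close>.\<close>

lemma closed_subgroup_subset_if_prime_elements:
  assumes U: "subgroup U G" "closedin T U" and K: "subgroup K G" "closedin T K"
    and prim: "\<And>q x. prime q \<Longrightarrow> x \<in> U \<Longrightarrow> pi_elt {q} x \<Longrightarrow> x \<in> K"
  shows "U \<subseteq> K"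
proof
  have fin: "x \<in> K" if "finite I" "x \<in> U" "pi_elt I x" for I x
    using that
  proof (induction I arbitrary: x rule: finite_induct)
    case empty
    then have "x = \<one>" using pi_elt_disjoint_eq_one[of "{}" x "{}"] by simp
    then show ?case using K(1) by (simp add: subgroup.one_closed)
  next
    case (insert q I)
    have xc: "x \<in> carrier G" using insert.prems by simp
    obtain u v where uv: "x = u \<otimes> v" "u \<otimes> v = v \<otimes> u" "pi_elt {q} u" "pi_elt (- {q}) v"
      and par: "\<And>K. subgroup K G \<Longrightarrow> closedin T K \<Longrightarrow> x \<in> K \<Longrightarrow> u \<in> K \<and> v \<in> K"
      using ex_pi_parts[OF xc, of "{q}"] by metis
    have U': "u \<in> U" "v \<in> U" using par[OF U] insert.prems by auto
    have c: "u \<in> carrier G" "v \<in> carrier G" using uv by auto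
    have "u \<in> K"
    proof (cases "prime q")
      case True
      then show ?thesis using prim U'(1) uv(3) by blast
    next
      case False
      then have "u = \<one>" using uv(3) by (intro pi_elt_disjoint_eq_one[of "{q}" u "{q}"]) auto
      then show ?thesis using K(1) by (simp add: subgroup.one_closed)
    qed
    moreover have "v \<in> K"
    proof -
      have v: "v = inv u \<otimes> x" using c uv(1) by simp
      have "x = v \<otimes> u" using uv(1,2) by simp
      then have "x \<otimes> inv u = v" using c by (simp add: m_assoc)
      then have "inv u \<otimes> x = x \<otimes> inv u" using v by simp
      moreover have "pi_elt (insert q I) (inv u)" using uv(3) pi_elt_mono[of "{q}" u "insert q I"] pi_elt_inv by auto
      ultimately have "pi_elt (insert q I) v"
        unfolding v using insert.prems by (intro pi_elt_mult_commuting) auto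
      then have "pi_elt I v"
        using uv(4) element_primes_subset_iff[OF c(2), symmetric] by auto
      then show ?thesis using insert.IH U'(2) by blast
    qed
    ultimately show ?case unfolding uv(1) using K(1) by (intro subgroup.m_closed)
  qed
  fix x assume x: "x \<in> U"
  show "x \<in> K"
  proof (rule ccontr)
    assume xK: "x \<notin> K"
    have xc: "x \<in> carrier G" using subgroup.mem_carrier[OF U(1) x] .
    obtain M where M: "onorm M" "\<forall>m \<in> M. x \<otimes> m \<notin> K" using ex_onorm_disjoint_closed[OF K(2) xc xK] .
    define I where "I = {p. prime p \<and> p dvd index M}"
    obtain u v where uv: "x = u \<otimes> v" "u \<otimes> v = v \<otimes> u" "pi_elt I u" "pi_elt (- I) v"
      and par: "\<And>K. subgroup K G \<Longrightarrow> closedin T K \<Longrightarrow> x \<in> K \<Longrightarrow> u \<in> K \<and> v \<in> K"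
      using ex_pi_parts[OF xc, of I] by metis
    have c: "u \<in> carrier G" "v \<in> carrier G" using uv by auto
    have "finite I" unfolding I_def using index_pos[OF M(1)] by (intro finite_subset[OF _ finite_atMost[of "index M"]]) (auto dest: dvd_imp_le)
    then have "u \<in> K" using fin par[OF U x] uv(3) by blast
    moreover have "v \<in> M"
      using index_pos[OF M(1)]
      by (intro pi_elt_mem_coprime[OF uv(4) M(1) pow_index_mem[OF M(1) c(2)], of I]) (auto simp: pi_num_def I_def)
    then have "inv v \<in> M" using M(1) by (simp add: normal_inverse)
    moreover have "x \<otimes> inv v = u" using uv(1) c by (simp add: m_assoc)
    ultimately show False using M(2) by metis
  qed
qed

lemma closedin_upper_central: "closedin T (upper_central G j)"
proof (induction j)
  case 0
  then show ?case by (simp add: closedin_one)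
next
  case (Suc j)
  have "upper_central G (Suc j) = (\<Inter>g \<in> carrier G. {x \<in> topspace T. commutator G x g \<in> upper_central G j})"
    by (auto simp: topspace_eq_carrier)
  moreover have "closedin T {x \<in> topspace T. commutator G x g \<in> upper_central G j}" if "g \<in> carrier G" for g
    using Suc that by (intro closedin_continuous_map_preimage[of T T] continuous_commutator continuous_group) auto
  ultimately show ?case by (auto intro!: closedin_INT)
qed

end

section \<open>All primes together\<close>

context few_uniform_commutators
begin

text \<open>Independent tuples for infinitely many primes could be combined into products indexed by
  arbitrary sets of primes, giving continuum many uniform commutators.\<close>

lemma finite_primes_nontrivial:
  assumes N: "pronil N"
  shows "finite {q. prime q \<and> (\<exists>x xs. x \<in> part N {q} \<and> set xs \<subseteq> part N {q} \<and> length xs = m \<and> lcomm G x xs \<noteq> \<one>)}"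
    (is "finite ?Q")
proof (rule ccontr)
  assume inf: "infinite ?Q"
  note pn = part_normal[OF N]
  note pc = normal_in_carrier[OF pn]
  have mono: "part N J \<subseteq> part N K" if "J \<subseteq> K" for J K
    using that pi_elt_mono unfolding part_def by blast
  have "\<forall>q \<in> ?Q. \<exists>w. (\<forall>i < Suc m. w i \<in> part N {q}) \<and> lcomm G (w 0) (map w [1..<Suc m]) \<noteq> \<one>"
  proof
    fix q assume "q \<in> ?Q"
    then obtain x xs where x: "x \<in> part N {q}" "set xs \<subseteq> part N {q}" "length xs = m" "lcomm G x xs \<noteq> \<one>" by blast
    define w where "w i = (x # xs) ! i" for i
    have "w i \<in> part N {q}" if "i < Suc m" for i
      using x(1-3) that nth_mem[of "i - 1" xs] by (cases i) (auto simp: w_def)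
    moreover have "map w [1..<Suc m] = xs"
      by (rule nth_equalityI) (simp_all add: x(3) w_def del: upt_Suc)
    moreover have "w 0 = x" by (simp add: w_def)
    ultimately show "\<exists>w. (\<forall>i < Suc m. w i \<in> part N {q}) \<and> lcomm G (w 0) (map w [1..<Suc m]) \<noteq> \<one>"
      using x(4) by metis
  qed
  then obtain w where w: "\<forall>q \<in> ?Q. (\<forall>i < Suc m. w q i \<in> part N {q}) \<and> lcomm G (w q 0) (map (w q) [1..<Suc m]) \<noteq> \<one>"
    by (elim bchoice[THEN exE])
  \<comment> \<open>For each set \<open>I\<close> of these primes the chosen tuples are multiplied
    entry by entry over all primes of \<open>I\<close>.\<close>
  have "\<exists>y. \<forall>I \<in> Pow ?Q. \<forall>i < Suc m. y I i \<in> part N I \<and> (\<forall>p \<in> I. inv (w p i) \<otimes> y I i \<in> part N (- {p}))"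
  proof -
    have "\<exists>z. z \<in> part N I \<and> (\<forall>p \<in> I. inv (w p i) \<otimes> z \<in> part N (- {p}))" if "I \<in> Pow ?Q" "i < Suc m" for I i
    proof (rule ex_infinite_product[OF N, of I "\<lambda>p. w p i"])
      show "w p i \<in> part N {p}" if "p \<in> I" for p
        using bspec[OF w, of p] \<open>I \<in> Pow ?Q\<close> \<open>i < Suc m\<close> that by blast
    qed blast
    then show ?thesis
      by (intro exI[of _ "\<lambda>I i. SOME z. z \<in> part N I \<and> (\<forall>p \<in> I. inv (w p i) \<otimes> z \<in> part N (- {p}))"] ballI allI impI)
        (rule someI_ex)
  qed
  then obtain y where y: "\<forall>I \<in> Pow ?Q. \<forall>i < Suc m. y I i \<in> part N I \<and> (\<forall>p \<in> I. inv (w p i) \<otimes> y I i \<in> part N (- {p}))"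
    by blast
  define c where "c I = lcomm G (y I 0) (map (y I) [1..<Suc m])" for I
  have y12: "y I i \<in> part N I \<and> (\<forall>p \<in> I. inv (w p i) \<otimes> y I i \<in> part N (- {p}))"
    if "I \<subseteq> ?Q" "i < Suc m" for I i
    using bspec[OF y PowI[OF that(1)]] that(2) by blast
  have y1: "y I i \<in> part N I" if "I \<subseteq> ?Q" "i < Suc m" for I i
    using y12[OF that] by (rule conjunct1)
  have y2: "inv (w p i) \<otimes> y I i \<in> part N (- {p})" if "I \<subseteq> ?Q" "i < Suc m" "p \<in> I" for I i p
    using y12[OF that(1,2)] that(3) by blast
  have w1: "w p i \<in> part N {p}" if "I \<subseteq> ?Q" "i < Suc m" "p \<in> I" for I i p
    using bspec[OF w subsetD[OF that(1,3)]] that(2) by blast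
  have w2: "lcomm G (w q 0) (map (w q) [1..<Suc m]) \<noteq> \<one>" if "q \<in> ?Q" for q
    using bspec[OF w that] by (rule conjunct2)
  have idx: "i < Suc m" if "i \<in> set [1..<Suc m]" for i using that by auto
  \<comment> \<open>If \<open>p\<close> were missing, then \<open>w p i\<close> would be trivial,
    and with it the commutator chosen at \<open>p\<close>.\<close>
  have prim: "element_primes G T (y I i) = I" if I: "I \<subseteq> ?Q" and i: "i < Suc m" for I i
  proof
    have yc: "y I i \<in> carrier G" using pc[OF y1[OF I i]] .
    show "element_primes G T (y I i) \<subseteq> I"
      using element_primes_subset_iff[OF yc] part_pi_elt[OF y1[OF I i]] by blast
    show "I \<subseteq> element_primes G T (y I i)"
    proof (rule ccontr)
      assume "\<not> I \<subseteq> element_primes G T (y I i)"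
      then obtain p where p: "p \<in> I" "element_primes G T (y I i) \<subseteq> - {p}" by blast
      have pQ: "p \<in> ?Q" using p I by blast
      have "y I i \<in> part N (- {p})"
        using iffD1[OF element_primes_subset_iff[OF yc] p(2)] y1[OF I i] by (simp add: part_def)
      then have "y I i \<otimes> inv (inv (w p i) \<otimes> y I i) \<in> part N (- {p})"
        by (rule normal_mult[OF pn _ normal_inverse[OF pn y2[OF I i p(1)]]])
      moreover have wc: "w p i \<in> carrier G" using pc[OF w1[OF I i p(1)]] .
      moreover have "y I i \<otimes> inv (inv (w p i) \<otimes> y I i) = w p i" using wc yc by (simp add: word)
      ultimately have "w p i \<in> part N (- {p})" by simp
      then have w_one: "w p i = \<one>"
        using pi_elt_disjoint_eq_one[OF part_pi_elt[OF w1[OF I i p(1)]] part_pi_elt] by simp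
      have ws: "w p j \<in> carrier G" if "j < Suc m" for j using pc[OF w1[OF I that p(1)]] .
      have wsc: "set (map (w p) [1..<Suc m]) \<subseteq> carrier G" using ws idx by auto
      have "lcomm G (w p 0) (map (w p) [1..<Suc m]) = \<one>"
      proof (cases "i = 0")
        case True
        then show ?thesis using w_one lcomm_one[OF wsc] by simp
      next
        case False
        then have "i \<in> set [1..<Suc m]" using i by (simp del: upt_Suc)
        then have "\<one> \<in> set (map (w p) [1..<Suc m])" using w_one by (metis imageI set_map)
        then show ?thesis using lcomm_one_mem[OF _ wsc] ws by simp
      qed
      then show False using w2[OF pQ] by simp
    qed
  qed
  have ys: "set (map (y I) [1..<Suc m]) \<subseteq> carrier G" if "I \<subseteq> ?Q" for I
    using pc[OF y1[OF that]] idx by auto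
  have cX: "c I \<in> X" if I: "I \<subseteq> ?Q" for I
    unfolding c_def
  proof (rule uniform_commutatorsI)
    show "y I 0 \<in> carrier G" using pc[OF y1[OF I]] by simp
    fix z assume "z \<in> set (map (y I) [1..<Suc m])"
    then show "element_primes G T z = element_primes G T (y I 0)" using prim[OF I] idx by auto
  qed (use ys[OF I] in auto)
  \<comment> \<open>This recovers \<open>I\<close> from the value \<open>c I\<close>: modulo the
    prime-to-\<open>q\<close> part, for \<open>q\<close> in \<open>I\<close>, the value is the
    nontrivial commutator chosen at \<open>q\<close>; for other \<open>q\<close> it
    vanishes.\<close>
  have mem: "q \<in> I \<longleftrightarrow> c I \<notin> part N (- {q})" if I: "I \<subseteq> ?Q" and q: "q \<in> ?Q" for I q
  proof
    assume qI: "q \<in> I"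
    let ?R = "part N (- {q})"
    interpret h: group_hom G "G Mod ?R" "\<lambda>x. ?R #> x" by (rule mod_hom[OF pn])
    have wy: "?R #> w q i = ?R #> y I i" if i: "i < Suc m" for i
    proof -
      have cc: "w q i \<in> carrier G" "y I i \<in> carrier G" using pc w1[OF I i qI] y1[OF I i] by blast+
      have "y I i \<otimes> inv (w q i) = conjg G (inv (w q i)) (inv (w q i) \<otimes> y I i)" using cc by (simp add: word)
      also have "\<dots> \<in> ?R" using y2[OF I i qI] cc by (intro normal_conjg[OF pn]) auto
      finally have "y I i \<in> ?R #> w q i"
        using cc by (auto simp: r_coset_def m_assoc intro!: bexI[of _ "y I i \<otimes> inv (w q i)"])
      then show ?thesis using repr_independence[OF _ _ normal_imp_subgroup[OF pn]] cc by blast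
    qed
    have ws: "set (map (w q) [1..<Suc m]) \<subseteq> carrier G" "w q 0 \<in> carrier G"
      using pc[OF w1[OF I _ qI]] idx by auto
    let ?d = "lcomm G (w q 0) (map (w q) [1..<Suc m])"
    have "?R #> ?d = lcomm (G Mod ?R) (?R #> w q 0) (map (\<lambda>x. ?R #> x) (map (w q) [1..<Suc m]))"
      by (rule h.hom_lcomm[OF ws(2,1)])
    also have "\<dots> = lcomm (G Mod ?R) (?R #> y I 0) (map (\<lambda>x. ?R #> x) (map (y I) [1..<Suc m]))"
    proof -
      have "map (\<lambda>x. ?R #> x) (map (w q) [1..<Suc m]) = map (\<lambda>x. ?R #> x) (map (y I) [1..<Suc m])"
        using wy by (auto simp del: upt_Suc)
      then show ?thesis using wy[of 0] by (simp only: zero_less_Suc)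
    qed
    also have "\<dots> = ?R #> c I"
      unfolding c_def using pc[OF y1[OF I]] by (intro h.hom_lcomm[symmetric] ys[OF I]) auto
    finally have dc: "?R #> ?d = ?R #> c I" .
    show "c I \<notin> ?R"
    proof
      assume "c I \<in> ?R"
      then have "?R #> ?d = \<one>\<^bsub>G Mod ?R\<^esub>"
        unfolding dc using mod_eq_one_iff[OF pn pc] by blast
      then have "?d \<in> ?R" using mod_eq_one_iff[OF pn, of ?d] lcomm_closed[OF ws(2,1)] by blast
      moreover have "?d \<in> part N {q}" using w1[OF I _ qI] ws by (intro normal_lcomm[OF pn]) auto
      ultimately have "?d = \<one>" using pi_elt_disjoint_eq_one[OF part_pi_elt part_pi_elt] by blast
      then show False using w2[OF q] by blast
    qed
  next
    assume nc: "c I \<notin> part N (- {q})"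
    show "q \<in> I"
    proof (rule ccontr)
      assume "q \<notin> I"
      then have "y I 0 \<in> part N (- {q})" using y1[OF I, of 0] mono[of I "- {q}"] by auto
      then have "c I \<in> part N (- {q})" unfolding c_def by (intro normal_lcomm[OF pn] ys[OF I])
      then show False using nc by blast
    qed
  qed
  obtain f :: "nat \<Rightarrow> nat" where f: "inj f" "range f \<subseteq> ?Q"
    using infinite_countable_subset[OF inf] by blast
  have fQ: "f ` A \<subseteq> ?Q" for A using f(2) by blast
  have "inj (\<lambda>A. c (f ` A))"
  proof (rule injI)
    fix A B assume AB: "c (f ` A) = c (f ` B)"
    have "n \<in> A \<longleftrightarrow> n \<in> B" for n
    proof -
      have "f n \<in> ?Q" using f(2) by (rule subsetD) (rule rangeI)
      then have "f n \<in> f ` A \<longleftrightarrow> f n \<in> f ` B"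
        by (simp only: mem[OF fQ] AB)
      then show ?thesis using f(1) by (simp add: inj_image_mem_iff)
    qed
    then show "A = B" by blast
  qed
  moreover have "range (\<lambda>A. c (f ` A)) \<subseteq> X" using cX[OF fQ] by blast
  ultimately have "(UNIV :: nat set set) \<lesssim> X" unfolding lepoll_def by blast
  then show False using few lesspoll_trans2 by blast
qed

lemma ex_onorm_at_prime:
  assumes N: "onorm N" "pronil N"
  obtains N' where "onorm N'" "N' \<subseteq> N" "\<forall>s. pi_elt {q} s \<longrightarrow> (\<forall>y \<in> N' \<inter> part N (- {q}). y \<otimes> s = s \<otimes> y)"
    "\<forall>y \<in> N' \<inter> part N {q}. \<forall>ss. set ss \<subseteq> {x. pi_elt {q} x} \<and> length ss = m \<longrightarrow> lcomm G y ss = \<one>"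
proof -
  interpret p: pronil_few_uniform_commutators G T m N q
    using N by unfold_locales
  obtain N1 where N1: "onorm N1" "N1 \<subseteq> N" "\<forall>s \<in> p.S. \<forall>y \<in> N1 \<inter> p.P. y \<otimes> s = s \<otimes> y"
    by (rule p.ex_onorm_commuting)
  obtain N2 where N2: "onorm N2" "N2 \<subseteq> N"
    "\<forall>y \<in> N2 \<inter> p.E. \<forall>ss. set ss \<subseteq> p.S \<and> length ss = m \<longrightarrow> lcomm G y ss = \<one>"
    by (rule p.ex_onorm_lcomm_trivial)
  show thesis
  proof (rule that[of "N1 \<inter> N2"])
    show "onorm (N1 \<inter> N2)" using N1(1) N2(1) by (rule onorm_Int)
    show "N1 \<inter> N2 \<subseteq> N" using N1(2) by blast
    show "\<forall>s. pi_elt {q} s \<longrightarrow> (\<forall>y \<in> N1 \<inter> N2 \<inter> p.P. y \<otimes> s = s \<otimes> y)"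
      using N1(3) by simp
    show "\<forall>y \<in> N1 \<inter> N2 \<inter> p.E. \<forall>ss. set ss \<subseteq> p.S \<and> length ss = m \<longrightarrow> lcomm G y ss = \<one>"
      using N2(3) by simp
  qed
qed

text \<open>Outside the finite set \<open>B\<close> the subgroup \<open>N\<close> itself works: if
  \<open>q\<close> does not divide its index, all \<open>q\<close>-elements of \<open>G\<close> lie
  in \<open>N\<close>, so \<open>part_commute\<close> and the choice of \<open>Q\<close>
  apply.\<close>

lemma ex_onorm_all_primes:
  obtains N U where "onorm N" "pronil N" "onorm U" "U \<subseteq> N"
    "\<forall>q s y. prime q \<longrightarrow> pi_elt {q} s \<longrightarrow> y \<in> U \<longrightarrow> y \<in> part N (- {q}) \<longrightarrow> y \<otimes> s = s \<otimes> y"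
    "\<forall>q y ss. prime q \<longrightarrow> y \<in> U \<longrightarrow> y \<in> part N {q} \<longrightarrow> set ss \<subseteq> {x. pi_elt {q} x} \<longrightarrow> length ss = m \<longrightarrow> lcomm G y ss = \<one>"
proof -
  obtain N where N: "onorm N" "pronil N" by (rule ex_onorm_pronil)
  define Q where "Q = {q. prime q \<and> (\<exists>x xs. x \<in> part N {q} \<and> set xs \<subseteq> part N {q} \<and> length xs = m \<and> lcomm G x xs \<noteq> \<one>)}"
  define B where "B = Q \<union> {q. prime q \<and> q dvd index N}"
  have "finite {q. prime q \<and> q dvd index N}"
    using index_pos[OF N(1)] by (intro finite_subset[OF _ finite_atMost[of "index N"]]) (auto dest: dvd_imp_le)
  then have B: "finite B" unfolding B_def Q_def using finite_primes_nontrivial[OF N(2)] by simp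
  have "\<forall>q. \<exists>N'. onorm N' \<and> (\<forall>s. pi_elt {q} s \<longrightarrow> (\<forall>y \<in> N' \<inter> part N (- {q}). y \<otimes> s = s \<otimes> y)) \<and>
    (\<forall>y \<in> N' \<inter> part N {q}. \<forall>ss. set ss \<subseteq> {x. pi_elt {q} x} \<and> length ss = m \<longrightarrow> lcomm G y ss = \<one>)"
  proof
    fix q
    show "\<exists>N'. onorm N' \<and> (\<forall>s. pi_elt {q} s \<longrightarrow> (\<forall>y \<in> N' \<inter> part N (- {q}). y \<otimes> s = s \<otimes> y)) \<and>
      (\<forall>y \<in> N' \<inter> part N {q}. \<forall>ss. set ss \<subseteq> {x. pi_elt {q} x} \<and> length ss = m \<longrightarrow> lcomm G y ss = \<one>)"
      by (rule ex_onorm_at_prime[OF N, of q]) (intro exI conjI)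
  qed
  then obtain C where "\<forall>q. onorm (C q) \<and> (\<forall>s. pi_elt {q} s \<longrightarrow> (\<forall>y \<in> C q \<inter> part N (- {q}). y \<otimes> s = s \<otimes> y)) \<and>
    (\<forall>y \<in> C q \<inter> part N {q}. \<forall>ss. set ss \<subseteq> {x. pi_elt {q} x} \<and> length ss = m \<longrightarrow> lcomm G y ss = \<one>)"
    by (elim choice[THEN exE])
  then have C: "onorm (C q)" "pi_elt {q} s \<Longrightarrow> y \<in> C q \<Longrightarrow> y \<in> part N (- {q}) \<Longrightarrow> y \<otimes> s = s \<otimes> y"
    "y \<in> C q \<Longrightarrow> y \<in> part N {q} \<Longrightarrow> set ss \<subseteq> {x. pi_elt {q} x} \<Longrightarrow> length ss = m \<Longrightarrow> lcomm G y ss = \<one>"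
    for q s y ss by simp_all
  obtain U where U: "onorm U" "U \<subseteq> N" "\<forall>q \<in> B. U \<subseteq> C q"
    by (rule onorm_finite_Inter[OF B N(1) C(1)])
  have good: "x \<in> part N {q}" if q: "prime q" "q \<notin> B" and x: "pi_elt {q} x" for q x
  proof -
    have "\<not> q dvd index N" using q by (simp add: B_def)
    then have "pi_num (- {q}) (index N)" using index_pos[OF N(1)] by (auto simp: pi_num_def)
    then have "x \<in> N"
      using x pow_index_mem[OF N(1), of x] by (intro pi_elt_mem_coprime[OF x N(1), of "index N" "- {q}"]) auto
    then show ?thesis using x by (simp add: part_def)
  qed
  show thesis
  proof (rule that[OF N U(1,2)]; intro allI impI)
    fix q s y assume q: "prime q" "pi_elt {q} s" "y \<in> U" "y \<in> part N (- {q})"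
    show "y \<otimes> s = s \<otimes> y"
    proof (cases "q \<in> B")
      case True
      then show ?thesis using C(2)[OF q(2) _ q(4)] U(3) q(3) by blast
    next
      case False
      show ?thesis by (rule part_commute[OF N(2) q(4) good[OF q(1) False q(2)]]) simp
    qed
  next
    fix q y ss assume q: "prime q" "y \<in> U" "y \<in> part N {q}" "set ss \<subseteq> {x. pi_elt {q} x}" "length ss = m"
    show "lcomm G y ss = \<one>"
    proof (cases "q \<in> B")
      case True
      then show ?thesis using C(3)[OF _ q(3-5)] U(3) q(2) by blast
    next
      case False
      then have "set ss \<subseteq> part N {q}" using good[OF q(1) False] q(4) by blast
      moreover have "q \<notin> Q" using False by (simp add: B_def)
      ultimately show ?thesis using q(1,3,5) unfolding Q_def by blast
    qed
  qed
qed

text \<open>The \<open>g\<close> for which \<open>[y, g]\<close> lies in a given upper central term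
  form a closed subgroup, so it suffices to test elements of prime power order. At the prime of
  \<open>y\<close> the number of remaining entries drops by one; at any other prime the elements
  commute.\<close>

lemma ex_onorm_upper_central:
  obtains U where "onorm U" "U \<subseteq> upper_central G m"
proof -
  obtain N U where N: "onorm N" "pronil N" and U: "onorm U" "U \<subseteq> N"
    and comm: "\<forall>q s y. prime q \<longrightarrow> pi_elt {q} s \<longrightarrow> y \<in> U \<longrightarrow> y \<in> part N (- {q}) \<longrightarrow> y \<otimes> s = s \<otimes> y"
    and triv: "\<forall>q y ss. prime q \<longrightarrow> y \<in> U \<longrightarrow> y \<in> part N {q} \<longrightarrow> set ss \<subseteq> {x. pi_elt {q} x} \<longrightarrow> length ss = m \<longrightarrow> lcomm G y ss = \<one>"
    by (rule ex_onorm_all_primes)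
  note Un = onorm_normal[OF U(1)]
  note pn = part_normal[OF N(2)]
  have central: "y \<in> upper_central G j"
    if "prime q" "y \<in> U" "y \<in> part N {q}" "\<forall>ss. set ss \<subseteq> {x. pi_elt {q} x} \<and> length ss = j \<longrightarrow> lcomm G y ss = \<one>" for q y j
    using that
  proof (induction j arbitrary: y)
    case 0
    then show ?case by simp
  next
    case (Suc j)
    let ?Z = "upper_central G j"
    have yc: "y \<in> carrier G" using normal_in_carrier[OF Un Suc.prems(2)] .
    let ?K = "{g \<in> carrier G. \<forall>d \<in> {y}. commutator G d g \<in> ?Z}"
    have K: "subgroup ?K G" using yc upper_central_normal by (intro subgroup_commutator_right_mem) auto
    have "closedin T {g \<in> topspace T. commutator G y g \<in> ?Z}"
      using closedin_upper_central yc
      by (intro closedin_continuous_map_preimage[of T T] continuous_commutator continuous_group) auto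
    then have Kc: "closedin T ?K" by (simp add: topspace_eq_carrier)
    have "carrier G \<subseteq> ?K"
    proof (rule closed_subgroup_subset_if_prime_elements[OF subgroup_self onorm_closedin[OF onorm_carrier] K Kc])
      fix p s assume p: "prime p" "pi_elt {p} s"
      have sc: "s \<in> carrier G" using p by simp
      have "commutator G y s \<in> ?Z"
      proof (cases "p = q")
        case True
        show ?thesis
        proof (rule Suc.IH[OF Suc.prems(1)])
          show "commutator G y s \<in> U" by (rule normal_commutator_left[OF Un Suc.prems(2) sc])
          show "commutator G y s \<in> part N {q}" by (rule normal_commutator_left[OF pn Suc.prems(3) sc])
          show "\<forall>ss. set ss \<subseteq> {x. pi_elt {q} x} \<and> length ss = j \<longrightarrow> lcomm G (commutator G y s) ss = \<one>"
          proof (intro allI impI)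
            fix ss assume "set ss \<subseteq> {x. pi_elt {q} x} \<and> length ss = j"
            then show "lcomm G (commutator G y s) ss = \<one>"
              using Suc.prems(4)[rule_format, of "s # ss"] p True by simp
          qed
        qed
      next
        case False
        have "y \<in> part N (- {p})" using Suc.prems(3) False pi_elt_mono[of "{q}" y "- {p}"] by (auto simp: part_def)
        then have "commutator G y s = \<one>"
          using comm[rule_format, OF p Suc.prems(2)] yc sc by (simp add: commutator_eq_one_iff)
        then show ?thesis using normal_one[OF upper_central_normal] by simp
      qed
      then show "s \<in> ?K" using sc by simp
    qed
    then show ?case using yc by auto
  qed
  have "U \<subseteq> upper_central G m"
  proof (rule closed_subgroup_subset_if_prime_elements[OF normal_imp_subgroup[OF Un] onorm_closedin[OF U(1)]
        normal_imp_subgroup[OF upper_central_normal] closedin_upper_central])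
    fix q x assume q: "prime q" "x \<in> U" "pi_elt {q} x"
    then have "x \<in> part N {q}" using U(2) by (auto simp: part_def)
    then show "x \<in> upper_central G m" using central[OF q(1,2)] triv q(1,2) by blast
  qed
  then show thesis using that U(1) by blast
qed

text \<open>A finite set is closed in a Hausdorff space, so the finite abstract term also contains
  the closure that defines \<open>lower_central\<close>.\<close>

lemma finite_lower_central: "finite (lower_central G T (Suc m))"
proof -
  obtain U where U: "onorm U" "U \<subseteq> upper_central G m" by (rule ex_onorm_upper_central)
  have "openin T (upper_central G m)"
    by (rule open_subgroup_if_nbhd[OF normal_imp_subgroup[OF upper_central_normal] _ _ U(2)])
      (use U(1) in \<open>simp_all add: onorm_def normal_one\<close>)
  then have "finite ((\<lambda>x. upper_central G m #> x) ` carrier G)"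
    using upper_central_normal by (intro finite_cosets) (simp add: onorm_def)
  then have fin: "finite (abstract_lower_central G m)" by (rule finite_abstract_lower_central)
  let ?S = "{long_commutator G xs |xs. length xs = Suc m \<and> set xs \<subseteq> carrier G}"
  have "?S \<subseteq> abstract_lower_central G m"
  proof
    fix c assume "c \<in> ?S"
    then obtain xs where xs: "c = long_commutator G xs" "length xs = Suc m" "set xs \<subseteq> carrier G" by blast
    then obtain y ys where "xs = y # ys" by (cases xs) auto
    then show "c \<in> abstract_lower_central G m"
      using xs lcomm_in_abstract_lower_central[of y ys] by (simp add: long_commutator_def)
  qed
  then have sub: "generate G ?S \<subseteq> abstract_lower_central G m"
    by (intro generate_subgroup_incl normal_imp_subgroup[OF abstract_lower_central_normal])
  have "abstract_lower_central G m \<subseteq> topspace T"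
    using normal_in_carrier[OF abstract_lower_central_normal] by (auto simp: topspace_eq_carrier)
  then have "closedin T (abstract_lower_central G m)"
    using fin Hausdorff by (simp add: closedin_Hausdorff_finite)
  then have "T closure_of (generate G ?S) \<subseteq> abstract_lower_central G m"
    using sub by (intro closure_of_minimal)
  then show ?thesis
    using fin unfolding lower_central_def closed_generate_def by (rule finite_subset)
qed

end

context profinite_group
begin

lemma uniform_commutators_subset_lower_central:
  "uniform_commutators G T (Suc m) \<subseteq> lower_central G T (Suc m)"
proof -
  let ?S = "{long_commutator G xs |xs. length xs = Suc m \<and> set xs \<subseteq> carrier G}"
  have S: "?S \<subseteq> carrier G"
  proof
    fix c assume "c \<in> ?S"
    then obtain xs where xs: "c = long_commutator G xs" "length xs = Suc m" "set xs \<subseteq> carrier G" by blast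
    then obtain y ys where "xs = y # ys" by (cases xs) auto
    then show "c \<in> carrier G" using xs by (simp add: long_commutator_def)
  qed
  have "uniform_commutators G T (Suc m) \<subseteq> ?S" unfolding uniform_commutators_def by blast
  also have "?S \<subseteq> generate G ?S" by (auto intro: generate.incl)
  also have "\<dots> \<subseteq> T closure_of (generate G ?S)"
    using generate_in_carrier[OF S] by (intro closure_of_subset) (auto simp: topspace_eq_carrier)
  finally show ?thesis unfolding lower_central_def closed_generate_def .
qed

end

theorem theorem1p3:
  fixes G :: "('a, 'b) monoid_scheme" and T :: "'a topology" and k :: nat
  assumes "profinite_group G T"
    and "k \<ge> 1"
  shows "finite (lower_central G T k) \<longleftrightarrow>
         uniform_commutators G T k \<prec> (UNIV :: nat set set)"
proof -
  interpret profinite_group G T by (rule assms(1))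
  obtain m where k: "k = Suc m" using assms(2) by (cases k) auto
  show ?thesis
  proof
    assume "finite (lower_central G T k)"
    then have "finite (uniform_commutators G T k)"
      using uniform_commutators_subset_lower_central[of m] k finite_subset by blast
    moreover have "infinite (UNIV :: nat set set)" by (simp add: Finite_Set.finite_set)
    ultimately show "uniform_commutators G T k \<prec> (UNIV :: nat set set)"
      by (rule finite_lesspoll_infinite[rotated])
  next
    assume "uniform_commutators G T k \<prec> (UNIV :: nat set set)"
    then interpret few_uniform_commutators G T m
      using k by unfold_locales simp
    show "finite (lower_central G T k)" using finite_lower_central k by simp
  qed
qed

end
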